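(* Let $a>0$, let $\alpha$ be real with $0<|\alpha|<1$, and let $f$ and $g$ be suitably smooth functions on $[0,a]$, independent of $w$, with $g$ real-valued, $g(0)=0$ and $g'(x)>0$ for $x\in[0,a]$. Let $0=x_0<x_1<\cdots<x_n=a$ be nodes with multiplicities $m_0,\ldots,m_n\ge1$, where $m_0=m_n=s+1$ for an integer $s\ge0$, and let $M=\sum_{j=0}^n m_j-1$. Let $\{\phi_j\}_{j=1}^M$ be a Chebyshev set of functions on $[0,a]$ independent of $w$. Then for all sufficiently large $w$ each of the two linear systems $$ \frac{d^{j}\mathcal{W}[c_0,q_1]}{dx^j}(x_l)=f_1^{(j)}(x_l),\qquad j=0,\ldots,m_l-1,\ l=0,\ldots,n, $$ $$ \frac{d^{j}\mathcal{W}[d_0,\ell_1]}{dx^j}(x_l)=(-q_1g')^{(j)}(x_l),\qquad j=0,\ldots,m_l-1,\ l=0,\ldots,n, $$ where $q_1=\sum_{j=1}^M c_j\phi_j$ and $\ell_1=\sum_{j=1}^M d_j\phi_j$, has a unique solution (in the unknowns $c_0,\ldots,c_M$ and $d_0,\ldots,d_M$ respectively), and, as $w\to\infty$, $$ \int_0^a f(x)x^\alpha\log(x)\,e^{iwg(x)}\,dx-Q_{w,n}^{L,s}[f]=\mathcal{O}\bigl(\delta_\alpha(w)\,w^{-s-1-\min\{1+\alpha,1\}}\bigr). $$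
   Context: "Suitably smooth" means having as many continuous derivatives on $[0,a]$ as needed (it may be read as $C^\infty[0,a]$); the same applies to the basis functions. "Chebyshev set" is understood in the sense that counts multiplicity: every nontrivial linear combination of $\phi_1,\ldots,\phi_M$ has at most $M-1$ zeros in $[0,a]$ counted with multiplicity. Definitions. $\delta_\alpha(w)=1+|\ln w|$ if $-1<\alpha\le0$ and $\delta_\alpha(w)=1$ if $\alpha>0$. $f_1(x)=f(x)\left(\frac{x}{g(x)}\right)^\alpha$ for $x\neq0$, $f_1(0)=\frac{f(0)}{(g'(0))^\alpha}$; $f_2(x)=f(x)\log\frac{x}{g(x)}$ for $x\ne0$, $f_2(0)=f(0)\log\frac{1}{g'(0)}$. For a number $c$ and a function $q$, $$\mathcal{W}[c,q](x)=iwg'(x)c+g(x)q'(x)+[1+\alpha+iwg(x)]g'(x)q(x).$$ Levin method for the algebraic singularity: for a function $F$, put $F_1(x)=F(x)\left(\frac{x}{g(x)}\right)^\alpha$ for $x\ne 0$, $F_1(0)=F(0)/(g'(0))^\alpha$; let $\gamma_0$ and $r\in\operatorname{span}\{\phi_1,\ldots,\phi_M\}$ solve $\frac{d^j\mathcal{W}[\gamma_0,r]}{dx^j}(x_l)=F_1^{(j)}(x_l)$, $j=0,\ldots,m_l-1$, $l=0,\ldots,n$; let $H(x)=\alpha\gamma_0e^{-iwg(x)}\int_0^x\frac{g'(t)(1-e^{iwg(t)})}{g^{1-\alpha}(t)}dt$; then $$Q_{w,\alpha,n}^{L,s}[F]=\left.\left[g^{\alpha+1}(x)r(x)+\gamma_0(1-e^{-iwg(x)})g^\alpha(x)+H(x)\right]e^{iwg(x)}\right|_0^a.$$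 Levin method for the algebraic and logarithmic singularity: with $c_0,q_1,d_0,\ell_1$ from the two systems in the claim, let $$h(x)=e^{-iwg(x)}\int_0^x\bigl(\alpha c_0\log g(t)+\alpha d_0+c_0\bigr)\,g'(t)\,\frac{1-e^{iwg(t)}}{g^{1-\alpha}(t)}\,dt,$$ $$Q_{w,n}^{L,s}[f]=Q_{w,\alpha,n}^{L,s}[f_2]+\left.\left[(q_1(x)\log g(x)+\ell_1(x))g^{1+\alpha}(x)+(c_0\log g(x)+d_0)(1-e^{-iwg(x)})g^\alpha(x)+h(x)\right]e^{iwg(x)}\right|_0^a.$$ In all these formulas the value at $x=0$ is understood as the limit $x\to0^+$ (which is $0$). *)

theory Defs
  imports "HOL-Analysis.Analysis" "HOL-Library.Landau_Symbols" "HOL-Library.Extended_Nat"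
begin

text \<open>Derivatives on \<open>{0..a}\<close> are taken within the interval, hence one-sided at the
  endpoints. Values of \<open>nth_deriv_on S\<close> outside \<open>S\<close> carry no meaning and are never used.\<close>

primrec nth_deriv_on ::
  "real set \<Rightarrow> nat \<Rightarrow> (real \<Rightarrow> 'a::real_normed_vector) \<Rightarrow> real \<Rightarrow> 'a" where
  "nth_deriv_on S 0 f = f"
| "nth_deriv_on S (Suc k) f = (\<lambda>x. vector_derivative (nth_deriv_on S k f) (at x within S))"

text \<open>\<open>C\<^sup>\<infinity>\<close> on \<open>S\<close>; continuity of all the derivatives follows from differentiability.\<close>

definition smooth_on :: "real set \<Rightarrow> (real \<Rightarrow> 'a::real_normed_vector) \<Rightarrow> bool" where
  "smooth_on S f \<longleftrightarrow> (\<forall>k. \<forall>x\<in>S. nth_deriv_on S k f differentiable (at x within S))"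

text \<open>The multiplicity is infinite when all derivatives vanish at \<open>x\<close>, and it is 0 when
  \<open>x\<close> is not a zero.\<close>

definition zero_multiplicity ::
  "real set \<Rightarrow> (real \<Rightarrow> 'a::real_normed_vector) \<Rightarrow> real \<Rightarrow> enat" where
  "zero_multiplicity S u x =
     (if \<exists>k. nth_deriv_on S k u x \<noteq> 0 then enat (LEAST k. nth_deriv_on S k u x \<noteq> 0) else \<infinity>)"

definition lin_comb ::
  "nat \<Rightarrow> (nat \<Rightarrow> real \<Rightarrow> complex) \<Rightarrow> (nat \<Rightarrow> complex) \<Rightarrow> real \<Rightarrow> complex" where
  "lin_comb M \<phi> c x = (\<Sum>j=1..M. c j * \<phi> j x)"

text \<open>Coefficients are complex. For real-valued \<open>\<phi> j\<close> this is equivalent to the condition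
  with real coefficients only, by passing to real and imaginary parts.\<close>

definition chebyshev_set :: "real set \<Rightarrow> nat \<Rightarrow> (nat \<Rightarrow> real \<Rightarrow> complex) \<Rightarrow> bool" where
  "chebyshev_set S M \<phi> \<longleftrightarrow>
     (\<forall>c. (\<exists>j\<in>{1..M}. c j \<noteq> 0) \<longrightarrow>
        finite {x\<in>S. lin_comb M \<phi> c x = 0} \<and>
        (\<Sum>x\<in>{x\<in>S. lin_comb M \<phi> c x = 0}. zero_multiplicity S (lin_comb M \<phi> c) x)
          \<le> enat (M - 1))"

definition delta :: "real \<Rightarrow> real \<Rightarrow> real" where
  "delta \<alpha> w = (if \<alpha> \<le> 0 then 1 + \<bar>ln w\<bar> else 1)"

abbreviation deriv_on :: "real \<Rightarrow> (real \<Rightarrow> 'a::real_normed_vector) \<Rightarrow> real \<Rightarrow> 'a" where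
  "deriv_on a f x \<equiv> vector_derivative f (at x within {0..a})"

text \<open>The functions \<open>f\<^sub>1\<close> (also \<open>F\<^sub>1\<close> for a general \<open>F\<close>) and \<open>f\<^sub>2\<close>.\<close>

definition alg_part ::
  "real \<Rightarrow> real \<Rightarrow> (real \<Rightarrow> real) \<Rightarrow> (real \<Rightarrow> complex) \<Rightarrow> real \<Rightarrow> complex" where
  "alg_part a \<alpha> g F x =
     (if x = 0 then F 0 / complex_of_real (deriv_on a g 0 powr \<alpha>)
      else F x * complex_of_real ((x / g x) powr \<alpha>))"

definition log_part ::
  "real \<Rightarrow> (real \<Rightarrow> real) \<Rightarrow> (real \<Rightarrow> complex) \<Rightarrow> real \<Rightarrow> complex" where
  "log_part a g f x =
     (if x = 0 then f 0 * complex_of_real (ln (1 / deriv_on a g 0))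
      else f x * complex_of_real (ln (x / g x)))"

text \<open>The operator \<open>\<W>[c,q]\<close>.\<close>

definition levin_op ::
  "real \<Rightarrow> real \<Rightarrow> (real \<Rightarrow> real) \<Rightarrow> real \<Rightarrow> complex \<Rightarrow> (real \<Rightarrow> complex) \<Rightarrow> real \<Rightarrow> complex" where
  "levin_op a \<alpha> g w c q x =
     \<i> * complex_of_real w * complex_of_real (deriv_on a g x) * c
     + complex_of_real (g x) * deriv_on a q x
     + (1 + complex_of_real \<alpha> + \<i> * complex_of_real w * complex_of_real (g x))
         * complex_of_real (deriv_on a g x) * q x"

text \<open>The unknowns form a vector indexed by \<open>{0..M}\<close>, represented by an extensional function:
  \<open>c 0\<close> is the scalar unknown and \<open>c 1, \<dots>, c M\<close> are the coefficients of the function unknown.\<close>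

definition levin_system ::
  "real \<Rightarrow> real \<Rightarrow> (real \<Rightarrow> real) \<Rightarrow> nat \<Rightarrow> (nat \<Rightarrow> real) \<Rightarrow> (nat \<Rightarrow> nat) \<Rightarrow> nat \<Rightarrow>
   (nat \<Rightarrow> real \<Rightarrow> complex) \<Rightarrow> real \<Rightarrow> (real \<Rightarrow> complex) \<Rightarrow> (nat \<Rightarrow> complex) \<Rightarrow> bool" where
  "levin_system a \<alpha> g n x m M \<phi> w R c \<longleftrightarrow>
     c \<in> {0..M} \<rightarrow>\<^sub>E UNIV \<and>
     (\<forall>l\<in>{0..n}. \<forall>j<m l.
        nth_deriv_on {0..a} j (levin_op a \<alpha> g w (c 0) (lin_comb M \<phi> c)) (x l)
        = nth_deriv_on {0..a} j R (x l))"

text \<open>Meaningful only where the system has exactly one solution. The matrix of the system does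
  not depend on the right-hand side \<open>R\<close>, so unique solvability does not either (for smooth data).\<close>

definition levin_solution ::
  "real \<Rightarrow> real \<Rightarrow> (real \<Rightarrow> real) \<Rightarrow> nat \<Rightarrow> (nat \<Rightarrow> real) \<Rightarrow> (nat \<Rightarrow> nat) \<Rightarrow> nat \<Rightarrow>
   (nat \<Rightarrow> real \<Rightarrow> complex) \<Rightarrow> real \<Rightarrow> (real \<Rightarrow> complex) \<Rightarrow> nat \<Rightarrow> complex" where
  "levin_solution a \<alpha> g n x m M \<phi> w R = (THE c. levin_system a \<alpha> g n x m M \<phi> w R c)"

text \<open>The bracket \<open>E|\<^sub>0\<^sup>a\<close>, with the value at 0 read as a right-hand limit.\<close>

definition bracket :: "real \<Rightarrow> (real \<Rightarrow> complex) \<Rightarrow> complex" where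
  "bracket a E = E a - Lim (at_right 0) E"

definition levin_alg ::
  "real \<Rightarrow> real \<Rightarrow> (real \<Rightarrow> real) \<Rightarrow> nat \<Rightarrow> (nat \<Rightarrow> real) \<Rightarrow> (nat \<Rightarrow> nat) \<Rightarrow> nat \<Rightarrow>
   (nat \<Rightarrow> real \<Rightarrow> complex) \<Rightarrow> real \<Rightarrow> (real \<Rightarrow> complex) \<Rightarrow> complex" where
  "levin_alg a \<alpha> g n x m M \<phi> w F =
    (let c = levin_solution a \<alpha> g n x m M \<phi> w (alg_part a \<alpha> g F);
         \<gamma>\<^sub>0 = c 0;
         r = lin_comb M \<phi> c;
         H = (\<lambda>y. complex_of_real \<alpha> * \<gamma>\<^sub>0 * exp (- \<i> * complex_of_real w * complex_of_real (g y)) *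
               integral {0..y} (\<lambda>t. complex_of_real (deriv_on a g t) *
                 (1 - exp (\<i> * complex_of_real w * complex_of_real (g t))) /
                 complex_of_real (g t powr (1 - \<alpha>))))
     in bracket a (\<lambda>y.
          (complex_of_real (g y powr (\<alpha> + 1)) * r y
           + \<gamma>\<^sub>0 * (1 - exp (- \<i> * complex_of_real w * complex_of_real (g y))) *
               complex_of_real (g y powr \<alpha>)
           + H y) * exp (\<i> * complex_of_real w * complex_of_real (g y))))"

definition levin_log ::
  "real \<Rightarrow> real \<Rightarrow> (real \<Rightarrow> real) \<Rightarrow> nat \<Rightarrow> (nat \<Rightarrow> real) \<Rightarrow> (nat \<Rightarrow> nat) \<Rightarrow> nat \<Rightarrow>
   (nat \<Rightarrow> real \<Rightarrow> complex) \<Rightarrow> real \<Rightarrow> (real \<Rightarrow> complex) \<Rightarrow> complex" where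
  "levin_log a \<alpha> g n x m M \<phi> w f =
    (let c = levin_solution a \<alpha> g n x m M \<phi> w (alg_part a \<alpha> g f);
         c\<^sub>0 = c 0;
         q\<^sub>1 = lin_comb M \<phi> c;
         d = levin_solution a \<alpha> g n x m M \<phi> w (\<lambda>y. - q\<^sub>1 y * complex_of_real (deriv_on a g y));
         d\<^sub>0 = d 0;
         l\<^sub>1 = lin_comb M \<phi> d;
         h = (\<lambda>y. exp (- \<i> * complex_of_real w * complex_of_real (g y)) *
               integral {0..y} (\<lambda>t.
                 (complex_of_real \<alpha> * c\<^sub>0 * complex_of_real (ln (g t)) + complex_of_real \<alpha> * d\<^sub>0 + c\<^sub>0) *
                 complex_of_real (deriv_on a g t) *
                 ((1 - exp (\<i> * complex_of_real w * complex_of_real (g t))) /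
                  complex_of_real (g t powr (1 - \<alpha>)))))
     in levin_alg a \<alpha> g n x m M \<phi> w (log_part a g f)
        + bracket a (\<lambda>y.
          ((q\<^sub>1 y * complex_of_real (ln (g y)) + l\<^sub>1 y) * complex_of_real (g y powr (1 + \<alpha>))
           + (c\<^sub>0 * complex_of_real (ln (g y)) + d\<^sub>0) *
               (1 - exp (- \<i> * complex_of_real w * complex_of_real (g y))) *
               complex_of_real (g y powr \<alpha>)
           + h y) * exp (\<i> * complex_of_real w * complex_of_real (g y))))"

end

theory Submission
  imports Defs "Jordan_Normal_Form.Determinant"
begin

text \<open>Put \<open>f1 = alg_part f\<close> and \<open>f2 = alg_part (log_part f)\<close>. Since \<open>ln x = ln g + ln (x / g)\<close>, the integrand is
  \<open>g\<^sup>\<alpha> (ln g \<cdot> f1 + f2) e\<^sup>i\<^sup>w\<^sup>g\<close>. The product rule shows that the bracket of the Levin rule is an antiderivative of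
  \<open>g\<^sup>\<alpha> (ln g \<cdot> W[c, q] + W[d, l] + g' q) e\<^sup>i\<^sup>w\<^sup>g\<close> that tends to 0 at the singular endpoint; the terms with \<open>1 - e\<^sup>-\<^sup>i\<^sup>w\<^sup>g\<close>
  and the auxiliary integrals serve to represent the contribution of the scalar unknowns. Hence the quadrature
  error is itself an integral \<open>\<integral> g\<^sup>\<alpha> (ln g \<cdot> E + F) e\<^sup>i\<^sup>w\<^sup>g\<close>, where \<open>E\<close> and \<open>F\<close> are the residuals of the collocation
  systems and therefore vanish to order \<open>s + 1\<close> at both endpoints (\<open>levin_error_eq\<close>). Two facts give the rate.

  The residuals stay bounded, with all their derivatives, as \<open>w\<close> grows. The operator \<open>W[c, q] / w\<close> tends to
  \<open>\<i> g' (c + g q)\<close>. If this limit satisfies the homogeneous collocation conditions, then \<open>c = 0\<close> because \<open>g 0 = 0\<close>, and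
  \<open>q\<close> has at least \<open>M\<close> zeros: dividing by \<open>g\<close> costs one zero, and only at the left endpoint. The Chebyshev property forces
  \<open>q = 0\<close>, so the limiting matrix is invertible, the systems are uniquely solvable for large \<open>w\<close>, and their solutions
  are \<open>O(1/w)\<close> (\<open>leading_system_injective\<close>, \<open>levin_system_large_parameter\<close>). So each residual is a
  combination of fixed smooth functions with coefficients bounded in \<open>w\<close>.

  Such integrals decay (\<open>osc_integral_decay\<close>). An integration by parts against \<open>g' e\<^sup>i\<^sup>w\<^sup>g\<close> gains a factor \<open>1/w\<close>; it
  uses up one zero at the right endpoint, and at the singular endpoint either one zero or one power of \<open>g\<close>. After \<open>s + 1\<close>
  steps the amplitude is of size \<open>x\<^sup>\<alpha> (1 + \<bar>ln x\<bar>)\<close>. One more integration by parts, with phase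
  factor \<open>e\<^sup>i\<^sup>w\<^sup>g - 1\<close>, leaves an amplitude of size \<open>x\<close> to the power \<open>\<alpha> - 1\<close>, up to the logarithm, times \<open>min 1 (w x)\<close>.
  For \<open>\<alpha> > 0\<close> this is integrable uniformly in \<open>w\<close>; for \<open>\<alpha> < 0\<close> the integral concentrates near \<open>x = 1/w\<close>, and the size of the
  logarithm there is the factor \<open>1 + \<bar>ln w\<bar>\<close>.\<close>

section \<open>Smooth functions on a compact interval\<close>

text \<open>The definition applies the last derivative outermost; inductions on products and on vanishing
  orders need to peel off the first one.\<close>

lemma nth_deriv_on_Suc_deriv:
  "nth_deriv_on S (Suc k) f = nth_deriv_on S k (\<lambda>x. vector_derivative f (at x within S))"
  by (induction k) auto

lemma has_vector_derivative_cong_on: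
  fixes f h :: "real \<Rightarrow> 'a::real_normed_vector"
  assumes "\<And>x. x \<in> S \<Longrightarrow> f x = h x" and "y \<in> S"
  shows "(f has_vector_derivative D) (at y within S) \<longleftrightarrow> (h has_vector_derivative D) (at y within S)"
  using assms by (metis has_vector_derivative_transform)

lemma deriv_within_cong_on:
  fixes f h :: "real \<Rightarrow> 'a::real_normed_vector"
  assumes "\<And>x. x \<in> S \<Longrightarrow> f x = h x" and "y \<in> S"
  shows "vector_derivative f (at y within S) = vector_derivative h (at y within S)"
  unfolding vector_derivative_def using has_vector_derivative_cong_on[OF assms] by simp

lemma nth_deriv_on_cong:
  fixes f h :: "real \<Rightarrow> 'a::real_normed_vector"
  assumes "\<And>x. x \<in> S \<Longrightarrow> f x = h x" and "y \<in> S"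
  shows "nth_deriv_on S k f y = nth_deriv_on S k h y"
  using assms(2)
proof (induction k arbitrary: y)
  case 0
  then show ?case using assms(1) by simp
next
  case (Suc k)
  then show ?case by (simp add: deriv_within_cong_on[of S "nth_deriv_on S k f" "nth_deriv_on S k h"])
qed

lemma deriv_on_eqI:
  fixes f :: "real \<Rightarrow> 'a::real_normed_vector"
  assumes "0 < a" "y \<in> {0..a}" "(f has_vector_derivative D) (at y within {0..a})"
  shows "deriv_on a f y = D"
  using vector_derivative_within_cbox[of 0 a y f D] assms by simp

text \<open>A form of smoothness suited to induction: since the derivative of a product, a power or a logarithm
  is again built from such terms, closure under these operations follows from their
  derivative rules without any formula for higher derivatives.\<close>

primrec times_diff :: "real \<Rightarrow> nat \<Rightarrow> (real \<Rightarrow> 'a::real_normed_vector) \<Rightarrow> bool" where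
  "times_diff a 0 f \<longleftrightarrow> True"
| "times_diff a (Suc k) f \<longleftrightarrow>
     (\<exists>f'. (\<forall>x\<in>{0..a}. (f has_vector_derivative f' x) (at x within {0..a})) \<and> times_diff a k f')"

lemma times_diff_SucI:
  assumes "\<And>x. x \<in> {0..a} \<Longrightarrow> (f has_vector_derivative f' x) (at x within {0..a})" "times_diff a k f'"
  shows "times_diff a (Suc k) f"
  unfolding times_diff.simps by (rule exI[of _ f']) (simp add: assms del: atLeastAtMost_iff)

lemma times_diff_SucE:
  assumes "times_diff a (Suc k) f"
  obtains f' where "\<And>x. x \<in> {0..a} \<Longrightarrow> (f has_vector_derivative f' x) (at x within {0..a})" "times_diff a k f'"
  using assms unfolding times_diff.simps by blast

declare times_diff.simps(2) [simp del]

lemma smooth_on_has_deriv: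
  assumes "smooth_on {0..a} f" "x \<in> {0..a}"
  shows "(f has_vector_derivative deriv_on a f x) (at x within {0..a})"
  using assms unfolding smooth_on_def
  by (metis nth_deriv_on.simps(1) vector_derivative_works)

lemma smooth_on_deriv:
  assumes "smooth_on {0..a} f"
  shows "smooth_on {0..a} (deriv_on a f)"
  using assms unfolding smooth_on_def by (metis nth_deriv_on_Suc_deriv)

lemma smooth_on_imp_times_diff:
  "smooth_on {0..a} f \<Longrightarrow> times_diff a k f"
proof (induction k arbitrary: f)
  case (Suc k)
  show ?case
    by (rule times_diff_SucI[OF smooth_on_has_deriv[OF Suc.prems] Suc.IH[OF smooth_on_deriv[OF Suc.prems]]])
qed simp

lemma times_diff_imp_differentiable:
  assumes a: "0 < a"
  shows "times_diff a (Suc k) f \<Longrightarrow> x \<in> {0..a} \<Longrightarrow>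
    nth_deriv_on {0..a} k f differentiable (at x within {0..a})"
proof (induction k arbitrary: f x)
  case 0
  then show ?case by (auto intro: differentiableI_vector elim!: times_diff_SucE)
next
  case (Suc k)
  obtain f' where f': "\<And>x. x\<in>{0..a} \<Longrightarrow> (f has_vector_derivative f' x) (at x within {0..a})"
    and k: "times_diff a (Suc k) f'"
    using times_diff_SucE[OF Suc.prems(1)] by metis
  have "deriv_on a f x = f' x" if "x \<in> {0..a}" for x
    using deriv_on_eqI[OF a that f'[OF that]] .
  note f'_eq = this
  have eq: "nth_deriv_on {0..a} (Suc k) f x = nth_deriv_on {0..a} k f' x" if "x \<in> {0..a}" for x
    unfolding nth_deriv_on_Suc_deriv by (rule nth_deriv_on_cong[OF f'_eq that])
  have "(nth_deriv_on {0..a} k f' has_vector_derivative deriv_on a (nth_deriv_on {0..a} k f') x) (at x within {0..a})"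
    using Suc.IH[OF k Suc.prems(2)] by (simp add: vector_derivative_works)
  then have "(nth_deriv_on {0..a} (Suc k) f has_vector_derivative deriv_on a (nth_deriv_on {0..a} k f') x) (at x within {0..a})"
    using has_vector_derivative_cong_on[of "{0..a}" "nth_deriv_on {0..a} (Suc k) f" "nth_deriv_on {0..a} k f'" x, OF eq Suc.prems(2)]
    by simp
  then show ?case by (rule differentiableI_vector)
qed

lemma smooth_on_iff_times_diff:
  assumes "0 < a"
  shows "smooth_on {0..a} f \<longleftrightarrow> (\<forall>k. times_diff a k f)"
  using smooth_on_imp_times_diff times_diff_imp_differentiable[OF assms]
  unfolding smooth_on_def by blast

lemma smooth_onI:
  assumes "0 < a" "\<And>k. times_diff a k f"
  shows "smooth_on {0..a} f"
  using assms smooth_on_iff_times_diff by blast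

lemma times_diff_cong:
  assumes "\<And>x. x \<in> {0..a} \<Longrightarrow> f x = h x" "times_diff a k f"
  shows "times_diff a k h"
proof (cases k)
  case (Suc j)
  then show ?thesis using assms(2) has_vector_derivative_cong_on[of "{0..a}" f h, OF assms(1)]
    by (auto simp: times_diff.simps(2))
qed simp

lemma smooth_on_cong:
  assumes "0 < a" "\<And>x. x \<in> {0..a} \<Longrightarrow> f x = h x" "smooth_on {0..a} f"
  shows "smooth_on {0..a} h"
  using assms times_diff_cong smooth_on_iff_times_diff by metis

lemma times_diff_SucD: "times_diff a (Suc k) f \<Longrightarrow> times_diff a k f"
proof (induction k arbitrary: f)
  case (Suc k)
  obtain f' where f': "\<And>x. x \<in> {0..a} \<Longrightarrow> (f has_vector_derivative f' x) (at x within {0..a})"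
    "times_diff a (Suc k) f'"
    using times_diff_SucE[OF Suc.prems] by metis
  show ?case by (rule times_diff_SucI[OF f'(1) Suc.IH[OF f'(2)]])
qed simp

lemma times_diff_const [simp]: "times_diff a k (\<lambda>_. c)"
proof (induction k arbitrary: c)
  case (Suc k)
  then show ?case
    by (auto intro!: times_diff_SucI[of _ _ "\<lambda>_. 0"] derivative_eq_intros)
qed simp

lemma times_diff_add: "times_diff a k f \<Longrightarrow> times_diff a k h \<Longrightarrow> times_diff a k (\<lambda>x. f x + h x)"
proof (induction k arbitrary: f h)
  case (Suc k)
  then obtain f' h' where "\<forall>x\<in>{0..a}. (f has_vector_derivative f' x) (at x within {0..a})"
    "times_diff a k f'" "\<forall>x\<in>{0..a}. (h has_vector_derivative h' x) (at x within {0..a})"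
    "times_diff a k h'"
    by (auto simp: times_diff.simps(2))
  then show ?case
    by (auto intro!: times_diff_SucI[of _ _ "\<lambda>x. f' x + h' x"] derivative_eq_intros Suc.IH)
qed simp

lemma times_diff_mult:
  fixes f h :: "real \<Rightarrow> 'a::real_normed_algebra"
  shows "times_diff a k f \<Longrightarrow> times_diff a k h \<Longrightarrow> times_diff a k (\<lambda>x. f x * h x)"
proof (induction k arbitrary: f h)
  case (Suc k)
  then obtain f' h' where *: "\<forall>x\<in>{0..a}. (f has_vector_derivative f' x) (at x within {0..a})"
    "times_diff a k f'" "\<forall>x\<in>{0..a}. (h has_vector_derivative h' x) (at x within {0..a})"
    "times_diff a k h'"
    by (auto simp: times_diff.simps(2))
  have "times_diff a k (\<lambda>x. f x * h' x + f' x * h x)"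
    by (intro times_diff_add Suc.IH *(2,4) Suc.prems[THEN times_diff_SucD])
  then show ?case using *
    by (auto intro!: times_diff_SucI[of _ _ "\<lambda>x. f x * h' x + f' x * h x"] has_vector_derivative_mult)
qed simp

lemma times_diff_of_real:
  "times_diff a k f \<Longrightarrow> times_diff a k (\<lambda>x. of_real (f x) :: 'a::{real_normed_algebra_1})"
proof (induction k arbitrary: f)
  case (Suc k)
  then obtain f' where *: "\<forall>x\<in>{0..a}. (f has_vector_derivative f' x) (at x within {0..a})"
    "times_diff a k f'"
    by (auto elim!: times_diff_SucE)
  then show ?case
    by (auto intro!: times_diff_SucI[of _ _ "\<lambda>x. of_real (f' x)"] Suc.IH has_vector_derivative_of_real
        simp: has_real_derivative_iff_has_vector_derivative)
qed simp

lemma has_vector_derivative_powr: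
  fixes u :: "real \<Rightarrow> real"
  assumes "(u has_vector_derivative u') (at x within S)" "u x > 0"
  shows "((\<lambda>x. u x powr p) has_vector_derivative p * u x powr (p - 1) * u') (at x within S)"
  using DERIV_chain'[where f = u and x = x, OF _ has_real_derivative_powr[OF assms(2), of p], of u' S] assms(1)
  by (simp add: has_real_derivative_iff_has_vector_derivative)

lemma has_vector_derivative_ln:
  fixes u :: "real \<Rightarrow> real"
  assumes "(u has_vector_derivative u') (at x within S)" "u x > 0"
  shows "((\<lambda>x. ln (u x)) has_vector_derivative u' / u x) (at x within S)"
  using assms unfolding has_real_derivative_iff_has_vector_derivative[symmetric]
  by (auto intro!: derivative_eq_intros)

text \<open>The exponent has to vary in the induction, as each derivative lowers it by one.\<close>

lemma times_diff_powr:
  fixes u :: "real \<Rightarrow> real"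
  assumes "\<And>x. x \<in> {0..a} \<Longrightarrow> u x > 0"
  shows "times_diff a k u \<Longrightarrow> times_diff a k (\<lambda>x. u x powr p)"
proof (induction k arbitrary: p)
  case (Suc k)
  then obtain u' where *: "\<forall>x\<in>{0..a}. (u has_vector_derivative u' x) (at x within {0..a})"
    "times_diff a k u'"
    by (auto simp: times_diff.simps(2))
  have "times_diff a k (\<lambda>x. p * u x powr (p - 1) * u' x)"
    by (intro times_diff_mult times_diff_const Suc.IH *(2) Suc.prems[THEN times_diff_SucD])
  then show ?case using * assms
    by (auto intro!: times_diff_SucI[of _ _ "\<lambda>x. p * u x powr (p - 1) * u' x"] has_vector_derivative_powr)
qed simp

lemma times_diff_ln:
  fixes u :: "real \<Rightarrow> real"
  assumes "\<And>x. x \<in> {0..a} \<Longrightarrow> u x > 0" "times_diff a k u"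
  shows "times_diff a k (\<lambda>x. ln (u x))"
proof (cases k)
  case (Suc j)
  then obtain u' where *: "\<forall>x\<in>{0..a}. (u has_vector_derivative u' x) (at x within {0..a})"
    "times_diff a j u'"
    using assms(2) by (auto simp: times_diff.simps(2))
  have "times_diff a j u" using assms(2) Suc times_diff_SucD by blast
  from times_diff_mult[OF *(2) times_diff_powr[OF assms(1) this, of "-1"]]
  have "times_diff a j (\<lambda>x. u' x * u x powr (-1))" by simp
  then have "times_diff a j (\<lambda>x. u' x / u x)"
    by (rule times_diff_cong[rotated]) (use assms(1) in \<open>simp add: powr_minus divide_inverse less_imp_le\<close>)
  then show ?thesis using * assms(1) Suc
    by (auto intro!: times_diff_SucI[of _ _ "\<lambda>x. u' x / u x"] has_vector_derivative_ln)
qed simp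

lemma smooth_on_const: "0 < a \<Longrightarrow> smooth_on {0..a} (\<lambda>_. c)"
  by (simp add: smooth_on_iff_times_diff)

lemma smooth_on_add:
  "0 < a \<Longrightarrow> smooth_on {0..a} f \<Longrightarrow> smooth_on {0..a} h \<Longrightarrow> smooth_on {0..a} (\<lambda>x. f x + h x)"
  by (simp add: smooth_on_iff_times_diff times_diff_add)

lemma smooth_on_mult:
  fixes f h :: "real \<Rightarrow> 'a::real_normed_algebra"
  shows "0 < a \<Longrightarrow> smooth_on {0..a} f \<Longrightarrow> smooth_on {0..a} h \<Longrightarrow> smooth_on {0..a} (\<lambda>x. f x * h x)"
  by (simp add: smooth_on_iff_times_diff times_diff_mult)

lemma smooth_on_of_real:
  "0 < a \<Longrightarrow> smooth_on {0..a} f \<Longrightarrow> smooth_on {0..a} (\<lambda>x. of_real (f x) :: 'a::real_normed_algebra_1)"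
  by (simp add: smooth_on_iff_times_diff times_diff_of_real)

lemma smooth_on_powr:
  fixes u :: "real \<Rightarrow> real"
  shows "0 < a \<Longrightarrow> (\<And>x. x \<in> {0..a} \<Longrightarrow> u x > 0) \<Longrightarrow> smooth_on {0..a} u \<Longrightarrow>
    smooth_on {0..a} (\<lambda>x. u x powr p)"
  using times_diff_powr[of a u] by (auto simp: smooth_on_iff_times_diff)

lemma smooth_on_ln:
  fixes u :: "real \<Rightarrow> real"
  shows "0 < a \<Longrightarrow> (\<And>x. x \<in> {0..a} \<Longrightarrow> u x > 0) \<Longrightarrow> smooth_on {0..a} u \<Longrightarrow>
    smooth_on {0..a} (\<lambda>x. ln (u x))"
  using times_diff_ln[of a u] by (auto simp: smooth_on_iff_times_diff)

lemma smooth_on_sum: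
  "0 < a \<Longrightarrow> (\<And>i. i \<in> K \<Longrightarrow> smooth_on {0..a} (f i)) \<Longrightarrow> smooth_on {0..a} (\<lambda>x. \<Sum>i\<in>K. f i x)"
  by (induction K rule: infinite_finite_induct) (simp_all add: smooth_on_const smooth_on_add)

lemma smooth_on_imp_continuous_on:
  "smooth_on {0..a} f \<Longrightarrow> continuous_on {0..a} f"
  by (meson continuous_on_eq_continuous_within has_vector_derivative_continuous smooth_on_has_deriv)

text \<open>Hadamard's lemma: \<open>g x = x \<integral> g' (t x) dt\<close> over \<open>t\<close> in the unit interval, and this integral can be
  differentiated under the integral sign arbitrarily often. It makes \<open>x / g x\<close> smooth up to the
  singular endpoint.\<close>

lemma hadamard_quotient_smooth:
  fixes g :: "real \<Rightarrow> real"
  assumes a: "0 < a" and g: "smooth_on {0..a} g" and g0: "g 0 = 0"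
  obtains G where "smooth_on {0..a} G" "\<And>x. x \<in> {0..a} \<Longrightarrow> g x = x * G x" "G 0 = deriv_on a g 0"
proof -
  let ?S = "{0..a}"
  define D where "D k = nth_deriv_on ?S (Suc k) g" for k
  \<comment> \<open>The weight \<open>t ^ k\<close> collects the inner derivatives, so that \<open>G (Suc k)\<close> is the derivative of \<open>G k\<close>.\<close>
  define G where "G k x = integral (cbox 0 1) (\<lambda>t. t ^ k * D k (t * x))" for k and x :: real
  have tx: "t * x \<in> ?S" if "t \<in> cbox 0 1" "x \<in> ?S" for t x :: real
    using that by (auto simp: mult_left_le_one_le intro: order_trans[of _ x])
  have D: "(D k has_vector_derivative D (Suc k) x) (at x within ?S)" if "x \<in> ?S" for k x
    using g that unfolding D_def smooth_on_def
    by (metis nth_deriv_on.simps(2) vector_derivative_works)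
  have Dc: "continuous_on ?S (D k)" for k
    using D by (meson continuous_on_eq_continuous_within has_vector_derivative_continuous)
  have Dx: "continuous_on (cbox 0 1) (\<lambda>t. D k (t * x))" if "x \<in> ?S" for k x
    by (rule continuous_on_compose2[OF Dc]) (use tx that in \<open>auto intro!: continuous_intros\<close>)
  have chain: "((\<lambda>x. t ^ k * D k (t * x)) has_vector_derivative t ^ Suc k * D (Suc k) (t * x)) (at x within ?S)"
    if "x \<in> ?S" "t \<in> cbox 0 1" for k x t
  proof -
    have img: "(\<lambda>x. t * x) ` ?S \<subseteq> ?S" using tx that by auto
    have "(D k has_vector_derivative D (Suc k) (t * x)) (at (t * x) within (\<lambda>x. t * x) ` ?S)"
      by (rule has_vector_derivative_within_subset[OF D img]) (rule tx[OF that(2,1)])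
    moreover have "((\<lambda>x. t * x) has_vector_derivative t) (at x within ?S)"
      by (auto intro!: derivative_eq_intros)
    ultimately have "((D k \<circ> (\<lambda>x. t * x)) has_vector_derivative t *\<^sub>R D (Suc k) (t * x)) (at x within ?S)"
      by (intro vector_diff_chain_within)
    then have "((\<lambda>x. D k (t * x)) has_vector_derivative t * D (Suc k) (t * x)) (at x within ?S)"
      by (simp add: o_def)
    from has_vector_derivative_mult[OF has_vector_derivative_const[of "t ^ k"] this]
    show ?thesis by (simp add: mult_ac)
  qed
  have jc: "continuous_on (?S \<times> cbox 0 1) (\<lambda>(x, t). t ^ Suc k * D (Suc k) (t * x))" for k
    unfolding case_prod_unfold
    by (intro continuous_intros continuous_on_compose2[OF Dc]) (use tx in auto)
  have Gd: "(G k has_vector_derivative G (Suc k) x) (at x within ?S)" if "x \<in> ?S" for k x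
    unfolding G_def
    by (rule leibniz_rule_vector_derivative[where U = ?S])
       (use chain jc Dx that in \<open>auto intro!: integrable_continuous_real continuous_intros\<close>)
  have td: "times_diff a j (G k)" for j k
    by (induction j arbitrary: k) (auto intro: times_diff_SucI Gd)
  have G0: "smooth_on ?S (G 0)" using td a smooth_onI by blast
  have eq: "g x = x * G 0 x" if "x \<in> ?S" for x
  proof -
    have *: "((\<lambda>t. g (t * x)) has_vector_derivative x * D 0 (t * x)) (at t within {0..1})" if "t \<in> {0..1}" for t
    proof -
      have img: "(\<lambda>t. t * x) ` {0..1} \<subseteq> ?S" using tx \<open>x \<in> ?S\<close> by auto
      have "(g has_vector_derivative D 0 (t * x)) (at (t * x) within ?S)"
        using smooth_on_has_deriv[OF g] tx that \<open>x \<in> ?S\<close> unfolding D_def by auto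
      then have "(g has_vector_derivative D 0 (t * x)) (at (t * x) within (\<lambda>t. t * x) ` {0..1})"
        by (rule has_vector_derivative_within_subset[OF _ img])
      moreover have "((\<lambda>t. t * x) has_vector_derivative x) (at t within {0..1})"
        by (auto intro!: derivative_eq_intros)
      ultimately have "((g \<circ> (\<lambda>t. t * x)) has_vector_derivative x *\<^sub>R D 0 (t * x)) (at t within {0..1})"
        by (intro vector_diff_chain_within)
      then show ?thesis by (simp add: o_def)
    qed
    have "((\<lambda>t. x * D 0 (t * x)) has_integral g (1 * x) - g (0 * x)) {0..1}"
      by (rule fundamental_theorem_of_calculus) (use * in auto)
    then have "g x = integral {0..1} (\<lambda>t. x * D 0 (t * x))"
      using g0 by (simp add: integral_unique del: integral_mult_right)
    then show ?thesis unfolding G_def by simp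
  qed
  have "G 0 0 = deriv_on a g 0" unfolding G_def D_def by simp
  then show ?thesis using that G0 eq by blast
qed

section \<open>Vanishing orders\<close>

definition vanishes :: "real \<Rightarrow> real \<Rightarrow> nat \<Rightarrow> (real \<Rightarrow> 'a::real_normed_vector) \<Rightarrow> bool" where
  "vanishes a y p u \<longleftrightarrow> (\<forall>i<p. nth_deriv_on {0..a} i u y = 0)"

lemma vanishes_0 [simp]: "vanishes a y 0 u"
  by (simp add: vanishes_def)

lemma vanishes_Suc: "vanishes a y (Suc p) u \<longleftrightarrow> u y = 0 \<and> vanishes a y p (deriv_on a u)"
  unfolding vanishes_def nth_deriv_on_Suc_deriv[symmetric] by (auto simp: less_Suc_eq_0_disj)

lemma vanishes_mono: "vanishes a y q u \<Longrightarrow> p \<le> q \<Longrightarrow> vanishes a y p u"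
  by (auto simp: vanishes_def)

lemma vanishes_cong:
  assumes "\<And>x. x \<in> {0..a} \<Longrightarrow> u x = v x" "y \<in> {0..a}" "vanishes a y p u"
  shows "vanishes a y p v"
  using assms(3) nth_deriv_on_cong[of "{0..a}" u v y, OF assms(1,2)] by (simp add: vanishes_def)

lemma deriv_on_add:
  assumes "0 < a" "smooth_on {0..a} f" "smooth_on {0..a} h" "x \<in> {0..a}"
  shows "deriv_on a (\<lambda>x. f x + h x) x = deriv_on a f x + deriv_on a h x"
  by (rule deriv_on_eqI[OF assms(1,4)], rule has_vector_derivative_add)
     (rule smooth_on_has_deriv[OF assms(2,4)], rule smooth_on_has_deriv[OF assms(3,4)])

lemma deriv_on_mult:
  fixes f h :: "real \<Rightarrow> 'a::real_normed_algebra"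
  assumes "0 < a" "smooth_on {0..a} f" "smooth_on {0..a} h" "x \<in> {0..a}"
  shows "deriv_on a (\<lambda>x. f x * h x) x = f x * deriv_on a h x + deriv_on a f x * h x"
  by (rule deriv_on_eqI[OF assms(1,4)], rule has_vector_derivative_mult)
     (rule smooth_on_has_deriv[OF assms(2,4)], rule smooth_on_has_deriv[OF assms(3,4)])

lemma deriv_on_of_real:
  fixes f :: "real \<Rightarrow> real"
  assumes "0 < a" "smooth_on {0..a} f" "x \<in> {0..a}"
  shows "deriv_on a (\<lambda>x. of_real (f x) :: complex) x = of_real (deriv_on a f x)"
  using smooth_on_has_deriv[OF assms(2,3)]
  by (intro deriv_on_eqI[OF assms(1,3)] has_vector_derivative_of_real)
     (simp add: has_real_derivative_iff_has_vector_derivative)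

lemma deriv_on_const: "0 < a \<Longrightarrow> x \<in> {0..a} \<Longrightarrow> deriv_on a (\<lambda>_. c) x = 0"
  by (rule deriv_on_eqI) auto

lemma nth_deriv_on_add:
  assumes "0 < a"
  shows "smooth_on {0..a} f \<Longrightarrow> smooth_on {0..a} h \<Longrightarrow> x \<in> {0..a} \<Longrightarrow>
    nth_deriv_on {0..a} k (\<lambda>x. f x + h x) x = nth_deriv_on {0..a} k f x + nth_deriv_on {0..a} k h x"
proof (induction k arbitrary: f h)
  case (Suc k)
  have "nth_deriv_on {0..a} (Suc k) (\<lambda>x. f x + h x) x =
    nth_deriv_on {0..a} k (\<lambda>x. deriv_on a f x + deriv_on a h x) x"
    unfolding nth_deriv_on_Suc_deriv using deriv_on_add[OF assms Suc.prems(1,2)] Suc.prems(3)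
    by (intro nth_deriv_on_cong)
  then show ?case
    unfolding nth_deriv_on_Suc_deriv by (simp only: Suc.IH[OF Suc.prems(1,2)[THEN smooth_on_deriv] Suc.prems(3)])
qed simp

lemma nth_deriv_on_cmult:
  fixes f :: "real \<Rightarrow> complex"
  assumes a: "0 < a" and x: "x \<in> {0..a}"
  shows "smooth_on {0..a} f \<Longrightarrow> nth_deriv_on {0..a} k (\<lambda>x. c * f x) x = c * nth_deriv_on {0..a} k f x"
proof (induction k arbitrary: f)
  case (Suc k)
  have "nth_deriv_on {0..a} (Suc k) (\<lambda>x. c * f x) x = nth_deriv_on {0..a} k (\<lambda>x. c * deriv_on a f x) x"
    unfolding nth_deriv_on_Suc_deriv
    by (rule nth_deriv_on_cong[OF _ x])
       (simp add: deriv_on_mult[OF a smooth_on_const[OF a] Suc.prems] deriv_on_const[OF a])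
  then show ?case
    unfolding nth_deriv_on_Suc_deriv using Suc.IH[OF smooth_on_deriv[OF Suc.prems]] by simp
qed simp

lemma nth_deriv_on_zero: "0 < a \<Longrightarrow> x \<in> {0..a} \<Longrightarrow> nth_deriv_on {0..a} k (\<lambda>_. 0 :: complex) x = 0"
  using nth_deriv_on_cmult[of a x "\<lambda>_. 0" k 0] by (simp add: smooth_on_const)

lemma nth_deriv_on_lin_comb:
  fixes f :: "'i \<Rightarrow> real \<Rightarrow> complex"
  assumes a: "0 < a" and x: "x \<in> {0..a}"
  shows "(\<And>i. i \<in> I \<Longrightarrow> smooth_on {0..a} (f i)) \<Longrightarrow>
    nth_deriv_on {0..a} k (\<lambda>x. \<Sum>i\<in>I. c i * f i x) x = (\<Sum>i\<in>I. c i * nth_deriv_on {0..a} k (f i) x)"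
proof (induction I rule: infinite_finite_induct)
  case (insert i I)
  have "smooth_on {0..a} (\<lambda>x. c i * f i x)" "smooth_on {0..a} (\<lambda>x. \<Sum>i\<in>I. c i * f i x)"
    using insert.prems by (auto intro!: smooth_on_mult smooth_on_sum smooth_on_const a)
  from nth_deriv_on_add[OF a this x, of k] insert show ?case
    by (simp add: nth_deriv_on_cmult[OF a x])
qed (simp_all add: nth_deriv_on_zero[OF a x])

lemma vanishes_add:
  assumes "0 < a" "smooth_on {0..a} f" "smooth_on {0..a} h" "y \<in> {0..a}"
    "vanishes a y p f" "vanishes a y p h"
  shows "vanishes a y p (\<lambda>x. f x + h x)"
  using assms(5,6) nth_deriv_on_add[OF assms(1-4)] by (simp add: vanishes_def)

lemma vanishes_mult:
  fixes u v :: "real \<Rightarrow> 'a::real_normed_algebra"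
  assumes a: "0 < a" and y: "y \<in> {0..a}"
  shows "smooth_on {0..a} u \<Longrightarrow> smooth_on {0..a} v \<Longrightarrow> vanishes a y p u \<Longrightarrow> vanishes a y p (\<lambda>x. u x * v x)"
proof (induction p arbitrary: u v)
  case (Suc p)
  have du: "smooth_on {0..a} (deriv_on a u)" "smooth_on {0..a} (deriv_on a v)"
    using Suc.prems smooth_on_deriv by blast+
  have "vanishes a y p (\<lambda>x. u x * deriv_on a v x + deriv_on a u x * v x)"
    by (intro vanishes_add smooth_on_mult a y Suc.IH Suc.prems du)
       (use Suc.prems(3) vanishes_Suc vanishes_mono[of a y "Suc p" u p] in auto)
  then have "vanishes a y p (deriv_on a (\<lambda>x. u x * v x))"
    using deriv_on_mult[OF a Suc.prems(1,2)] y
    by (auto intro: vanishes_cong[rotated 2])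
  then show ?case using Suc.prems(3) by (simp add: vanishes_Suc)
qed simp

text \<open>All Leibniz terms but the leading one contain a derivative of \<open>u\<close> of order below \<open>p\<close>, which is zero at
  \<open>y\<close>.\<close>

lemma nth_deriv_on_mult_vanishes:
  fixes u v :: "real \<Rightarrow> 'a::real_normed_algebra"
  assumes a: "0 < a" and y: "y \<in> {0..a}"
  shows "smooth_on {0..a} u \<Longrightarrow> smooth_on {0..a} v \<Longrightarrow> vanishes a y p u \<Longrightarrow>
    nth_deriv_on {0..a} p (\<lambda>x. v x * u x) y = v y * nth_deriv_on {0..a} p u y"
proof (induction p arbitrary: u v)
  case (Suc p)
  have du: "smooth_on {0..a} (deriv_on a u)" "smooth_on {0..a} (deriv_on a v)"
    using Suc.prems smooth_on_deriv by blast+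
  have van: "vanishes a y p (deriv_on a u)" "vanishes a y p u" "nth_deriv_on {0..a} p u y = 0"
    using Suc.prems(3) by (auto simp: vanishes_Suc[symmetric] vanishes_def simp del: nth_deriv_on.simps(2))
       (simp add: nth_deriv_on_Suc_deriv[symmetric] del: nth_deriv_on.simps(2))
  have "nth_deriv_on {0..a} (Suc p) (\<lambda>x. v x * u x) y
      = nth_deriv_on {0..a} p (\<lambda>x. v x * deriv_on a u x + deriv_on a v x * u x) y"
    unfolding nth_deriv_on_Suc_deriv using deriv_on_mult[OF a Suc.prems(2,1)] y
    by (intro nth_deriv_on_cong)
  also have "\<dots> = v y * nth_deriv_on {0..a} p (deriv_on a u) y + deriv_on a v y * nth_deriv_on {0..a} p u y"
    using nth_deriv_on_add[OF a smooth_on_mult[OF a Suc.prems(2) du(1)] smooth_on_mult[OF a du(2) Suc.prems(1)] y, of p]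
      Suc.IH[OF du(1) Suc.prems(2) van(1)] Suc.IH[OF Suc.prems(1) du(2) van(2)]
    by simp
  finally show ?case using van(3) by (simp only: nth_deriv_on_Suc_deriv mult_zero_right add_0_right)
qed simp

text \<open>If \<open>v\<close> has a zero and \<open>u\<close> has a zero of order \<open>p\<close>, the only surviving Leibniz terms have exactly one
  derivative on \<open>v\<close>, and there are \<open>Suc p\<close> of them.\<close>

lemma nth_deriv_on_mult_simple_zero:
  fixes u v :: "real \<Rightarrow> complex"
  assumes a: "0 < a" and y: "y \<in> {0..a}" and v: "smooth_on {0..a} v" "v y = 0"
  shows "smooth_on {0..a} u \<Longrightarrow> vanishes a y p u \<Longrightarrow>
    nth_deriv_on {0..a} (Suc p) (\<lambda>x. v x * u x) y = of_nat (Suc p) * deriv_on a v y * nth_deriv_on {0..a} p u y"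
proof (induction p arbitrary: u)
  case 0
  then show ?case using deriv_on_mult[OF a v(1) 0(1) y] v(2) by simp
next
  case (Suc p)
  have du: "smooth_on {0..a} (deriv_on a u)" "smooth_on {0..a} (deriv_on a v)"
    using Suc.prems v smooth_on_deriv by blast+
  have van: "vanishes a y p (deriv_on a u)" using Suc.prems(2) by (simp add: vanishes_Suc)
  have "nth_deriv_on {0..a} (Suc (Suc p)) (\<lambda>x. v x * u x) y
      = nth_deriv_on {0..a} (Suc p) (\<lambda>x. v x * deriv_on a u x + deriv_on a v x * u x) y"
    unfolding nth_deriv_on_Suc_deriv[of _ "Suc p"] using deriv_on_mult[OF a v(1) Suc.prems(1)] y
    by (intro nth_deriv_on_cong)
  also have "\<dots> = of_nat (Suc p) * deriv_on a v y * nth_deriv_on {0..a} p (deriv_on a u) y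
      + deriv_on a v y * nth_deriv_on {0..a} (Suc p) u y"
    using nth_deriv_on_add[OF a smooth_on_mult[OF a v(1) du(1)] smooth_on_mult[OF a du(2) Suc.prems(1)] y, of "Suc p"]
      Suc.IH[OF du(1) van] nth_deriv_on_mult_vanishes[OF a y Suc.prems(1) du(2) Suc.prems(2)]
    by (simp only:)
  also have "\<dots> = of_nat (Suc (Suc p)) * deriv_on a v y * nth_deriv_on {0..a} (Suc p) u y"
    by (simp only: nth_deriv_on_Suc_deriv) (simp add: algebra_simps)
  finally show ?case .
qed

lemma vanishes_cancel_simple_zero:
  fixes u v :: "real \<Rightarrow> complex"
  assumes a: "0 < a" and y: "y \<in> {0..a}" and v: "smooth_on {0..a} v" "v y = 0" "deriv_on a v y \<noteq> 0"
    and u: "smooth_on {0..a} u"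
  shows "vanishes a y (Suc p) (\<lambda>x. v x * u x) \<Longrightarrow> vanishes a y p u"
proof (induction p)
  case (Suc p)
  then have IH: "vanishes a y p u" using vanishes_mono by (metis le_Suc_eq)
  have "nth_deriv_on {0..a} (Suc p) (\<lambda>x. v x * u x) y = 0"
    using Suc.prems unfolding vanishes_def by blast
  then have "nth_deriv_on {0..a} p u y = 0"
    using nth_deriv_on_mult_simple_zero[OF a y v(1,2) u IH] v(3) by (simp del: of_nat_Suc nth_deriv_on.simps)
  then show ?case using IH by (auto simp: vanishes_def less_Suc_eq)
qed simp

lemma vanishes_cancel_nonzero:
  fixes u v :: "real \<Rightarrow> complex"
  assumes a: "0 < a" and y: "y \<in> {0..a}" and v: "smooth_on {0..a} v" "v y \<noteq> 0"
    and u: "smooth_on {0..a} u"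
  shows "vanishes a y p (\<lambda>x. v x * u x) \<Longrightarrow> vanishes a y p u"
proof (induction p)
  case (Suc p)
  have IH: "vanishes a y p u" using Suc.IH vanishes_mono[OF Suc.prems, of p] by simp
  have "nth_deriv_on {0..a} p (\<lambda>x. v x * u x) y = 0"
    using Suc.prems unfolding vanishes_def by blast
  then have "nth_deriv_on {0..a} p u y = 0"
    using nth_deriv_on_mult_vanishes[OF a y u v(1) IH] v(2) by simp
  then show ?case using IH by (auto simp: vanishes_def less_Suc_eq)
qed simp

lemma vanishes_diffI:
  fixes u v :: "real \<Rightarrow> complex"
  assumes a: "0 < a" and y: "y \<in> {0..a}" and u: "smooth_on {0..a} u" and v: "smooth_on {0..a} v"
    and eq: "\<And>j. j < p \<Longrightarrow> nth_deriv_on {0..a} j v y = nth_deriv_on {0..a} j u y"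
  shows "vanishes a y p (\<lambda>x. u x - v x)"
proof -
  have "nth_deriv_on {0..a} j (\<lambda>x. u x + (-1) * v x) y = nth_deriv_on {0..a} j u y + (-1) * nth_deriv_on {0..a} j v y" for j
    using nth_deriv_on_add[OF a u smooth_on_mult[OF a smooth_on_const[OF a] v] y, of j "-1"]
    by (simp only: nth_deriv_on_cmult[OF a y v])
  then show ?thesis using eq by (simp add: vanishes_def)
qed

section \<open>Bounded combinations of fixed smooth functions\<close>

text \<open>Families that depend on the parameter \<open>w\<close> only through bounded scalar coefficients. This structure survives
  differentiation and multiplication by a fixed smooth function, and it bounds
  every derivative uniformly in \<open>w\<close>. The rule \<open>cong\<close> discards values outside the interval, where one-sided
  derivatives carry no meaning.\<close>

inductive bounded_comb :: "real \<Rightarrow> real set \<Rightarrow> (real \<Rightarrow> real \<Rightarrow> complex) \<Rightarrow> bool" for a W where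
  single: "smooth_on {0..a} \<psi> \<Longrightarrow> bounded (b ` W) \<Longrightarrow> bounded_comb a W (\<lambda>w x. b w * \<psi> x)"
| add: "bounded_comb a W E \<Longrightarrow> bounded_comb a W F \<Longrightarrow> bounded_comb a W (\<lambda>w x. E w x + F w x)"
| cong: "bounded_comb a W E \<Longrightarrow> (\<And>w x. w \<in> W \<Longrightarrow> x \<in> {0..a} \<Longrightarrow> E w x = F w x) \<Longrightarrow> bounded_comb a W F"

lemma bounded_comb_fixed:
  assumes "smooth_on {0..a} \<psi>"
  shows "bounded_comb a W (\<lambda>_. \<psi>)"
proof -
  have "bounded ((\<lambda>_. 1::complex) ` W)" by (rule bounded_subset[of "{1}"]) auto
  from bounded_comb.single[OF assms this] show ?thesis by simp
qed

lemma bounded_comb_sum: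
  assumes "0 < a" "\<And>i. i \<in> K \<Longrightarrow> bounded_comb a W (E i)"
  shows "bounded_comb a W (\<lambda>w x. \<Sum>i\<in>K. E i w x)"
  using assms(2)
  by (induction K rule: infinite_finite_induct)
     (auto intro: bounded_comb_fixed smooth_on_const[OF assms(1)] bounded_comb.add)

lemma bounded_comb_mult:
  assumes a: "0 < a" and h: "smooth_on {0..a} h" and E: "bounded_comb a W E"
  shows "bounded_comb a W (\<lambda>w x. E w x * h x)"
  using E
proof induction
  case (single \<psi> b)
  from bounded_comb.single[OF smooth_on_mult[OF a single(1) h] single(2)]
  show ?case by (simp add: mult.assoc)
next
  case (add E F)
  from bounded_comb.add[OF add.IH] show ?case by (simp add: distrib_right)
next
  case (cong E F)
  then show ?case by (auto intro: bounded_comb.cong)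
qed

lemma bounded_comb_cmult:
  "0 < a \<Longrightarrow> bounded_comb a W E \<Longrightarrow> bounded_comb a W (\<lambda>w x. c * E w x)"
  using bounded_comb_mult[OF _ smooth_on_const, of a W E c] by (simp add: mult.commute)

lemma bounded_comb_diff:
  "0 < a \<Longrightarrow> bounded_comb a W E \<Longrightarrow> bounded_comb a W F \<Longrightarrow> bounded_comb a W (\<lambda>w x. E w x - F w x)"
  using bounded_comb.add[OF _ bounded_comb_cmult[of a W F "-1"]] by simp

lemma bounded_comb_smooth:
  assumes a: "0 < a" and E: "bounded_comb a W E" and w: "w \<in> W"
  shows "smooth_on {0..a} (E w)"
  using E
proof induction
  case (single \<psi> b)
  then show ?case by (intro smooth_on_mult smooth_on_const a)
next
  case (cong E F)
  then show ?case using smooth_on_cong[OF a _ cong.IH] w by blast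
qed (intro smooth_on_add a)

lemma bounded_comb_deriv:
  assumes a: "0 < a" and E: "bounded_comb a W E"
  shows "bounded_comb a W (\<lambda>w. deriv_on a (E w))"
  using E
proof induction
  case (single \<psi> b)
  show ?case
  proof (rule bounded_comb.cong)
    show "bounded_comb a W (\<lambda>w x. b w * deriv_on a \<psi> x)"
      using single smooth_on_deriv by (intro bounded_comb.single)
    show "b w * deriv_on a \<psi> x = deriv_on a (\<lambda>x. b w * \<psi> x) x" if "x \<in> {0..a}" for w x
      using deriv_on_mult[OF a smooth_on_const[OF a] single(1) that, of "b w"] deriv_on_const[OF a that, of "b w"]
      by simp
  qed
next
  case (add E F)
  show ?case
    by (rule bounded_comb.cong[OF bounded_comb.add[OF add.IH]])
       (simp add: deriv_on_add a bounded_comb_smooth[OF a add.hyps(1)] bounded_comb_smooth[OF a add.hyps(2)])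
next
  case (cong E F)
  show ?case
    by (rule bounded_comb.cong[OF cong.IH]) (rule deriv_within_cong_on, auto intro: cong.hyps)
qed

lemma bounded_comb_nth_deriv:
  "0 < a \<Longrightarrow> bounded_comb a W E \<Longrightarrow> bounded_comb a W (\<lambda>w. nth_deriv_on {0..a} k (E w))"
  by (induction k) (auto intro: bounded_comb_deriv)

lemma bounded_comb_bound:
  assumes E: "bounded_comb a W E"
  obtains C where "C \<ge> 0" "\<And>w x. w \<in> W \<Longrightarrow> x \<in> {0..a} \<Longrightarrow> norm (E w x) \<le> C"
proof -
  from E have "\<exists>C\<ge>0. \<forall>w\<in>W. \<forall>x\<in>{0..a}. norm (E w x) \<le> C"
  proof induction
    case (single \<psi> b)
    have "bounded (\<psi> ` {0..a})"
      using single(1) smooth_on_imp_continuous_on compact_continuous_image compact_imp_bounded compact_Icc by metis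
    then obtain C1 where "\<And>x. x \<in> {0..a} \<Longrightarrow> norm (\<psi> x) \<le> C1"
      unfolding bounded_iff by blast
    moreover obtain C2 where "\<And>w. w \<in> W \<Longrightarrow> norm (b w) \<le> C2"
      using single(2) by (auto simp: bounded_iff)
    ultimately have "\<forall>w\<in>W. \<forall>x\<in>{0..a}. norm (b w * \<psi> x) \<le> \<bar>C2\<bar> * \<bar>C1\<bar>"
      by (auto simp: norm_mult intro!: mult_mono intro: order_trans[OF _ abs_ge_self])
    then show ?case by (intro exI[of _ "\<bar>C2\<bar> * \<bar>C1\<bar>"]) auto
  next
    case (add E F)
    then obtain C1 C2 where C: "C1 \<ge> 0" "\<forall>w\<in>W. \<forall>x\<in>{0..a}. norm (E w x) \<le> C1"
      "C2 \<ge> 0" "\<forall>w\<in>W. \<forall>x\<in>{0..a}. norm (F w x) \<le> C2" by blast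
    then have "\<forall>w\<in>W. \<forall>x\<in>{0..a}. norm (E w x + F w x) \<le> C1 + C2"
      using norm_triangle_mono by blast
    then show ?case using C by (intro exI[of _ "C1 + C2"]) auto
  next
    case (cong E F)
    then show ?case by auto
  qed
  then show ?thesis using that by blast
qed

text \<open>Integrating the bound on the derivative from 0 raises the power of \<open>x\<close> by one for each
  order of vanishing, uniformly in the parameter.\<close>

lemma bounded_comb_vanishes_bound:
  assumes a: "0 < a"
  shows "bounded_comb a W E \<Longrightarrow> (\<And>w. w \<in> W \<Longrightarrow> vanishes a 0 p (E w)) \<Longrightarrow>
    \<exists>C\<ge>0. \<forall>w\<in>W. \<forall>x\<in>{0..a}. norm (E w x) \<le> C * x ^ p"
proof (induction p arbitrary: E)
  case 0
  then show ?case using bounded_comb_bound[OF 0(1)] by (metis mult.right_neutral power_0)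
next
  case (Suc p)
  then obtain C where C: "C \<ge> 0" "\<And>w x. w\<in>W \<Longrightarrow> x\<in>{0..a} \<Longrightarrow> norm (deriv_on a (E w) x) \<le> C * x ^ p"
    using Suc.IH[OF bounded_comb_deriv[OF a Suc.prems(1)]] by (metis vanishes_Suc)
  have "norm (E w x) \<le> C * x ^ Suc p" if w: "w \<in> W" and x: "x \<in> {0..a}" for w x
  proof -
    have "norm (E w x - E w 0) \<le> C * x ^ p * norm (x - 0)"
    proof (rule differentiable_bound[where S = "{0..x}" and f' = "\<lambda>y h. h *\<^sub>R deriv_on a (E w) y"])
      fix y assume y: "y \<in> {0..x}"
      then have ya: "y \<in> {0..a}" using x by auto
      have "(E w has_vector_derivative deriv_on a (E w) y) (at y within {0..a})"
        by (rule smooth_on_has_deriv[OF bounded_comb_smooth[OF a Suc.prems(1) w] ya])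
      then have "(E w has_vector_derivative deriv_on a (E w) y) (at y within {0..x})"
        by (rule has_vector_derivative_within_subset) (use x in auto)
      then show "(E w has_derivative (\<lambda>h. h *\<^sub>R deriv_on a (E w) y)) (at y within {0..x})"
        by (simp add: has_vector_derivative_def)
      have "norm (deriv_on a (E w) y) \<le> C * y ^ p" using C w ya by blast
      also have "\<dots> \<le> C * x ^ p" using y C(1) by (auto intro!: mult_left_mono power_mono)
      finally show "onorm (\<lambda>h. h *\<^sub>R deriv_on a (E w) y) \<le> C * x ^ p"
        using onorm_scaleR_left[OF bounded_linear_ident, of "deriv_on a (E w) y"] onorm_id[where 'a=real] by (simp add: id_def)
    qed (use x in auto)
    moreover have "E w 0 = 0" using Suc.prems(2) w by (simp add: vanishes_Suc)
    ultimately show ?thesis using x by (simp add: mult_ac)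
  qed
  then show ?case using C(1) by blast
qed

section \<open>Algebraic and logarithmic weights\<close>

text \<open>The inequality \<open>1 + \<bar>s + t\<bar> \<le> (1 + \<bar>s\<bar>) (1 + \<bar>t\<bar>)\<close>, applied to \<open>ln x = ln h - ln (h / x)\<close>, splits off the
  logarithm at the reference scale \<open>h\<close>. The rest of the logarithm is absorbed by an
  arbitrarily small power of \<open>h / x\<close>, so singular integrals at scale \<open>h\<close> reduce to integrals of
  pure powers and lose only the factor \<open>1 + \<bar>ln h\<bar>\<close>.\<close>

lemma log_le_powr_below:
  fixes x h \<epsilon> :: real
  assumes "0 < x" "x \<le> h" "0 < \<epsilon>"
  shows "1 + \<bar>ln x\<bar> \<le> (1 + \<bar>ln h\<bar>) * (1 + 1 / \<epsilon>) * (h powr \<epsilon> * x powr (-\<epsilon>))"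
proof -
  define u where "u = h / x"
  have u: "u \<ge> 1" using assms by (simp add: u_def)
  have "ln u \<le> u powr \<epsilon> / \<epsilon>" "1 \<le> u powr \<epsilon>" "0 \<le> ln u"
    using ln_powr_bound u assms(3) by (auto simp: ge_one_powr_ge_zero)
  then have le: "1 + \<bar>ln u\<bar> \<le> (1 + 1 / \<epsilon>) * u powr \<epsilon>"
    by (simp add: field_simps)
  have "ln x = ln h - ln u" using assms u by (simp add: u_def ln_div)
  then have "1 + \<bar>ln x\<bar> \<le> 1 + \<bar>ln h\<bar> + \<bar>ln u\<bar>" by linarith
  also have "\<dots> \<le> (1 + \<bar>ln h\<bar>) * (1 + \<bar>ln u\<bar>)" by (simp add: algebra_simps)
  also have "\<dots> \<le> (1 + \<bar>ln h\<bar>) * ((1 + 1 / \<epsilon>) * u powr \<epsilon>)"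
    using le by (intro mult_left_mono) auto
  also have "u powr \<epsilon> = h powr \<epsilon> * x powr (-\<epsilon>)"
    using assms by (simp add: u_def powr_divide powr_minus_divide)
  finally show ?thesis by (simp only: mult.assoc)
qed

lemma log_le_powr_above:
  fixes x h \<epsilon> :: real
  assumes "0 < h" "h \<le> x" "0 < \<epsilon>"
  shows "1 + \<bar>ln x\<bar> \<le> (1 + \<bar>ln h\<bar>) * (1 + 1 / \<epsilon>) * (h powr (-\<epsilon>) * x powr \<epsilon>)"
proof -
  have "1 + \<bar>ln (1 / x)\<bar> \<le> (1 + \<bar>ln (1 / h)\<bar>) * (1 + 1 / \<epsilon>) * ((1 / h) powr \<epsilon> * (1 / x) powr (-\<epsilon>))"
    using assms by (intro log_le_powr_below) (auto simp: field_simps)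
  then show ?thesis using assms by (simp add: ln_div powr_divide powr_minus field_simps)
qed

lemma has_integral_powr_Icc:
  fixes h a q :: real
  assumes "0 < h" "h \<le> a" "q \<noteq> 0"
  shows "((\<lambda>x. x powr (q - 1)) has_integral (a powr q - h powr q) / q) {h..a}"
proof -
  have "((\<lambda>x. x powr q / q) has_vector_derivative x powr (q - 1)) (at x within {h..a})"
    if "x \<in> {h..a}" for x
  proof -
    have "((\<lambda>x. x powr q / q) has_real_derivative (q * x powr (q - 1)) / q) (at x)"
      using that assms by (intro DERIV_cdivide has_real_derivative_powr) auto
    then show ?thesis
      using assms by (simp add: has_real_derivative_iff_has_vector_derivative has_vector_derivative_at_within)
  qed
  from fundamental_theorem_of_calculus[OF assms(2) this]
  show ?thesis by (simp add: diff_divide_distrib)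
qed

lemma has_integral_powr_from_0_shift:
  fixes h q :: real
  assumes "0 < h" "q > 0"
  shows "((\<lambda>x. x powr (q - 1)) has_integral h powr q / q) {0..h}"
  using has_integral_powr_from_0[of "q - 1" h] assms by simp

lemma integrable_on_Ioc_iff_Icc:
  fixes u :: "real \<Rightarrow> 'a::euclidean_space"
  shows "u integrable_on {0<..a} \<longleftrightarrow> u integrable_on {0..a}"
  by (rule integrable_spike_set_eq[OF negligible_subset[of "{0}"]]) auto

text \<open>Half of the exponent \<open>p\<close> absorbs the logarithm, the other half keeps the power integrable.\<close>

lemma integrable_powr_log_bound:
  fixes u :: "real \<Rightarrow> 'a::euclidean_space"
  assumes a: "0 < a" and cont: "continuous_on {0<..a} u" and p: "p > 0"
    and le: "\<And>x. x \<in> {0<..a} \<Longrightarrow> norm (u x) \<le> C * x powr (p - 1) * (1 + \<bar>ln x\<bar>)"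
  shows "u integrable_on {0..a}"
proof -
  define K where "K = (1 + \<bar>ln a\<bar>) * (1 + 1 / (p/2)) * a powr (p/2)"
  have "norm (u a) \<le> C * a powr (p - 1) * (1 + \<bar>ln a\<bar>)" using le[of a] a by simp
  then have "0 \<le> C * a powr (p - 1) * (1 + \<bar>ln a\<bar>)" using norm_ge_zero order_trans by blast
  moreover have "0 < a powr (p - 1) * (1 + \<bar>ln a\<bar>)" using a by (intro mult_pos_pos) auto
  ultimately have C: "C \<ge> 0"
    using mult_neg_pos[of C "a powr (p - 1) * (1 + \<bar>ln a\<bar>)"] by (fastforce simp: mult.assoc not_le[symmetric])
  have "((\<lambda>x. C * K * x powr (p/2 - 1)) has_integral C * K * (a powr (p/2) / (p/2))) {0..a}"
    by (intro has_integral_mult_right has_integral_powr_from_0_shift a) (use p in auto)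
  from has_integral_integrable[OF this] have int: "(\<lambda>x. C * K * x powr (p/2 - 1)) integrable_on {0<..a}"
    by (simp only: integrable_on_Ioc_iff_Icc)
  have "u integrable_on {0<..a}"
  proof (rule measurable_bounded_by_integrable_imp_integrable[OF _ int])
    show "u \<in> borel_measurable (lebesgue_on {0<..a})"
      by (rule continuous_imp_measurable_on_sets_lebesgue[OF cont]) simp
    fix x assume x: "x \<in> {0<..a}"
    have "norm (u x) \<le> C * x powr (p - 1) * (1 + \<bar>ln x\<bar>)" by (rule le[OF x])
    also have "\<dots> \<le> C * x powr (p - 1) * (K * x powr (-(p/2)))"
      using log_le_powr_below[of x a "p/2"] x p C unfolding K_def by (intro mult_left_mono) (auto simp: mult.assoc)
    also have "\<dots> = C * K * (x powr (p - 1) * x powr (-(p/2)))" by (simp only: mult_ac)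
    also have "x powr (p - 1) * x powr (-(p/2)) = x powr (p/2 - 1)"
      by (simp only: powr_add[symmetric]) (simp add: field_simps)
    finally show "norm (u x) \<le> C * K * x powr (p/2 - 1)" .
  qed simp
  then show ?thesis by (simp only: integrable_on_Ioc_iff_Icc)
qed

text \<open>The bounds for singular integrands fail at 0, where both sides take conventional values.\<close>

lemma norm_integral_bound_off_zero:
  fixes D :: "real \<Rightarrow> 'a::euclidean_space"
  assumes D: "D integrable_on {0..h}" and f: "(f has_integral I) {0..h}"
    and le: "\<And>x. x \<in> {0<..h} \<Longrightarrow> norm (D x) \<le> f x"
  shows "norm (integral {0..h} D) \<le> I"
proof -
  have D': "((\<lambda>x. if x = 0 then 0 else D x) has_integral integral {0..h} D) {0..h}"
    by (rule has_integral_spike_finite[of "{0}" _ _ D]) (use D in auto)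
  have f': "((\<lambda>x. if x = 0 then 0 else f x) has_integral I) {0..h}"
    by (rule has_integral_spike_finite[of "{0}" _ _ f]) (use f in auto)
  show ?thesis
    using integral_norm_bound_integral[OF has_integral_integrable[OF D'] has_integral_integrable[OF f']] le
    by (simp add: integral_unique[OF D'] integral_unique[OF f'])
qed

lemma continuous_on_extend_powr_log_bound:
  fixes u :: "real \<Rightarrow> 'a::real_normed_vector"
  assumes a: "0 < a" and cont: "continuous_on {0<..a} u" and p: "p > 0" and u0: "u 0 = 0"
    and le: "\<And>x. x \<in> {0<..a} \<Longrightarrow> norm (u x) \<le> C * x powr p * (1 + \<bar>ln x\<bar>)"
  shows "continuous_on {0..a} u"
  unfolding continuous_on_eq_continuous_within
proof
  fix x assume x: "x \<in> {0..a}"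
  show "continuous (at x within {0..a}) u"
  proof (cases "x = 0")
    case False
    then have x': "x \<in> {0<..a}" using x by auto
    have "at x within {0..a} = at x within {0<..a}"
      by (rule at_within_nhd[of _ "{0<..}"]) (use x' in auto)
    then show ?thesis using cont x' by (simp add: continuous_on_eq_continuous_within)
  next
    case True
    define K where "K = (1 + \<bar>ln a\<bar>) * (1 + 1 / (p/2)) * a powr (p/2)"
    have le': "norm (u x) \<le> \<bar>C\<bar> * K * x powr (p/2)" if "x \<in> {0..a}" for x
    proof (cases "x = 0")
      case True then show ?thesis using u0 by simp
    next
      case False
      then have x: "x \<in> {0<..a}" using that by auto
      have "norm (u x) \<le> C * x powr p * (1 + \<bar>ln x\<bar>)" by (rule le[OF x])
      also have "\<dots> \<le> \<bar>C\<bar> * x powr p * (K * x powr (-(p/2)))"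
        using log_le_powr_below[of x a "p/2"] x p unfolding K_def by (intro mult_mono) (auto simp: mult.assoc)
      also have "\<dots> = \<bar>C\<bar> * K * (x powr p * x powr (-(p/2)))" by (simp only: mult_ac)
      also have "x powr p * x powr (-(p/2)) = x powr (p/2)"
        by (simp only: powr_add[symmetric]) (simp add: field_simps)
      finally show ?thesis .
    qed
    have "((\<lambda>x. \<bar>C\<bar> * K * x powr (p/2)) \<longlongrightarrow> \<bar>C\<bar> * K * 0 powr (p/2)) (at 0 within {0..a})"
      using p by (intro tendsto_intros) (auto simp: eventually_at_filter)
    then have "((\<lambda>x. \<bar>C\<bar> * K * x powr (p/2)) \<longlongrightarrow> 0) (at 0 within {0..a})" by simp
    then have "(u \<longlongrightarrow> 0) (at 0 within {0..a})"
      by (rule Lim_null_comparison[rotated]) (use le' in \<open>auto simp: eventually_at_filter\<close>)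
    then show ?thesis using True u0 by (simp add: continuous_within)
  qed
qed

lemma delta_ge_1: "1 \<le> delta \<alpha> w"
  by (simp add: delta_def)

text \<open>For \<open>\<alpha> > 0\<close> the weight is integrable and \<open>min 1 (w * x)\<close> may be replaced by 1. For \<open>\<alpha> < 0\<close> the integral is split
  at \<open>h = 1 / w\<close>: below \<open>h\<close> the factor \<open>w * x\<close> restores integrability, above \<open>h\<close> the power is integrable at infinity, and
  both parts are of size \<open>h powr \<alpha>\<close> times the logarithm at scale \<open>h\<close>.\<close>

lemma singular_integral_bound:
  fixes a \<alpha> :: real
  assumes a: "0 < a" and al: "-1 < \<alpha>" "\<alpha> \<noteq> 0" "\<alpha> < 1"
  obtains K where "K \<ge> 0"
    "\<And>w C D. w \<ge> 1 \<Longrightarrow> w \<ge> 1 / a \<Longrightarrow> C \<ge> 0 \<Longrightarrow> (D :: real \<Rightarrow> complex) integrable_on {0..a} \<Longrightarrow>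
       (\<And>x. x \<in> {0<..a} \<Longrightarrow> norm (D x) \<le> C * x powr (\<alpha> - 1) * (1 + \<bar>ln x\<bar>) * min 1 (w * x)) \<Longrightarrow>
       norm (integral {0..a} D) \<le> K * C * delta \<alpha> w * w powr (1 - min (1 + \<alpha>) 1)"
proof (cases "\<alpha> > 0")
  case True
  define K0 where "K0 = (1 + \<bar>ln a\<bar>) * (1 + 1 / (\<alpha>/2)) * a powr (\<alpha>/2)"
  define K where "K = K0 * (a powr (\<alpha>/2) / (\<alpha>/2))"
  have K0: "K0 \<ge> 0" using True unfolding K0_def by auto
  show ?thesis
  proof (rule that[of K])
    show "K \<ge> 0" unfolding K_def using K0 True by auto
    fix w C :: real and D :: "real \<Rightarrow> complex"
    assume w: "w \<ge> 1" "w \<ge> 1 / a" and C: "C \<ge> 0" and int: "D integrable_on {0..a}"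
      and le: "\<And>x. x \<in> {0<..a} \<Longrightarrow> norm (D x) \<le> C * x powr (\<alpha> - 1) * (1 + \<bar>ln x\<bar>) * min 1 (w * x)"
    have hi: "((\<lambda>x. C * K0 * x powr (\<alpha>/2 - 1)) has_integral C * K0 * (a powr (\<alpha>/2) / (\<alpha>/2))) {0..a}"
      using True by (intro has_integral_mult_right has_integral_powr_from_0_shift a) auto
    have ptw: "norm (D x) \<le> C * K0 * x powr (\<alpha>/2 - 1)" if x: "x \<in> {0<..a}" for x
    proof -
      have "norm (D x) \<le> C * x powr (\<alpha> - 1) * (1 + \<bar>ln x\<bar>) * min 1 (w * x)" by (rule le[OF x])
      also have "\<dots> \<le> C * x powr (\<alpha> - 1) * (1 + \<bar>ln x\<bar>) * 1"
        using C by (intro mult_left_mono) auto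
      also have "\<dots> \<le> C * x powr (\<alpha> - 1) * (K0 * x powr (-(\<alpha>/2)))"
        using log_le_powr_below[of x a "\<alpha>/2"] x True C unfolding K0_def
        by (simp only: mult_1_right, intro mult_left_mono) (auto simp: mult.assoc)
      also have "\<dots> = C * K0 * (x powr (\<alpha> - 1) * x powr (-(\<alpha>/2)))" by (simp only: mult_ac)
      also have "x powr (\<alpha> - 1) * x powr (-(\<alpha>/2)) = x powr (\<alpha>/2 - 1)"
        by (simp only: powr_add[symmetric]) (simp add: field_simps)
      finally show ?thesis .
    qed
    from norm_integral_bound_off_zero[OF int hi ptw]
    have "norm (integral {0..a} D) \<le> K * C" by (simp add: K_def mult_ac)
    then show "norm (integral {0..a} D) \<le> K * C * delta \<alpha> w * w powr (1 - min (1 + \<alpha>) 1)"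
      using True w by (simp add: delta_def)
  qed
next
  case False
  then have neg: "\<alpha> < 0" using al by auto
  \<comment> \<open>Small enough to keep the exponent above \<open>-1\<close> on the inner part and below \<open>-1\<close> on the outer part.\<close>
  define \<epsilon> where "\<epsilon> = min (-\<alpha>/2) ((1+\<alpha>)/2)"
  have eps: "\<epsilon> > 0" "\<alpha> + \<epsilon> < 0" "1 + \<alpha> - \<epsilon> > 0" using neg al unfolding \<epsilon>_def by (auto simp: min_def field_simps)
  define K1 where "K1 = (1 + 1 / \<epsilon>) / (1 + \<alpha> - \<epsilon>)"
  define K2 where "K2 = (1 + 1 / \<epsilon>) / (- (\<alpha> + \<epsilon>))"
  have K: "K1 \<ge> 0" "K2 \<ge> 0" unfolding K1_def K2_def using eps by (auto intro!: divide_nonneg_pos)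
  show ?thesis
  proof (rule that[of "K1 + K2"])
    show "K1 + K2 \<ge> 0" using K by auto
    fix w C :: real and D :: "real \<Rightarrow> complex"
    assume w: "w \<ge> 1" "w \<ge> 1 / a" and C: "C \<ge> 0" and int: "D integrable_on {0..a}"
      and le: "\<And>x. x \<in> {0<..a} \<Longrightarrow> norm (D x) \<le> C * x powr (\<alpha> - 1) * (1 + \<bar>ln x\<bar>) * min 1 (w * x)"
    define h where "h = 1 / w"
    have h: "0 < h" "h \<le> a" "w = 1 / h" using w a unfolding h_def by (auto simp: field_simps)
    \<comment> \<open>For negative \<open>\<alpha>\<close> the function \<open>delta\<close> is exactly the logarithmic loss at scale \<open>h\<close>.\<close>
    define L where "L = delta \<alpha> w"
    have L: "L = 1 + \<bar>ln h\<bar>" "L \<ge> 0" using neg w unfolding L_def delta_def h_def by (auto simp: ln_div)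
    have hw: "h powr \<alpha> = w powr (1 - min (1 + \<alpha>) 1)"
      using neg w unfolding h_def by (simp add: powr_divide powr_minus_divide)
    have hi1: "((\<lambda>x. C * w * L * (1 + 1/\<epsilon>) * h powr \<epsilon> * x powr ((1 + \<alpha> - \<epsilon>) - 1)) has_integral
        C * w * L * (1 + 1/\<epsilon>) * h powr \<epsilon> * (h powr (1 + \<alpha> - \<epsilon>) / (1 + \<alpha> - \<epsilon>))) {0..h}"
      using eps by (intro has_integral_mult_right has_integral_powr_from_0_shift h) auto
    have v1: "C * w * L * (1 + 1/\<epsilon>) * h powr \<epsilon> * (h powr (1 + \<alpha> - \<epsilon>) / (1 + \<alpha> - \<epsilon>)) = K1 * C * L * h powr \<alpha>"
    proof -
      have "w * (h powr \<epsilon> * h powr (1 + \<alpha> - \<epsilon>)) = h powr \<alpha>"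
        using h by (simp add: powr_add[symmetric]) (simp add: powr_add)
      then show ?thesis unfolding K1_def by (simp add: field_simps)
    qed
    have p1: "norm (D x) \<le> C * w * L * (1 + 1/\<epsilon>) * h powr \<epsilon> * x powr ((1 + \<alpha> - \<epsilon>) - 1)" if x: "x \<in> {0<..h}" for x
    proof -
      have "norm (D x) \<le> C * x powr (\<alpha> - 1) * (1 + \<bar>ln x\<bar>) * min 1 (w * x)" using x h by (intro le) auto
      also have "\<dots> \<le> C * x powr (\<alpha> - 1) * (L * (1 + 1 / \<epsilon>) * (h powr \<epsilon> * x powr (-\<epsilon>))) * (w * x)"
        using log_le_powr_below[of x h \<epsilon>] x eps C L w by (intro mult_mono mult_left_mono) auto
      also have "\<dots> = C * w * L * (1 + 1/\<epsilon>) * h powr \<epsilon> * (x powr (\<alpha> - 1) * x powr (-\<epsilon>) * x powr 1)"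
        using x by (simp add: mult_ac)
      also have "x powr (\<alpha> - 1) * x powr (-\<epsilon>) * x powr 1 = x powr ((1 + \<alpha> - \<epsilon>) - 1)"
        by (simp only: powr_add[symmetric]) simp
      finally show ?thesis .
    qed
    have "D integrable_on {0..h}" by (rule integrable_on_subinterval[OF int]) (use h in auto)
    from norm_integral_bound_off_zero[OF this hi1 p1]
    have b1: "norm (integral {0..h} D) \<le> K1 * C * L * h powr \<alpha>" unfolding v1 .
    have hi2: "((\<lambda>x. C * L * (1 + 1/\<epsilon>) * h powr (-\<epsilon>) * x powr ((\<alpha> + \<epsilon>) - 1)) has_integral
        C * L * (1 + 1/\<epsilon>) * h powr (-\<epsilon>) * ((a powr (\<alpha> + \<epsilon>) - h powr (\<alpha> + \<epsilon>)) / (\<alpha> + \<epsilon>))) {h..a}"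
      using eps h by (intro has_integral_mult_right has_integral_powr_Icc) auto
    have v2: "C * L * (1 + 1/\<epsilon>) * h powr (-\<epsilon>) * ((a powr (\<alpha> + \<epsilon>) - h powr (\<alpha> + \<epsilon>)) / (\<alpha> + \<epsilon>)) \<le> K2 * C * L * h powr \<alpha>"
    proof -
      have "(a powr (\<alpha> + \<epsilon>) - h powr (\<alpha> + \<epsilon>)) / (\<alpha> + \<epsilon>) = (h powr (\<alpha> + \<epsilon>) - a powr (\<alpha> + \<epsilon>)) / (- (\<alpha> + \<epsilon>))"
        using eps by (simp add: field_simps)
      also have "\<dots> \<le> h powr (\<alpha> + \<epsilon>) / (- (\<alpha> + \<epsilon>))" using eps by (intro divide_right_mono) auto
      finally have "C * L * (1 + 1/\<epsilon>) * h powr (-\<epsilon>) * ((a powr (\<alpha> + \<epsilon>) - h powr (\<alpha> + \<epsilon>)) / (\<alpha> + \<epsilon>))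
        \<le> C * L * (1 + 1/\<epsilon>) * h powr (-\<epsilon>) * (h powr (\<alpha> + \<epsilon>) / (- (\<alpha> + \<epsilon>)))"
        using C L eps by (intro mult_left_mono) auto
      also have "\<dots> = K2 * C * L * (h powr (-\<epsilon>) * h powr (\<alpha> + \<epsilon>))"
        unfolding K2_def by (simp add: mult_ac)
      also have "h powr (-\<epsilon>) * h powr (\<alpha> + \<epsilon>) = h powr \<alpha>" by (simp add: powr_add[symmetric])
      finally show ?thesis .
    qed
    have p2: "norm (D x) \<le> C * L * (1 + 1/\<epsilon>) * h powr (-\<epsilon>) * x powr ((\<alpha> + \<epsilon>) - 1)" if x: "x \<in> {h..a}" for x
    proof -
      have "norm (D x) \<le> C * x powr (\<alpha> - 1) * (1 + \<bar>ln x\<bar>) * min 1 (w * x)" using x h by (intro le) auto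
      also have "\<dots> \<le> C * x powr (\<alpha> - 1) * (L * (1 + 1 / \<epsilon>) * (h powr (-\<epsilon>) * x powr \<epsilon>)) * 1"
        using log_le_powr_above[of h x \<epsilon>] x eps C L w h(1) by (intro mult_mono mult_left_mono) auto
      also have "\<dots> = C * L * (1 + 1/\<epsilon>) * h powr (-\<epsilon>) * (x powr (\<alpha> - 1) * x powr \<epsilon>)"
        by (simp add: mult_ac)
      also have "x powr (\<alpha> - 1) * x powr \<epsilon> = x powr ((\<alpha> + \<epsilon>) - 1)"
        by (simp only: powr_add[symmetric]) (simp add: algebra_simps)
      finally show ?thesis .
    qed
    have "norm (integral {h..a} D) \<le> integral {h..a} (\<lambda>x. C * L * (1 + 1/\<epsilon>) * h powr (-\<epsilon>) * x powr ((\<alpha> + \<epsilon>) - 1))"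
    proof (rule integral_norm_bound_integral)
      show "D integrable_on {h..a}" by (rule integrable_on_subinterval[OF int]) (use h in auto)
    qed (use hi2 p2 in auto)
    also have "\<dots> \<le> K2 * C * L * h powr \<alpha>" using integral_unique[OF hi2] v2 by simp
    finally have b2: "norm (integral {h..a} D) \<le> K2 * C * L * h powr \<alpha>" .
    have "integral {0..a} D = integral {0..h} D + integral {h..a} D"
      using Henstock_Kurzweil_Integration.integral_combine[OF _ h(2) int] h by simp
    then have "norm (integral {0..a} D) \<le> K1 * C * L * h powr \<alpha> + K2 * C * L * h powr \<alpha>"
      using b1 b2 norm_triangle_mono by metis
    also have "\<dots> = (K1 + K2) * C * L * h powr \<alpha>" by (simp add: algebra_simps)
    finally show "norm (integral {0..a} D) \<le> (K1 + K2) * C * delta \<alpha> w * w powr (1 - min (1 + \<alpha>) 1)"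
      unfolding hw L_def .
  qed
qed

section \<open>Decay of oscillatory integrals\<close>

lemma norm_cexp_minus_1_le:
  fixes t :: real
  shows "norm (exp (\<i> * of_real t) - 1) \<le> \<bar>t\<bar>"
proof -
  have "norm (exp (\<i> * of_real t) - 1) = 2 * \<bar>sin (t / 2)\<bar>" by (rule dist_exp_i_1)
  also have "\<dots> \<le> 2 * \<bar>t / 2\<bar>" using abs_sin_x_le_abs_x[of "t/2"] by simp
  finally show ?thesis by simp
qed

locale levin_phase =
  fixes a :: real and g :: "real \<Rightarrow> real"
  assumes a_pos: "0 < a" and smooth_g: "smooth_on {0..a} g" and g_0: "g 0 = 0"
    and dg_pos: "\<And>y. y \<in> {0..a} \<Longrightarrow> deriv_on a g y > 0"
begin

abbreviation dg :: "real \<Rightarrow> real" where "dg \<equiv> deriv_on a g"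

abbreviation osc :: "real \<Rightarrow> real \<Rightarrow> complex" where
  "osc w x \<equiv> exp (\<i> * complex_of_real w * complex_of_real (g x))"

lemma has_deriv_interior:
  assumes "smooth_on {0..a} u" "x \<in> {0<..<a}"
  shows "(u has_vector_derivative deriv_on a u x) (at x)"
  using smooth_on_has_deriv[OF assms(1), of x] assms(2) by (simp add: at_within_Icc_at)

lemma g_pos:
  assumes "x \<in> {0<..a}"
  shows "g x > 0"
proof -
  have "g 0 < g x"
  proof (rule DERIV_pos_imp_increasing_open[of 0 x g])
    show "0 < x" using assms by simp
    fix y assume y: "0 < y" "y < x"
    then show "\<exists>d. DERIV g y :> d \<and> d > 0"
      using has_deriv_interior[OF smooth_g, of y] dg_pos[of y] assms
      by (auto simp: has_real_derivative_iff_has_vector_derivative)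
  next
    show "continuous_on {0..x} g"
      by (rule continuous_on_subset[OF smooth_on_imp_continuous_on[OF smooth_g]]) (use assms in auto)
  qed
  then show ?thesis using g_0 by simp
qed

lemma g_quotient:
  obtains G where "smooth_on {0..a} G" "\<And>x. x \<in> {0..a} \<Longrightarrow> g x = x * G x"
    "\<And>x. x \<in> {0..a} \<Longrightarrow> G x > 0" "G 0 = dg 0"
proof -
  obtain G where G: "smooth_on {0..a} G" "\<And>x. x \<in> {0..a} \<Longrightarrow> g x = x * G x" "G 0 = dg 0"
    using hadamard_quotient_smooth[OF a_pos smooth_g g_0] by metis
  have "G x > 0" if x: "x \<in> {0..a}" for x
  proof (cases "x = 0")
    case True then show ?thesis using G(3) dg_pos[of 0] a_pos by simp
  next
    case False
    then show ?thesis using g_pos[of x] G(2)[OF x] x by (auto simp: zero_less_mult_iff)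
  qed
  then show ?thesis using that G by blast
qed

lemma smooth_dg: "smooth_on {0..a} (\<lambda>x. complex_of_real (dg x))"
  by (intro smooth_on_of_real smooth_on_deriv smooth_g a_pos)

lemma smooth_inverse_dg: "smooth_on {0..a} (\<lambda>x. complex_of_real (1 / dg x))"
proof -
  have "smooth_on {0..a} (\<lambda>x. dg x powr (-1))"
    using dg_pos by (intro smooth_on_powr smooth_on_deriv smooth_g a_pos)
  then have "smooth_on {0..a} (\<lambda>x. 1 / dg x)"
    by (rule smooth_on_cong[OF a_pos, rotated]) (use dg_pos in \<open>auto simp: powr_minus_divide less_imp_le\<close>)
  then show ?thesis by (intro smooth_on_of_real a_pos)
qed

lemma g_powr_bound: "\<exists>K\<ge>0. \<forall>x\<in>{0<..a}. g x powr \<beta> \<le> K * x powr \<beta>"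
proof -
  obtain G where G: "smooth_on {0..a} G" "\<And>x. x \<in> {0..a} \<Longrightarrow> g x = x * G x" "\<And>x. x \<in> {0..a} \<Longrightarrow> G x > 0"
    using g_quotient by metis
  have "continuous_on {0..a} (\<lambda>x. G x powr \<beta>)"
    by (intro smooth_on_imp_continuous_on smooth_on_powr a_pos G) auto
  then have "bounded ((\<lambda>x. G x powr \<beta>) ` {0..a})"
    by (intro compact_imp_bounded compact_continuous_image) auto
  then obtain K where K: "\<forall>x\<in>{0..a}. norm (G x powr \<beta>) \<le> K"
    unfolding bounded_iff by blast
  have "g x powr \<beta> \<le> \<bar>K\<bar> * x powr \<beta>" if x: "x \<in> {0<..a}" for x
  proof -
    have "G x powr \<beta> \<le> \<bar>K\<bar>" using K[rule_format, of x] x by auto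
    then have "x powr \<beta> * G x powr \<beta> \<le> x powr \<beta> * \<bar>K\<bar>" by (intro mult_left_mono) auto
    moreover have "g x powr \<beta> = x powr \<beta> * G x powr \<beta>"
      using G(2,3)[of x] x by (auto simp: powr_mult less_imp_le)
    ultimately show ?thesis by (simp add: mult.commute)
  qed
  then show ?thesis by (intro exI[of _ "\<bar>K\<bar>"]) auto
qed

lemma ln_g_bound: "\<exists>K\<ge>0. \<forall>x\<in>{0<..a}. \<bar>ln (g x)\<bar> \<le> K * (1 + \<bar>ln x\<bar>)"
proof -
  obtain G where G: "smooth_on {0..a} G" "\<And>x. x \<in> {0..a} \<Longrightarrow> g x = x * G x" "\<And>x. x \<in> {0..a} \<Longrightarrow> G x > 0"
    using g_quotient by metis
  have "continuous_on {0..a} (\<lambda>x. ln (G x))"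
    by (intro smooth_on_imp_continuous_on smooth_on_ln a_pos G) auto
  then have "bounded ((\<lambda>x. ln (G x)) ` {0..a})"
    by (intro compact_imp_bounded compact_continuous_image) auto
  then obtain K where K: "\<forall>x\<in>{0..a}. norm (ln (G x)) \<le> K"
    unfolding bounded_iff by blast
  have "\<bar>ln (g x)\<bar> \<le> (1 + \<bar>K\<bar>) * (1 + \<bar>ln x\<bar>)" if x: "x \<in> {0<..a}" for x
  proof -
    have "\<bar>ln (G x)\<bar> \<le> \<bar>K\<bar>" using K[rule_format, of x] x by auto
    moreover have "ln (g x) = ln x + ln (G x)"
      using G(2,3)[of x] x by (simp add: ln_mult)
    ultimately have "\<bar>ln (g x)\<bar> \<le> \<bar>ln x\<bar> + \<bar>K\<bar>" by linarith
    also have "\<dots> \<le> (1 + \<bar>K\<bar>) * (1 + \<bar>ln x\<bar>)" by (simp add: algebra_simps)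
    finally show ?thesis .
  qed
  then show ?thesis by (intro exI[of _ "1 + \<bar>K\<bar>"]) auto
qed

text \<open>The logarithmic and the regular amplitude are kept together because differentiating \<open>ln g\<close> feeds the first into the
  second. The arguments \<open>u\<close> and \<open>v\<close> are values, not functions, which makes the bounds pointwise.\<close>

definition amp :: "real \<Rightarrow> real \<Rightarrow> complex \<Rightarrow> complex \<Rightarrow> complex" where
  "amp \<beta> x u v = complex_of_real (g x powr \<beta>) * (complex_of_real (ln (g x)) * u + v)"

text \<open>As \<open>0 powr \<beta> = 0\<close>, the conventional value at the singular endpoint equals the limit whenever the amplitude tends to 0
  there.\<close>

lemma amp_at_0 [simp]: "amp \<beta> 0 u v = 0"
  by (simp add: amp_def g_0)

lemma amp_bound:
  "\<exists>K\<ge>0. \<forall>x\<in>{0<..a}. \<forall>C \<rho> u v. norm u \<le> C * x powr \<rho> \<longrightarrow> norm v \<le> C * x powr \<rho> \<longrightarrow>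
     norm (amp \<beta> x u v) \<le> K * C * x powr (\<beta> + \<rho>) * (1 + \<bar>ln x\<bar>)"
proof -
  obtain K1 where K1: "K1 \<ge> 0" "\<forall>x\<in>{0<..a}. g x powr \<beta> \<le> K1 * x powr \<beta>" using g_powr_bound by blast
  obtain K2 where K2: "K2 \<ge> 0" "\<forall>x\<in>{0<..a}. \<bar>ln (g x)\<bar> \<le> K2 * (1 + \<bar>ln x\<bar>)" using ln_g_bound by blast
  have "norm (amp \<beta> x u v) \<le> (K1 * (K2 + 1)) * C * x powr (\<beta> + \<rho>) * (1 + \<bar>ln x\<bar>)"
    if x: "x \<in> {0<..a}" and u: "norm u \<le> C * x powr \<rho>" and v: "norm v \<le> C * x powr \<rho>" for x C \<rho> u v
  proof -
    have nn: "0 \<le> C * x powr \<rho>" using norm_ge_zero u order_trans by blast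
    have "norm (complex_of_real (ln (g x)) * u + v) \<le> \<bar>ln (g x)\<bar> * norm u + norm v"
      by (rule order_trans[OF norm_triangle_ineq]) (simp add: norm_mult)
    also have "\<dots> \<le> K2 * (1 + \<bar>ln x\<bar>) * (C * x powr \<rho>) + (1 + \<bar>ln x\<bar>) * (C * x powr \<rho>)"
    proof (rule add_mono)
      show "\<bar>ln (g x)\<bar> * norm u \<le> K2 * (1 + \<bar>ln x\<bar>) * (C * x powr \<rho>)"
        using K2 x u by (intro mult_mono) auto
      show "norm v \<le> (1 + \<bar>ln x\<bar>) * (C * x powr \<rho>)"
        using v mult_right_mono[OF _ nn, of 1 "1 + \<bar>ln x\<bar>"] by simp
    qed
    finally have 1: "norm (complex_of_real (ln (g x)) * u + v) \<le> (K2 + 1) * (1 + \<bar>ln x\<bar>) * (C * x powr \<rho>)"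
      by (simp add: algebra_simps)
    have "norm (amp \<beta> x u v) = g x powr \<beta> * norm (complex_of_real (ln (g x)) * u + v)"
      by (simp add: amp_def norm_mult)
    also have "\<dots> \<le> (K1 * x powr \<beta>) * ((K2 + 1) * (1 + \<bar>ln x\<bar>) * (C * x powr \<rho>))"
      using K1 x 1 by (intro mult_mono) auto
    also have "\<dots> = (K1 * (K2 + 1)) * C * (x powr \<beta> * x powr \<rho>) * (1 + \<bar>ln x\<bar>)"
      by (simp only: mult_ac)
    finally show ?thesis by (simp only: powr_add)
  qed
  then show ?thesis using K1 K2 by (intro exI[of _ "K1 * (K2 + 1)"]) auto
qed

lemma continuous_on_g: "S \<subseteq> {0..a} \<Longrightarrow> continuous_on S g"
  using continuous_on_subset[OF smooth_on_imp_continuous_on[OF smooth_g]] by blast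

lemma continuous_on_osc: "S \<subseteq> {0..a} \<Longrightarrow> continuous_on S (osc w)"
  by (intro continuous_intros continuous_on_g)

lemma continuous_on_amp:
  assumes "continuous_on {0..a} E" "continuous_on {0..a} F"
  shows "continuous_on {0<..a} (\<lambda>x. amp \<beta> x (E x) (F x))"
proof -
  have sub: "{0<..a} \<subseteq> {0..a}" by auto
  have "g x \<noteq> 0" if "x \<in> {0<..a}" for x using g_pos[OF that] by simp
  then show ?thesis unfolding amp_def
    by (intro continuous_intros continuous_on_g sub continuous_on_subset[OF assms(1)] continuous_on_subset[OF assms(2)]) auto
qed

lemma amp_integrable:
  assumes E: "continuous_on {0..a} E" and F: "continuous_on {0..a} F" and p: "continuous_on {0..a} p"
    and le: "\<And>x. x \<in> {0<..a} \<Longrightarrow> norm (E x) \<le> C * x powr \<rho>"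
      "\<And>x. x \<in> {0<..a} \<Longrightarrow> norm (F x) \<le> C * x powr \<rho>"
    and br: "\<beta> + \<rho> > -1"
  shows "(\<lambda>x. amp \<beta> x (E x) (F x) * p x) integrable_on {0..a}"
proof -
  obtain K where K: "\<forall>x\<in>{0<..a}. \<forall>C \<rho> u v. norm u \<le> C * x powr \<rho> \<longrightarrow> norm v \<le> C * x powr \<rho> \<longrightarrow>
     norm (amp \<beta> x u v) \<le> K * C * x powr (\<beta> + \<rho>) * (1 + \<bar>ln x\<bar>)" using amp_bound by blast
  have "bounded (p ` {0..a})"
    by (intro compact_imp_bounded compact_continuous_image p) auto
  then obtain B where B: "\<forall>x\<in>{0..a}. norm (p x) \<le> B" unfolding bounded_iff by blast
  show ?thesis
  proof (rule integrable_powr_log_bound[OF a_pos])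
    show "continuous_on {0<..a} (\<lambda>x. amp \<beta> x (E x) (F x) * p x)"
      by (intro continuous_on_mult continuous_on_amp E F continuous_on_subset[OF p]) auto
    show "\<beta> + \<rho> + 1 > 0" using br by simp
    fix x assume x: "x \<in> {0<..a}"
    have 1: "norm (amp \<beta> x (E x) (F x)) \<le> K * C * x powr (\<beta> + \<rho>) * (1 + \<bar>ln x\<bar>)"
      using K x le[OF x] by blast
    have "norm (p x) \<le> B" using B x by auto
    then have "norm (amp \<beta> x (E x) (F x)) * norm (p x) \<le> (K * C * x powr (\<beta> + \<rho>) * (1 + \<bar>ln x\<bar>)) * B"
      using 1 norm_ge_zero order_trans by (intro mult_mono) blast+
    then show "norm (amp \<beta> x (E x) (F x) * p x) \<le> (K * C * B) * x powr (\<beta> + \<rho> + 1 - 1) * (1 + \<bar>ln x\<bar>)"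
      by (simp add: norm_mult mult_ac)
  qed
qed

lemma osc_deriv:
  assumes "x \<in> {0<..<a}"
  shows "(osc w has_vector_derivative \<i> * complex_of_real w * complex_of_real (dg x) * osc w x) (at x)"
proof -
  have "(g has_vector_derivative dg x) (at x)" by (rule has_deriv_interior[OF smooth_g assms])
  then have "((\<lambda>x. complex_of_real (g x)) has_vector_derivative complex_of_real (dg x)) (at x)"
    by (intro has_vector_derivative_of_real) (simp add: has_real_derivative_iff_has_vector_derivative)
  moreover have "((\<lambda>z. exp (\<i> * complex_of_real w * z)) has_field_derivative \<i> * complex_of_real w * osc w x)
    (at (complex_of_real (g x)))"
    by (auto intro!: derivative_eq_intros)
  ultimately have "((\<lambda>z. exp (\<i> * complex_of_real w * z)) \<circ> (\<lambda>x. complex_of_real (g x)) has_vector_derivative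
    complex_of_real (dg x) * (\<i> * complex_of_real w * osc w x)) (at x)"
    by (rule field_vector_diff_chain_at)
  then show ?thesis by (simp add: o_def mult_ac)
qed

text \<open>If \<open>E\<close> and \<open>F\<close> carry a factor \<open>1 / g'\<close>, both summands are again amplitudes: one with differentiated entries and
  the same exponent, one with undifferentiated entries and the exponent lowered by one.\<close>

lemma amp_deriv:
  fixes E F :: "real \<Rightarrow> complex"
  assumes E: "smooth_on {0..a} E" and F: "smooth_on {0..a} F" and x: "x \<in> {0<..<a}"
  shows "((\<lambda>x. amp \<beta> x (E x) (F x)) has_vector_derivative
     amp \<beta> x (deriv_on a E x) (deriv_on a F x)
     + amp (\<beta> - 1) x (\<beta> * (dg x * E x)) (\<beta> * (dg x * F x) + dg x * E x)) (at x)"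
proof -
  have gx: "g x > 0" using g_pos x by simp
  have g: "(g has_vector_derivative dg x) (at x)" by (rule has_deriv_interior[OF smooth_g x])
  have P: "((\<lambda>x. complex_of_real (g x powr \<beta>)) has_vector_derivative complex_of_real (\<beta> * g x powr (\<beta> - 1) * dg x)) (at x)"
    using has_vector_derivative_powr[OF g gx]
    by (intro has_vector_derivative_of_real) (simp add: has_real_derivative_iff_has_vector_derivative)
  have L: "((\<lambda>x. complex_of_real (ln (g x))) has_vector_derivative complex_of_real (dg x / g x)) (at x)"
    using has_vector_derivative_ln[OF g gx]
    by (intro has_vector_derivative_of_real) (simp add: has_real_derivative_iff_has_vector_derivative)
  have "((\<lambda>x. amp \<beta> x (E x) (F x)) has_vector_derivative
     complex_of_real (g x powr \<beta>) * ((complex_of_real (ln (g x)) * deriv_on a E x + complex_of_real (dg x / g x) * E x) + deriv_on a F x)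
     + complex_of_real (\<beta> * g x powr (\<beta> - 1) * dg x) * (complex_of_real (ln (g x)) * E x + F x)) (at x)"
    unfolding amp_def
    by (intro has_vector_derivative_mult has_vector_derivative_add P L has_deriv_interior E F x)
  moreover have "complex_of_real (g x powr \<beta>) * ((complex_of_real (ln (g x)) * deriv_on a E x + complex_of_real (dg x / g x) * E x) + deriv_on a F x)
     + complex_of_real (\<beta> * g x powr (\<beta> - 1) * dg x) * (complex_of_real (ln (g x)) * E x + F x)
     = amp \<beta> x (deriv_on a E x) (deriv_on a F x)
     + amp (\<beta> - 1) x (\<beta> * (dg x * E x)) (\<beta> * (dg x * F x) + dg x * E x)"
  proof -
    have e: "complex_of_real (g x powr \<beta>) = complex_of_real (g x powr (\<beta> - 1)) * complex_of_real (g x)"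
      using gx by (simp add: powr_diff)
    show ?thesis unfolding amp_def e using gx by (simp add: field_simps)
  qed
  ultimately show ?thesis by simp
qed

text \<open>The values of interest are \<open>c = 0\<close> and \<open>c = 1\<close>. In the second case the phase factor is of size \<open>w x\<close> at the
  singular endpoint, so that the boundary term there disappears even if the amplitude itself is unbounded.\<close>

lemma amp_ibp:
  fixes E F :: "real \<Rightarrow> complex"
  assumes E: "smooth_on {0..a} E" and F: "smooth_on {0..a} F"
    and q: "q > 0"
    and le: "\<And>x. x \<in> {0<..a} \<Longrightarrow> norm (amp \<beta> x (E x) (F x) * (osc w x - c)) \<le> C * x powr q * (1 + \<bar>ln x\<bar>)"
    and I1: "(\<lambda>x. (amp \<beta> x (deriv_on a E x) (deriv_on a F x)
       + amp (\<beta> - 1) x (\<beta> * (dg x * E x)) (\<beta> * (dg x * F x) + dg x * E x)) * (osc w x - c)) integrable_on {0..a}"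
    and I2: "(\<lambda>x. amp \<beta> x (dg x * E x) (dg x * F x) * osc w x) integrable_on {0..a}"
  shows "amp \<beta> a (E a) (F a) * (osc w a - c) =
    integral {0..a} (\<lambda>x. (amp \<beta> x (deriv_on a E x) (deriv_on a F x)
       + amp (\<beta> - 1) x (\<beta> * (dg x * E x)) (\<beta> * (dg x * F x) + dg x * E x)) * (osc w x - c))
    + \<i> * w * integral {0..a} (\<lambda>x. amp \<beta> x (dg x * E x) (dg x * F x) * osc w x)"
    (is "_ = integral _ (\<lambda>x. ?D x * _) + _ * integral _ ?J")
proof -
  let ?P = "\<lambda>x. amp \<beta> x (E x) (F x) * (osc w x - c)"
  have cont: "continuous_on {0..a} ?P"
  proof (rule continuous_on_extend_powr_log_bound[OF a_pos _ q _ le])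
    show "continuous_on {0<..a} ?P"
      by (intro continuous_on_mult continuous_on_amp smooth_on_imp_continuous_on E F
          continuous_on_diff continuous_on_osc continuous_on_const) auto
  qed auto
  have d: "(?P has_vector_derivative ?D x * (osc w x - c) + \<i> * w * ?J x) (at x)" if x: "x \<in> {0<..<a}" for x
  proof -
    have "((\<lambda>x. osc w x - c) has_vector_derivative \<i> * w * dg x * osc w x) (at x)"
      using has_vector_derivative_diff[OF osc_deriv[OF x] has_vector_derivative_const[of c]] by simp
    from has_vector_derivative_mult[OF amp_deriv[OF E F x, of \<beta>] this]
    show ?thesis by (rule back_subst[of "\<lambda>d. (_ has_vector_derivative d) _"]) (simp add: amp_def algebra_simps)
  qed
  have "((\<lambda>x. ?D x * (osc w x - c) + \<i> * w * ?J x) has_integral ?P a - ?P 0) {0..a}"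
    by (rule fundamental_theorem_of_calculus_interior[OF _ cont d]) (use a_pos in auto)
  moreover have "((\<lambda>x. ?D x * (osc w x - c) + \<i> * w * ?J x) has_integral
     integral {0..a} (\<lambda>x. ?D x * (osc w x - c)) + \<i> * w * integral {0..a} ?J) {0..a}"
    by (intro has_integral_add has_integral_mult_right integrable_integral I1 I2)
  ultimately show ?thesis by (auto dest: has_integral_unique)
qed

lemma vanishes_pair_bound:
  assumes E: "bounded_comb a W E" and F: "bounded_comb a W F"
    and v: "\<And>w. w \<in> W \<Longrightarrow> vanishes a 0 p (E w)" "\<And>w. w \<in> W \<Longrightarrow> vanishes a 0 p (F w)"
  obtains C where "C \<ge> 0" "\<And>w x. w \<in> W \<Longrightarrow> x \<in> {0<..a} \<Longrightarrow> norm (E w x) \<le> C * x powr real p"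
    "\<And>w x. w \<in> W \<Longrightarrow> x \<in> {0<..a} \<Longrightarrow> norm (F w x) \<le> C * x powr real p"
proof -
  obtain C1 where C1: "C1 \<ge> 0" "\<forall>w\<in>W. \<forall>x\<in>{0..a}. norm (E w x) \<le> C1 * x ^ p"
    using bounded_comb_vanishes_bound[OF a_pos E, of p] v(1) by blast
  obtain C2 where C2: "C2 \<ge> 0" "\<forall>w\<in>W. \<forall>x\<in>{0..a}. norm (F w x) \<le> C2 * x ^ p"
    using bounded_comb_vanishes_bound[OF a_pos F, of p] v(2) by blast
  have "norm (E w x) \<le> (C1 + C2) * x powr real p \<and> norm (F w x) \<le> (C1 + C2) * x powr real p"
    if "w \<in> W" "x \<in> {0<..a}" for w x
  proof -
    have "norm (E w x) \<le> C1 * x powr real p" "norm (F w x) \<le> C2 * x powr real p"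
      using C1 C2 that by (auto simp: powr_realpow)
    moreover have "0 \<le> C1 * x powr real p" "0 \<le> C2 * x powr real p" using C1 C2 by auto
    ultimately show ?thesis by (simp add: distrib_right)
  qed
  then show ?thesis using that[of "C1 + C2"] C1 C2 by auto
qed

text \<open>For \<open>p = 0\<close> the derivative is merely bounded; the weaker power \<open>-1\<close> is recorded to have one formula for all \<open>p\<close>.\<close>

lemma vanishes_pair_deriv_bound:
  assumes E: "bounded_comb a W E" and F: "bounded_comb a W F"
    and v: "\<And>w. w \<in> W \<Longrightarrow> vanishes a 0 p (E w)" "\<And>w. w \<in> W \<Longrightarrow> vanishes a 0 p (F w)"
  obtains C where "C \<ge> 0" "\<And>w x. w \<in> W \<Longrightarrow> x \<in> {0<..a} \<Longrightarrow> norm (deriv_on a (E w) x) \<le> C * x powr (real p - 1)"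
    "\<And>w x. w \<in> W \<Longrightarrow> x \<in> {0<..a} \<Longrightarrow> norm (deriv_on a (F w) x) \<le> C * x powr (real p - 1)"
proof (cases p)
  case (Suc q)
  have v': "vanishes a 0 q (deriv_on a (E w))" "vanishes a 0 q (deriv_on a (F w))" if "w \<in> W" for w
    using v[OF that] Suc by (simp_all add: vanishes_Suc)
  have pq: "real p - 1 = real q" using Suc by simp
  show ?thesis
    by (rule vanishes_pair_bound[OF bounded_comb_deriv[OF a_pos E] bounded_comb_deriv[OF a_pos F] v'])
       (assumption, assumption, rule that, simp_all only: pq)
next
  case 0
  obtain C where C: "C \<ge> 0" "\<And>w x. w \<in> W \<Longrightarrow> x \<in> {0<..a} \<Longrightarrow> norm (deriv_on a (E w) x) \<le> C * x powr real 0"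
    "\<And>w x. w \<in> W \<Longrightarrow> x \<in> {0<..a} \<Longrightarrow> norm (deriv_on a (F w) x) \<le> C * x powr real 0"
    using vanishes_pair_bound[OF bounded_comb_deriv[OF a_pos E] bounded_comb_deriv[OF a_pos F], of 0] by auto
  have le: "C * x powr real 0 \<le> C * a * x powr (real p - 1)" if x: "x \<in> {0<..a}" for x
  proof -
    have "C * 1 \<le> C * (a * x powr (-1))"
      using x C(1) by (intro mult_left_mono) (auto simp: powr_minus_divide)
    then show ?thesis using x 0 by simp
  qed
  show ?thesis
  proof (rule that[of "C * a"])
    show "C * a \<ge> 0" using C(1) a_pos by simp
  qed (rule order_trans[OF _ le], rule C, assumption+)+
qed

lemma norm_osc [simp]: "norm (osc w x) = 1"
  using norm_exp_i_times[of "w * g x"] by (simp add: mult.assoc)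

lemma norm_osc_minus_1_bound:
  "\<exists>k\<ge>0. \<forall>w\<ge>0. \<forall>x\<in>{0<..a}. norm (osc w x - 1) \<le> k * (w * x)"
proof -
  obtain k where k: "k \<ge> 0" "\<forall>x\<in>{0<..a}. g x powr 1 \<le> k * x powr 1" using g_powr_bound by blast
  have "norm (osc w x - 1) \<le> k * (w * x)" if w: "w \<ge> 0" and x: "x \<in> {0<..a}" for w x
  proof -
    have "norm (osc w x - 1) \<le> w * g x"
      using norm_cexp_minus_1_le[of "w * g x"] w g_pos[OF x] by (simp add: mult.assoc)
    also have "\<dots> \<le> w * (k * x)"
      using k(2)[rule_format, OF x] x w g_pos[OF x] by (intro mult_left_mono) auto
    finally show ?thesis by (simp add: mult_ac)
  qed
  then show ?thesis using k(1) by blast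
qed

text \<open>Integration by parts with the phase factor \<open>osc - 1\<close> turns the amplitude, of size \<open>x powr \<alpha>\<close> up to the logarithm, into
  one of size \<open>x powr (\<alpha> - 1) * min 1 (w * x)\<close>, to which \<open>singular_integral_bound\<close> applies. The boundary term at \<open>a\<close> is
  \<open>O(1 / w)\<close>, which is why the rate is capped at \<open>min (1 + \<alpha>) 1\<close>.\<close>

lemma osc_integral_base:
  assumes al: "-1 < \<alpha>" "\<alpha> \<noteq> 0" "\<alpha> < 1"
    and W: "\<And>w. w \<in> W \<Longrightarrow> w \<ge> 1 \<and> w \<ge> 1 / a"
    and E: "bounded_comb a W E" and F: "bounded_comb a W F"
    and vE: "\<And>w. w \<in> W \<Longrightarrow> vanishes a 0 j (E w)" and vF: "\<And>w. w \<in> W \<Longrightarrow> vanishes a 0 j (F w)"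
  shows "\<exists>C\<ge>0. \<forall>w\<in>W. norm (integral {0..a} (\<lambda>x. amp (\<alpha> - real j) x (E w x) (F w x) * osc w x))
    \<le> C * delta \<alpha> w * w powr (- min (1 + \<alpha>) 1)"
proof -
  define \<beta> where "\<beta> = \<alpha> - real j"
  define E1 where "E1 w x = E w x * complex_of_real (1 / dg x)" for w x
  define F1 where "F1 w x = F w x * complex_of_real (1 / dg x)" for w x
  have 0: "0 \<in> {0..a}" using a_pos by simp
  have bE1: "bounded_comb a W E1" unfolding E1_def by (intro bounded_comb_mult a_pos smooth_inverse_dg E)
  have bF1: "bounded_comb a W F1" unfolding F1_def by (intro bounded_comb_mult a_pos smooth_inverse_dg F)
  have vE1: "vanishes a 0 j (E1 w)" if "w \<in> W" for w unfolding E1_def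
    by (intro vanishes_mult a_pos 0 smooth_inverse_dg vE that bounded_comb_smooth[OF a_pos E that])
  have vF1: "vanishes a 0 j (F1 w)" if "w \<in> W" for w unfolding F1_def
    by (intro vanishes_mult a_pos 0 smooth_inverse_dg vF that bounded_comb_smooth[OF a_pos F that])
  have dE1: "dg x * E1 w x = E w x" and dF1: "dg x * F1 w x = F w x" if "x \<in> {0..a}" for w x
    using dg_pos[OF that] by (simp_all add: E1_def F1_def)
  have bEF: "bounded_comb a W (\<lambda>w x. \<beta> * E w x)" "bounded_comb a W (\<lambda>w x. \<beta> * F w x + E w x)"
    by (intro bounded_comb.add bounded_comb_cmult a_pos E F)+
  note smE = bounded_comb_smooth[OF a_pos E] and smF = bounded_comb_smooth[OF a_pos F]
  have vEF: "vanishes a 0 j (\<lambda>x. \<beta> * E w x)" "vanishes a 0 j (\<lambda>x. \<beta> * F w x + E w x)" if "w \<in> W" for w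
  proof -
    have "vanishes a 0 j (\<lambda>x. E w x * \<beta>)" "vanishes a 0 j (\<lambda>x. F w x * \<beta>)"
      by (intro vanishes_mult a_pos 0 smooth_on_const smE smF vE vF that)+
    then show e: "vanishes a 0 j (\<lambda>x. \<beta> * E w x)" and f: "vanishes a 0 j (\<lambda>x. \<beta> * F w x + E w x)"
      using that by (auto simp: mult.commute intro!: vanishes_add a_pos 0 smooth_on_mult smooth_on_const smE smF vE)
  qed
  obtain C0 where C0: "C0 \<ge> 0" "\<And>w x. w \<in> W \<Longrightarrow> x \<in> {0<..a} \<Longrightarrow> norm (E1 w x) \<le> C0 * x powr real j"
    "\<And>w x. w \<in> W \<Longrightarrow> x \<in> {0<..a} \<Longrightarrow> norm (F1 w x) \<le> C0 * x powr real j"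
    using vanishes_pair_bound[OF bE1 bF1 vE1 vF1] by metis
  obtain C1 where C1: "C1 \<ge> 0" "\<And>w x. w \<in> W \<Longrightarrow> x \<in> {0<..a} \<Longrightarrow> norm (deriv_on a (E1 w) x) \<le> C1 * x powr (real j - 1)"
    "\<And>w x. w \<in> W \<Longrightarrow> x \<in> {0<..a} \<Longrightarrow> norm (deriv_on a (F1 w) x) \<le> C1 * x powr (real j - 1)"
    using vanishes_pair_deriv_bound[OF bE1 bF1 vE1 vF1] by metis
  obtain C2 where C2: "C2 \<ge> 0" "\<And>w x. w \<in> W \<Longrightarrow> x \<in> {0<..a} \<Longrightarrow> norm (\<beta> * E w x) \<le> C2 * x powr real j"
    "\<And>w x. w \<in> W \<Longrightarrow> x \<in> {0<..a} \<Longrightarrow> norm (\<beta> * F w x + E w x) \<le> C2 * x powr real j"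
    using vanishes_pair_bound[OF bEF vEF] by metis
  obtain C3 where C3: "C3 \<ge> 0" "\<And>w x. w \<in> W \<Longrightarrow> x \<in> {0<..a} \<Longrightarrow> norm (E w x) \<le> C3 * x powr real j"
    "\<And>w x. w \<in> W \<Longrightarrow> x \<in> {0<..a} \<Longrightarrow> norm (F w x) \<le> C3 * x powr real j"
    using vanishes_pair_bound[OF E F vE vF] by metis
  obtain K where K: "K \<ge> 0" "\<And>x C \<rho> u v. x\<in>{0<..a} \<Longrightarrow> norm u \<le> C * x powr \<rho> \<Longrightarrow> norm v \<le> C * x powr \<rho> \<Longrightarrow>
     norm (amp \<beta> x u v) \<le> K * C * x powr (\<beta> + \<rho>) * (1 + \<bar>ln x\<bar>)" using amp_bound[of \<beta>] by blast
  obtain K' where K': "K' \<ge> 0" "\<And>x C \<rho> u v. x\<in>{0<..a} \<Longrightarrow> norm u \<le> C * x powr \<rho> \<Longrightarrow> norm v \<le> C * x powr \<rho> \<Longrightarrow>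
     norm (amp (\<beta> - 1) x u v) \<le> K' * C * x powr (\<beta> - 1 + \<rho>) * (1 + \<bar>ln x\<bar>)" using amp_bound[of "\<beta> - 1"] by blast
  obtain kg where kg: "kg \<ge> 0" "\<forall>w\<ge>0. \<forall>x\<in>{0<..a}. norm (osc w x - 1) \<le> kg * (w * x)"
    using norm_osc_minus_1_bound by blast
  obtain S where S: "S \<ge> 0"
    "\<And>w C D. w \<ge> 1 \<Longrightarrow> w \<ge> 1 / a \<Longrightarrow> C \<ge> 0 \<Longrightarrow> (D :: real \<Rightarrow> complex) integrable_on {0..a} \<Longrightarrow>
       (\<And>x. x \<in> {0<..a} \<Longrightarrow> norm (D x) \<le> C * x powr (\<alpha> - 1) * (1 + \<bar>ln x\<bar>) * min 1 (w * x)) \<Longrightarrow>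
       norm (integral {0..a} D) \<le> S * C * delta \<alpha> w * w powr (1 - min (1 + \<alpha>) 1)"
    using singular_integral_bound[OF a_pos al] by metis
  \<comment> \<open>Covers the bound by \<open>w x\<close> near 0 and the trivial bound 2 elsewhere.\<close>
  define P where "P = kg + 2"
  have p: "norm (osc w x - 1) \<le> P * min 1 (w * x)" if w: "w \<in> W" and x: "x \<in> {0<..a}" for w x
  proof -
    have w0: "w > 0" using W[OF w] by simp
    have 1: "norm (osc w x - 1) \<le> kg * (w * x)" using kg(2) w0 x by auto
    have 2: "norm (osc w x - 1) \<le> 2" using norm_triangle_ineq4[of "osc w x" 1] by simp
    have "0 \<le> w * x" using w0 x by simp
    then have "kg * (w * x) \<le> P * (w * x)" "2 \<le> P" using kg(1) unfolding P_def by (auto intro: mult_right_mono)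
    then show ?thesis using 1 2 by (auto simp: min_def)
  qed
  have P0: "P \<ge> 0" using kg by (simp add: P_def)
  define D where "D w x = amp \<beta> x (deriv_on a (E1 w) x) (deriv_on a (F1 w) x)
       + amp (\<beta> - 1) x (\<beta> * (dg x * E1 w x)) (\<beta> * (dg x * F1 w x) + dg x * E1 w x)" for w x
  have D_eq: "D w x = amp \<beta> x (deriv_on a (E1 w) x) (deriv_on a (F1 w) x) + amp (\<beta> - 1) x (\<beta> * E w x) (\<beta> * F w x + E w x)"
    if "x \<in> {0..a}" for w x unfolding D_def using dE1[OF that] dF1[OF that] by simp
  define B where "B = (K * C1 + K' * C2) * P"
  have B0: "B \<ge> 0" unfolding B_def using K K' C1 C2 P0 by simp
  have Dle: "norm (D w x * (osc w x - 1)) \<le> B * x powr (\<alpha> - 1) * (1 + \<bar>ln x\<bar>) * min 1 (w * x)"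
    if w: "w \<in> W" and x: "x \<in> {0<..a}" for w x
  proof -
    have e: "\<beta> + (real j - 1) = \<alpha> - 1" "\<beta> - 1 + real j = \<alpha> - 1" by (simp_all add: \<beta>_def)
    have xa: "x \<in> {0..a}" using x by auto
    have "norm (D w x) \<le> K * C1 * x powr (\<alpha> - 1) * (1 + \<bar>ln x\<bar>) + K' * C2 * x powr (\<alpha> - 1) * (1 + \<bar>ln x\<bar>)"
      unfolding D_eq[OF xa]
      by (rule norm_triangle_mono[OF K(2)[OF x C1(2,3)[OF w x], unfolded e] K'(2)[OF x C2(2,3)[OF w x], unfolded e]])
    also have "\<dots> = (K * C1 + K' * C2) * x powr (\<alpha> - 1) * (1 + \<bar>ln x\<bar>)" by (simp only: distrib_right)
    finally have "norm (D w x) * norm (osc w x - 1) \<le> ((K * C1 + K' * C2) * x powr (\<alpha> - 1) * (1 + \<bar>ln x\<bar>)) * (P * min 1 (w * x))"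
      using p[OF w x] K K' C1 C2 by (intro mult_mono) auto
    then show ?thesis by (simp add: norm_mult B_def mult_ac)
  qed
  define A where "A = K * C0 * a powr \<alpha> * (1 + \<bar>ln a\<bar>) * P"
  have A0: "A \<ge> 0" unfolding A_def using K C0 P0 by simp
  have "norm (integral {0..a} (\<lambda>x. amp \<beta> x (E w x) (F w x) * osc w x)) \<le> (A + S * B) * delta \<alpha> w * w powr (- min (1 + \<alpha>) 1)"
    if w: "w \<in> W" for w
  proof -
    have w1: "w \<ge> 1" "w \<ge> 1 / a" using W[OF w] by auto
    have sm: "smooth_on {0..a} (E1 w)" "smooth_on {0..a} (F1 w)"
      by (intro bounded_comb_smooth[OF a_pos _ w] bE1 bF1)+
    have cd: "continuous_on {0..a} (deriv_on a (E1 w))" "continuous_on {0..a} (deriv_on a (F1 w))"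
      by (intro smooth_on_imp_continuous_on smooth_on_deriv sm)+
    have co: "continuous_on {0..a} (\<lambda>x. osc w x - 1)"
      by (intro continuous_on_diff continuous_on_osc continuous_on_const) simp
    have cEF: "continuous_on {0..a} (E w)" "continuous_on {0..a} (F w)"
      by (intro smooth_on_imp_continuous_on smE smF w)+
    have Dcont: "continuous_on {0<..a} (\<lambda>x. D w x * (osc w x - 1))"
    proof -
      have "continuous_on {0<..a} (\<lambda>x. (amp \<beta> x (deriv_on a (E1 w) x) (deriv_on a (F1 w) x)
          + amp (\<beta> - 1) x (\<beta> * E w x) (\<beta> * F w x + E w x)) * (osc w x - 1))"
        by (intro continuous_on_mult continuous_on_add continuous_on_amp cd cEF continuous_on_const
             continuous_on_subset[OF co]) auto
      then show ?thesis by (rule continuous_on_eq) (simp add: D_eq)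
    qed
    have I1: "(\<lambda>x. D w x * (osc w x - 1)) integrable_on {0..a}"
    proof (rule integrable_powr_log_bound[OF a_pos Dcont])
      show "\<alpha> + 1 > 0" using al by simp
      fix x assume x: "x \<in> {0<..a}"
      have "B * x powr (\<alpha> - 1) * (1 + \<bar>ln x\<bar>) * min 1 (w * x) \<le> B * x powr (\<alpha> - 1) * (1 + \<bar>ln x\<bar>) * (w * x)"
        using B0 by (intro mult_left_mono) auto
      also have "\<dots> = B * w * (x powr (\<alpha> - 1) * x powr 1) * (1 + \<bar>ln x\<bar>)" using x by (simp add: mult_ac)
      also have "x powr (\<alpha> - 1) * x powr 1 = x powr (\<alpha> + 1 - 1)" by (simp only: powr_add[symmetric]) simp
      finally show "norm (D w x * (osc w x - 1)) \<le> B * w * x powr (\<alpha> + 1 - 1) * (1 + \<bar>ln x\<bar>)"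
        using Dle[OF w x] by linarith
    qed
    have I2: "(\<lambda>x. amp \<beta> x (E w x) (F w x) * osc w x) integrable_on {0..a}"
      by (rule amp_integrable[OF cEF continuous_on_osc C3(2,3)[OF w]]) (use al \<beta>_def in auto)
    have I2': "(\<lambda>x. amp \<beta> x (dg x * E1 w x) (dg x * F1 w x) * osc w x) integrable_on {0..a}"
      by (rule integrable_eq[OF I2]) (simp add: dE1 dF1)
    have J: "integral {0..a} (\<lambda>x. amp \<beta> x (dg x * E1 w x) (dg x * F1 w x) * osc w x)
       = integral {0..a} (\<lambda>x. amp \<beta> x (E w x) (F w x) * osc w x)" (is "_ = ?J")
      by (rule integral_cong) (simp add: dE1 dF1)
    have e0: "\<beta> + real j = \<alpha>" by (simp add: \<beta>_def)
    have b0: "norm (amp \<beta> x (E1 w x) (F1 w x)) \<le> K * C0 * x powr \<alpha> * (1 + \<bar>ln x\<bar>)" if "x \<in> {0<..a}" for x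
      using K(2)[OF that C0(2,3)[OF w that]] unfolding e0 .
    have lim: "norm (amp \<beta> x (E1 w x) (F1 w x) * (osc w x - 1)) \<le> K * C0 * P * w * x powr (\<alpha> + 1) * (1 + \<bar>ln x\<bar>)"
      if x: "x \<in> {0<..a}" for x
    proof -
      have "norm (osc w x - 1) \<le> P * (w * x)" using p[OF w x] P0
        by (meson min.cobounded2 mult_left_mono order_trans)
      then have "norm (amp \<beta> x (E1 w x) (F1 w x)) * norm (osc w x - 1) \<le> (K * C0 * x powr \<alpha> * (1 + \<bar>ln x\<bar>)) * (P * (w * x))"
        using b0[OF x] K C0 by (intro mult_mono) auto
      also have "\<dots> = K * C0 * P * w * (x powr \<alpha> * x powr 1) * (1 + \<bar>ln x\<bar>)" using x by (simp add: mult_ac)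
      finally show ?thesis by (simp only: norm_mult powr_add)
    qed
    have q: "\<alpha> + 1 > 0" using al by simp
    have iwJ: "\<i> * w * ?J = amp \<beta> a (E1 w a) (F1 w a) * (osc w a - 1) - integral {0..a} (\<lambda>x. D w x * (osc w x - 1))"
      using amp_ibp[OF sm q lim I1[unfolded D_def] I2'] unfolding J D_def by simp
    have "norm (\<i> * w * ?J) \<le> norm (amp \<beta> a (E1 w a) (F1 w a) * (osc w a - 1)) + norm (integral {0..a} (\<lambda>x. D w x * (osc w x - 1)))"
      unfolding iwJ by (rule norm_triangle_ineq4)
    also have "norm (amp \<beta> a (E1 w a) (F1 w a) * (osc w a - 1)) \<le> A"
    proof -
      have aa: "a \<in> {0<..a}" using a_pos by simp
      have "norm (osc w a - 1) \<le> P * 1" using p[OF w aa] P0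
        by (meson min.cobounded1 mult_left_mono order_trans)
      then have "norm (amp \<beta> a (E1 w a) (F1 w a)) * norm (osc w a - 1) \<le> (K * C0 * a powr \<alpha> * (1 + \<bar>ln a\<bar>)) * (P * 1)"
        using b0[OF aa] K C0 by (intro mult_mono) auto
      then show ?thesis by (simp add: A_def norm_mult)
    qed
    also have "A \<le> A * (delta \<alpha> w * w powr (1 - min (1 + \<alpha>) 1))"
    proof -
      have "1 * 1 \<le> delta \<alpha> w * w powr (1 - min (1 + \<alpha>) 1)"
        using delta_ge_1[of \<alpha> w] w1 by (intro mult_mono) (auto intro: ge_one_powr_ge_zero)
      then show ?thesis using A0 mult_left_mono[of 1 _ A] by simp
    qed
    also have "norm (integral {0..a} (\<lambda>x. D w x * (osc w x - 1))) \<le> S * B * delta \<alpha> w * w powr (1 - min (1 + \<alpha>) 1)"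
      by (rule S(2)[OF w1 B0 I1 Dle[OF w]])
    finally have "w * norm ?J \<le> (A + S * B) * delta \<alpha> w * w powr (1 - min (1 + \<alpha>) 1)"
      using w1 by (simp add: norm_mult algebra_simps)
    also have "w powr (1 - min (1 + \<alpha>) 1) = w * w powr (- min (1 + \<alpha>) 1)"
      using w1 by (simp add: powr_diff powr_minus_divide)
    finally have "w * norm ?J \<le> w * ((A + S * B) * delta \<alpha> w * w powr (- min (1 + \<alpha>) 1))"
      by (simp only: mult_ac)
    then show ?thesis using w1 by simp
  qed
  moreover have "A + S * B \<ge> 0" using A0 S(1) B0 by simp
  ultimately show ?thesis unfolding \<beta>_def by blast
qed

text \<open>Each integration by parts turns the pair at \<open>(k + 1, j)\<close> into two pairs, at \<open>(k, j)\<close> when the derivative falls on the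
  entries and at \<open>(k, j + 1)\<close> when it falls on the weight. The index \<open>j\<close> counts the powers of \<open>g\<close> lost in
  this way; it is matched by zeros at 0 that have not been used up, so the amplitude never exceeds
  \<open>x powr \<alpha>\<close> up to the logarithm.\<close>

lemma osc_integral_decay:
  assumes al: "-1 < \<alpha>" "\<alpha> \<noteq> 0" "\<alpha> < 1"
    and W: "\<And>w. w \<in> W \<Longrightarrow> w \<ge> 1 \<and> w \<ge> 1 / a"
  shows "bounded_comb a W E \<Longrightarrow> bounded_comb a W F \<Longrightarrow>
    (\<And>w. w \<in> W \<Longrightarrow> vanishes a 0 (k + j) (E w) \<and> vanishes a 0 (k + j) (F w)) \<Longrightarrow>
    (\<And>w. w \<in> W \<Longrightarrow> vanishes a a k (E w) \<and> vanishes a a k (F w)) \<Longrightarrow>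
    \<exists>C\<ge>0. \<forall>w\<in>W. norm (integral {0..a} (\<lambda>x. amp (\<alpha> - real j) x (E w x) (F w x) * osc w x))
      \<le> C * delta \<alpha> w * w powr (- real k - min (1 + \<alpha>) 1)"
proof (induction k arbitrary: j E F)
  case 0
  then show ?case using osc_integral_base[OF al W 0(1,2), of j] by simp
next
  case (Suc k)
  note E = Suc.prems(1) and F = Suc.prems(2)
  define \<beta> where "\<beta> = \<alpha> - real j"
  define E1 where "E1 w x = E w x * complex_of_real (1 / dg x)" for w x
  define F1 where "F1 w x = F w x * complex_of_real (1 / dg x)" for w x
  have ia: "0 \<in> {0..a}" "a \<in> {0..a}" using a_pos by auto
  note smE = bounded_comb_smooth[OF a_pos E] and smF = bounded_comb_smooth[OF a_pos F]
  have bE1: "bounded_comb a W E1" unfolding E1_def by (intro bounded_comb_mult a_pos smooth_inverse_dg E)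
  have bF1: "bounded_comb a W F1" unfolding F1_def by (intro bounded_comb_mult a_pos smooth_inverse_dg F)
  have v0: "vanishes a 0 (Suc k + j) (E1 w)" "vanishes a 0 (Suc k + j) (F1 w)" if "w \<in> W" for w
    unfolding E1_def F1_def
    by (rule vanishes_mult[OF a_pos ia(1) smE[OF that] smooth_inverse_dg conjunct1[OF Suc.prems(3)[OF that]]],
        rule vanishes_mult[OF a_pos ia(1) smF[OF that] smooth_inverse_dg conjunct2[OF Suc.prems(3)[OF that]]])
  have va: "vanishes a a (Suc k) (E1 w)" "vanishes a a (Suc k) (F1 w)" if "w \<in> W" for w
    unfolding E1_def F1_def
    by (rule vanishes_mult[OF a_pos ia(2) smE[OF that] smooth_inverse_dg conjunct1[OF Suc.prems(4)[OF that]]],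
        rule vanishes_mult[OF a_pos ia(2) smF[OF that] smooth_inverse_dg conjunct2[OF Suc.prems(4)[OF that]]])
  have dE1: "dg x * E1 w x = E w x" and dF1: "dg x * F1 w x = F w x" if "x \<in> {0..a}" for w x
    using dg_pos[OF that] by (simp_all add: E1_def F1_def)
  define E2 where "E2 w x = \<beta> * E w x" for w x
  define F2 where "F2 w x = \<beta> * F w x + E w x" for w x
  have b2: "bounded_comb a W E2" "bounded_comb a W F2"
    unfolding E2_def F2_def by (intro bounded_comb.add bounded_comb_cmult a_pos E F)+
  have v2: "vanishes a y p (E2 w)" "vanishes a y p (F2 w)"
    if "w \<in> W" "y \<in> {0..a}" "vanishes a y p (E w)" "vanishes a y p (F w)" for w y p
  proof -
    have "vanishes a y p (\<lambda>x. E w x * \<beta>)" "vanishes a y p (\<lambda>x. F w x * \<beta>)"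
      by (intro vanishes_mult a_pos smooth_on_const smE smF that)+
    then show "vanishes a y p (E2 w)" "vanishes a y p (F2 w)"
      unfolding E2_def F2_def using that
      by (auto simp: mult.commute intro!: vanishes_add a_pos smooth_on_mult smooth_on_const smE smF)
  qed
  have "\<exists>C\<ge>0. \<forall>w\<in>W. norm (integral {0..a} (\<lambda>x. amp (\<alpha> - real j) x (deriv_on a (E1 w) x) (deriv_on a (F1 w) x) * osc w x))
      \<le> C * delta \<alpha> w * w powr (- real k - min (1 + \<alpha>) 1)"
    using v0 va by (intro Suc.IH bounded_comb_deriv a_pos bE1 bF1) (auto simp: vanishes_Suc)
  then obtain C1 where C1: "C1 \<ge> 0" "\<And>w. w \<in> W \<Longrightarrow>
    norm (integral {0..a} (\<lambda>x. amp \<beta> x (deriv_on a (E1 w) x) (deriv_on a (F1 w) x) * osc w x))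
      \<le> C1 * delta \<alpha> w * w powr (- real k - min (1 + \<alpha>) 1)" unfolding \<beta>_def by blast
  have ex2: "\<exists>C\<ge>0. \<forall>w\<in>W. norm (integral {0..a} (\<lambda>x. amp (\<alpha> - real (Suc j)) x (E2 w x) (F2 w x) * osc w x))
      \<le> C * delta \<alpha> w * w powr (- real k - min (1 + \<alpha>) 1)"
  proof (rule Suc.IH[OF b2])
    fix w assume w: "w \<in> W"
    show "vanishes a 0 (k + Suc j) (E2 w) \<and> vanishes a 0 (k + Suc j) (F2 w)"
      using v2[OF w ia(1), of "k + Suc j"] Suc.prems(3)[OF w] by simp
    show "vanishes a a k (E2 w) \<and> vanishes a a k (F2 w)"
      using v2[OF w ia(2), of k] Suc.prems(4)[OF w] vanishes_mono[of a a "Suc k" _ k] by auto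
  qed
  have bj: "\<alpha> - real (Suc j) = \<beta> - 1" by (simp add: \<beta>_def)
  obtain C2 where C2: "C2 \<ge> 0" "\<And>w. w \<in> W \<Longrightarrow>
    norm (integral {0..a} (\<lambda>x. amp (\<beta> - 1) x (E2 w x) (F2 w x) * osc w x))
      \<le> C2 * delta \<alpha> w * w powr (- real k - min (1 + \<alpha>) 1)"
    using ex2[unfolded bj] by blast
  obtain B0 where B0: "B0 \<ge> 0" "\<And>w x. w \<in> W \<Longrightarrow> x \<in> {0<..a} \<Longrightarrow> norm (E1 w x) \<le> B0 * x powr real (Suc k + j)"
    "\<And>w x. w \<in> W \<Longrightarrow> x \<in> {0<..a} \<Longrightarrow> norm (F1 w x) \<le> B0 * x powr real (Suc k + j)"
    using vanishes_pair_bound[OF bE1 bF1 v0] by metis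
  obtain B1 where B1: "\<And>w x. w \<in> W \<Longrightarrow> x \<in> {0<..a} \<Longrightarrow> norm (deriv_on a (E1 w) x) \<le> B1 * x powr (real (Suc k + j) - 1)"
    "\<And>w x. w \<in> W \<Longrightarrow> x \<in> {0<..a} \<Longrightarrow> norm (deriv_on a (F1 w) x) \<le> B1 * x powr (real (Suc k + j) - 1)"
    using vanishes_pair_deriv_bound[OF bE1 bF1 v0] by metis
  have v2': "vanishes a 0 (Suc k + j) (E2 w)" "vanishes a 0 (Suc k + j) (F2 w)" if "w \<in> W" for w
    using v2[OF that ia(1)] Suc.prems(3)[OF that] by blast+
  obtain B2 where B2: "\<And>w x. w \<in> W \<Longrightarrow> x \<in> {0<..a} \<Longrightarrow> norm (E2 w x) \<le> B2 * x powr real (Suc k + j)"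
    "\<And>w x. w \<in> W \<Longrightarrow> x \<in> {0<..a} \<Longrightarrow> norm (F2 w x) \<le> B2 * x powr real (Suc k + j)"
    using vanishes_pair_bound[OF b2 v2'] by metis
  have v3: "vanishes a 0 (Suc k + j) (E w)" "vanishes a 0 (Suc k + j) (F w)" if "w \<in> W" for w
    using Suc.prems(3)[OF that] by blast+
  obtain B3 where B3: "\<And>w x. w \<in> W \<Longrightarrow> x \<in> {0<..a} \<Longrightarrow> norm (E w x) \<le> B3 * x powr real (Suc k + j)"
    "\<And>w x. w \<in> W \<Longrightarrow> x \<in> {0<..a} \<Longrightarrow> norm (F w x) \<le> B3 * x powr real (Suc k + j)"
    using vanishes_pair_bound[OF E F v3] by metis
  obtain K where K: "\<And>x C \<rho> u v. x\<in>{0<..a} \<Longrightarrow> norm u \<le> C * x powr \<rho> \<Longrightarrow> norm v \<le> C * x powr \<rho> \<Longrightarrow>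
     norm (amp \<beta> x u v) \<le> K * C * x powr (\<beta> + \<rho>) * (1 + \<bar>ln x\<bar>)" using amp_bound[of \<beta>] by blast
  have "norm (integral {0..a} (\<lambda>x. amp \<beta> x (E w x) (F w x) * osc w x))
     \<le> (C1 + C2) * delta \<alpha> w * w powr (- real (Suc k) - min (1 + \<alpha>) 1)"
    if w: "w \<in> W" for w
  proof -
    have w1: "w \<ge> 1" using W[OF w] by auto
    have sm: "smooth_on {0..a} (E1 w)" "smooth_on {0..a} (F1 w)"
      by (intro bounded_comb_smooth[OF a_pos _ w] bE1 bF1)+
    have cd: "continuous_on {0..a} (deriv_on a (E1 w))" "continuous_on {0..a} (deriv_on a (F1 w))"
      by (intro smooth_on_imp_continuous_on smooth_on_deriv sm)+
    have c2: "continuous_on {0..a} (E2 w)" "continuous_on {0..a} (F2 w)"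
      by (intro smooth_on_imp_continuous_on bounded_comb_smooth[OF a_pos _ w] b2)+
    have cEF: "continuous_on {0..a} (E w)" "continuous_on {0..a} (F w)"
      by (intro smooth_on_imp_continuous_on smE smF w)+
    have ex: "\<beta> + (real (Suc k + j) - 1) > -1" "\<beta> - 1 + real (Suc k + j) > -1" "\<beta> + real (Suc k + j) > -1"
      using al by (simp_all add: \<beta>_def)
    have I1: "(\<lambda>x. amp \<beta> x (deriv_on a (E1 w) x) (deriv_on a (F1 w) x) * osc w x) integrable_on {0..a}"
      by (rule amp_integrable[OF cd continuous_on_osc B1(1,2)[OF w] ex(1)]) auto
    have I2: "(\<lambda>x. amp (\<beta> - 1) x (E2 w x) (F2 w x) * osc w x) integrable_on {0..a}"
      by (rule amp_integrable[OF c2 continuous_on_osc B2(1,2)[OF w] ex(2)]) auto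
    have I3: "(\<lambda>x. amp \<beta> x (E w x) (F w x) * osc w x) integrable_on {0..a}"
      by (rule amp_integrable[OF cEF continuous_on_osc B3(1,2)[OF w] ex(3)]) auto
    define D where "D x = amp \<beta> x (deriv_on a (E1 w) x) (deriv_on a (F1 w) x)
       + amp (\<beta> - 1) x (\<beta> * (dg x * E1 w x)) (\<beta> * (dg x * F1 w x) + dg x * E1 w x)" for x
    have D_eq: "D x * (osc w x - 0) = amp \<beta> x (deriv_on a (E1 w) x) (deriv_on a (F1 w) x) * osc w x
        + amp (\<beta> - 1) x (E2 w x) (F2 w x) * osc w x"
      if "x \<in> {0..a}" for x unfolding D_def E2_def F2_def using dE1[OF that] dF1[OF that] by (simp add: distrib_right)
    let ?I1 = "integral {0..a} (\<lambda>x. amp \<beta> x (deriv_on a (E1 w) x) (deriv_on a (F1 w) x) * osc w x)"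
    let ?I2 = "integral {0..a} (\<lambda>x. amp (\<beta> - 1) x (E2 w x) (F2 w x) * osc w x)"
    let ?J = "integral {0..a} (\<lambda>x. amp \<beta> x (E w x) (F w x) * osc w x)"
    have hD: "((\<lambda>x. D x * (osc w x - 0)) has_integral ?I1 + ?I2) {0..a}"
      by (rule has_integral_eq[OF D_eq[symmetric]]) (auto intro!: has_integral_add integrable_integral I1 I2)
    have I3': "(\<lambda>x. amp \<beta> x (dg x * E1 w x) (dg x * F1 w x) * osc w x) integrable_on {0..a}"
      by (rule integrable_eq[OF I3]) (simp add: dE1 dF1)
    have J: "integral {0..a} (\<lambda>x. amp \<beta> x (dg x * E1 w x) (dg x * F1 w x) * osc w x) = ?J"
      by (rule integral_cong) (simp add: dE1 dF1)
    have le: "norm (amp \<beta> x (E1 w x) (F1 w x) * (osc w x - 0)) \<le> K * B0 * x powr (\<beta> + real (Suc k + j)) * (1 + \<bar>ln x\<bar>)"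
      if "x \<in> {0<..a}" for x
      using K[OF that B0(2,3)[OF w that]] by (simp add: norm_mult)
    have q: "\<beta> + real (Suc k + j) > 0" using al by (simp add: \<beta>_def)
    have Ea: "E1 w a = 0" "F1 w a = 0" using va[OF w] by (simp_all add: vanishes_Suc)
    have "amp \<beta> a (E1 w a) (F1 w a) * (osc w a - 0) = (?I1 + ?I2) + \<i> * w * ?J"
      using amp_ibp[OF sm q le hD[THEN has_integral_integrable, unfolded D_def] I3'] integral_unique[OF hD]
      unfolding J D_def by simp
    then have "(?I1 + ?I2) + \<i> * w * ?J = 0" unfolding Ea by (simp add: amp_def[of \<beta> a 0 0])
    from minus_unique[OF this, symmetric] have "\<i> * w * ?J = - (?I1 + ?I2)" .
    then have "norm (\<i> * w * ?J) = norm (?I1 + ?I2)" by (simp only: norm_minus_cancel)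
    then have "w * norm ?J = norm (?I1 + ?I2)" using w1 by (simp add: norm_mult)
    also have "\<dots> \<le> C1 * delta \<alpha> w * w powr (- real k - min (1 + \<alpha>) 1) + C2 * delta \<alpha> w * w powr (- real k - min (1 + \<alpha>) 1)"
      by (rule norm_triangle_mono[OF C1(2)[OF w] C2(2)[OF w]])
    also have "\<dots> = (C1 + C2) * delta \<alpha> w * w powr (- real k - min (1 + \<alpha>) 1)" by (simp add: algebra_simps)
    also have "w powr (- real k - min (1 + \<alpha>) 1) = w * w powr (- real (Suc k) - min (1 + \<alpha>) 1)"
    proof -
      have "- real k - min (1 + \<alpha>) 1 = 1 + (- real (Suc k) - min (1 + \<alpha>) 1)" by simp
      then show ?thesis using w1 by (simp only: powr_add) simp
    qed
    finally have "w * norm ?J \<le> w * ((C1 + C2) * delta \<alpha> w * w powr (- real (Suc k) - min (1 + \<alpha>) 1))"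
      by (simp only: mult_ac)
    then show ?thesis using w1 by simp
  qed
  then show ?case using C1(1) C2(1) unfolding \<beta>_def by (intro exI[of _ "C1 + C2"]) auto
qed

section \<open>The antiderivative behind the Levin bracket\<close>

lemma g_powr_add_1: "x \<in> {0<..a} \<Longrightarrow> g x powr (1 + \<alpha>) = g x * g x powr \<alpha>"
  using g_pos[of x] by (simp add: powr_add)

text \<open>The left-hand side lists the terms of the product rule for the antiderivative below that do not cancel.\<close>

lemma amp_osc_integrand:
  fixes q l :: "real \<Rightarrow> complex"
  assumes x: "x \<in> {0<..a}"
  shows "(amp (1 + \<alpha>) x (deriv_on a q x) (deriv_on a l x)
       + amp \<alpha> x ((1 + \<alpha>) * (dg x * q x)) ((1 + \<alpha>) * (dg x * l x) + dg x * q x)) * osc w x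
     + amp (1 + \<alpha>) x (q x) (l x) * (\<i> * w * dg x * osc w x)
     + amp \<alpha> x c0 d0 * (\<i> * w * dg x * osc w x)
   = amp \<alpha> x (levin_op a \<alpha> g w c0 q x) (levin_op a \<alpha> g w d0 l x + dg x * q x) * osc w x"
  unfolding amp_def levin_op_def g_powr_add_1[OF x] by (simp add: algebra_simps)

lemma smooth_pair_bound:
  fixes u v :: "real \<Rightarrow> complex"
  assumes u: "smooth_on {0..a} u" and v: "smooth_on {0..a} v"
  shows "\<exists>C\<ge>0. \<forall>x\<in>{0<..a}. norm (u x) \<le> C * x powr 0 \<and> norm (v x) \<le> C * x powr (0::real)"
proof (rule vanishes_pair_bound[OF bounded_comb_fixed[OF u, where W = "{0}"] bounded_comb_fixed[OF v, where W = "{0}"]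
      vanishes_0 vanishes_0])
  fix C :: real
  assume C: "C \<ge> 0" "\<And>w x. w \<in> {0::real} \<Longrightarrow> x \<in> {0<..a} \<Longrightarrow> norm (u x) \<le> C * x powr real 0"
    "\<And>w x. w \<in> {0::real} \<Longrightarrow> x \<in> {0<..a} \<Longrightarrow> norm (v x) \<le> C * x powr real 0"
  show ?thesis using C(1) C(2,3)[of 0] by (intro exI[of _ C]) auto
qed

lemma amp_osc_integrable:
  assumes al: "-1 < \<alpha>" and u: "smooth_on {0..a} u" and v: "smooth_on {0..a} v"
  shows "(\<lambda>x. amp \<alpha> x (u x) (v x) * osc w x) integrable_on {0..a}"
proof -
  obtain C where C: "\<And>x. x \<in> {0<..a} \<Longrightarrow> norm (u x) \<le> C * x powr 0" "\<And>x. x \<in> {0<..a} \<Longrightarrow> norm (v x) \<le> C * x powr 0"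
    using smooth_pair_bound[OF u v] by blast
  show ?thesis
    by (rule amp_integrable[OF smooth_on_imp_continuous_on[OF u] smooth_on_imp_continuous_on[OF v] continuous_on_osc C])
       (use al in auto)
qed

lemma levin_op_smooth:
  assumes "smooth_on {0..a} q"
  shows "smooth_on {0..a} (levin_op a \<alpha> g w c q)"
  unfolding levin_op_def[abs_def]
  by (intro smooth_on_add smooth_on_mult smooth_on_const smooth_dg smooth_on_of_real smooth_g smooth_on_deriv assms a_pos)

text \<open>The integral in \<open>E\<close> is chosen so that its integrand cancels the derivative of the weight in the middle term. This
  derivative is singular of order \<open>\<alpha> - 1\<close>; only the factor \<open>osc - 1\<close> makes it integrable.\<close>

lemma levin_antiderivative:
  fixes q l :: "real \<Rightarrow> complex" and c0 d0 :: complex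
  assumes al: "-1 < \<alpha>" and w: "w \<ge> 0" and q: "smooth_on {0..a} q" and l: "smooth_on {0..a} l"
  defines "E \<equiv> \<lambda>y. amp (1 + \<alpha>) y (q y) (l y) * osc w y + amp \<alpha> y c0 d0 * (osc w y - 1)
      + integral {0..y} (\<lambda>t. - (amp (\<alpha> - 1) t (\<alpha> * (dg t * c0)) (\<alpha> * (dg t * d0) + dg t * c0) * (osc w t - 1)))"
  shows "bracket a E =
    integral {0..a} (\<lambda>x. amp \<alpha> x (levin_op a \<alpha> g w c0 q x) (levin_op a \<alpha> g w d0 l x + dg x * q x) * osc w x)"
proof -
  define \<kappa> where "\<kappa> t = - (amp (\<alpha> - 1) t (\<alpha> * (dg t * c0)) (\<alpha> * (dg t * d0) + dg t * c0) * (osc w t - 1))" for t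
  have sub: "{0<..a} \<subseteq> {0..a}" by auto
  obtain kg where kg: "kg \<ge> 0" "\<forall>w\<ge>0. \<forall>x\<in>{0<..a}. norm (osc w x - 1) \<le> kg * (w * x)"
    using norm_osc_minus_1_bound by blast
  have ow: "norm (osc w x - 1) \<le> kg * (w * x)" if "x \<in> {0<..a}" for x using kg(2) w that by blast
  have bound: "\<exists>B\<ge>0. \<forall>x\<in>{0<..a}. norm (amp \<beta> x (u x) (v x)) \<le> B * x powr \<beta> * (1 + \<bar>ln x\<bar>)"
    if u: "smooth_on {0..a} u" and v: "smooth_on {0..a} v" for \<beta> and u v :: "real \<Rightarrow> complex"
  proof -
    obtain C where C: "C \<ge> 0" "\<And>x. x\<in>{0<..a} \<Longrightarrow> norm (u x) \<le> C * x powr 0" "\<And>x. x\<in>{0<..a} \<Longrightarrow> norm (v x) \<le> C * x powr 0"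
      using smooth_pair_bound[OF u v] by blast
    obtain K where K: "K \<ge> 0" "\<And>x C \<rho> u v. x\<in>{0<..a} \<Longrightarrow> norm u \<le> C * x powr \<rho> \<Longrightarrow> norm v \<le> C * x powr \<rho> \<Longrightarrow>
     norm (amp \<beta> x u v) \<le> K * C * x powr (\<beta> + \<rho>) * (1 + \<bar>ln x\<bar>)" using amp_bound[of \<beta>] by blast
    have "norm (amp \<beta> x (u x) (v x)) \<le> K * C * x powr \<beta> * (1 + \<bar>ln x\<bar>)" if "x \<in> {0<..a}" for x
      using K(2)[OF that C(2,3)[OF that]] by simp
    then show ?thesis using C(1) K(1) by (intro exI[of _ "K * C"]) auto
  qed
  have bound_osc: "\<exists>B. \<forall>x\<in>{0<..a}. norm (amp \<beta> x (u x) (v x) * (osc w x - 1)) \<le> B * x powr (\<beta> + 1) * (1 + \<bar>ln x\<bar>)"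
    if u: "smooth_on {0..a} u" and v: "smooth_on {0..a} v" for \<beta> and u v :: "real \<Rightarrow> complex"
  proof -
    obtain B where B: "B \<ge> 0" "\<And>x. x\<in>{0<..a} \<Longrightarrow> norm (amp \<beta> x (u x) (v x)) \<le> B * x powr \<beta> * (1 + \<bar>ln x\<bar>)"
      using bound[OF u v] by blast
    have "norm (amp \<beta> x (u x) (v x) * (osc w x - 1)) \<le> (B * kg * w) * x powr (\<beta> + 1) * (1 + \<bar>ln x\<bar>)"
      if x: "x \<in> {0<..a}" for x
    proof -
      have "norm (amp \<beta> x (u x) (v x)) * norm (osc w x - 1) \<le> (B * x powr \<beta> * (1 + \<bar>ln x\<bar>)) * (kg * (w * x))"
        using B(1) by (intro mult_mono B(2) ow x) auto
      also have "\<dots> = (B * kg * w) * (x powr \<beta> * x powr 1) * (1 + \<bar>ln x\<bar>)" using x by (simp add: mult_ac)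
      finally show ?thesis by (simp only: norm_mult powr_add)
    qed
    then show ?thesis by blast
  qed
  have co: "continuous_on {0..a} (\<lambda>x. osc w x - 1)"
    by (intro continuous_on_diff continuous_on_osc continuous_on_const) simp
  have sm: "smooth_on {0..a} (\<lambda>t. \<alpha> * (dg t * c0))" "smooth_on {0..a} (\<lambda>t. \<alpha> * (dg t * d0) + dg t * c0)"
    by (intro smooth_on_add smooth_on_mult smooth_on_const smooth_dg a_pos)+
  have smc: "smooth_on {0..a} (\<lambda>_. c0)" "smooth_on {0..a} (\<lambda>_. d0)" by (intro smooth_on_const a_pos)+
  have kc: "continuous_on {0<..a} \<kappa>"
    unfolding \<kappa>_def[abs_def]
    by (intro continuous_on_minus continuous_on_mult continuous_on_amp smooth_on_imp_continuous_on sm continuous_on_subset[OF co sub])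
  have ki: "\<kappa> integrable_on {0..a}"
  proof -
    obtain B where "\<forall>x\<in>{0<..a}. norm (amp (\<alpha> - 1) x (\<alpha> * (dg x * c0)) (\<alpha> * (dg x * d0) + dg x * c0) * (osc w x - 1))
        \<le> B * x powr (\<alpha> - 1 + 1) * (1 + \<bar>ln x\<bar>)"
      using bound_osc[OF sm] by blast
    then show ?thesis
      by (intro integrable_powr_log_bound[OF a_pos kc, of "1 + \<alpha>" B]) (use al in \<open>auto simp: \<kappa>_def\<close>)
  qed
  have cE: "continuous_on {0..a} E"
    unfolding E_def \<kappa>_def[symmetric]
  proof (intro continuous_on_add)
    show "continuous_on {0..a} (\<lambda>y. integral {0..y} \<kappa>)" by (rule indefinite_integral_continuous_1[OF ki])
    obtain B where B: "\<forall>x\<in>{0<..a}. norm (amp (1 + \<alpha>) x (q x) (l x)) \<le> B * x powr (1 + \<alpha>) * (1 + \<bar>ln x\<bar>)"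
      using bound[OF q l] by blast
    show "continuous_on {0..a} (\<lambda>y. amp (1 + \<alpha>) y (q y) (l y) * osc w y)"
      by (rule continuous_on_extend_powr_log_bound[OF a_pos _ _ _, where p = "1 + \<alpha>" and C = B])
         (use al B in \<open>auto simp: norm_mult intro!: continuous_on_mult continuous_on_amp smooth_on_imp_continuous_on q l continuous_on_osc\<close>)
    obtain B' where B': "\<forall>x\<in>{0<..a}. norm (amp \<alpha> x c0 d0 * (osc w x - 1)) \<le> B' * x powr (\<alpha> + 1) * (1 + \<bar>ln x\<bar>)"
      using bound_osc[OF smc] by blast
    show "continuous_on {0..a} (\<lambda>y. amp \<alpha> y c0 d0 * (osc w y - 1))"
    proof (rule continuous_on_extend_powr_log_bound[OF a_pos])
      show "continuous_on {0<..a} (\<lambda>y. amp \<alpha> y c0 d0 * (osc w y - 1))"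
        by (intro continuous_on_mult continuous_on_amp continuous_on_const continuous_on_subset[OF co sub])
      show "norm (amp \<alpha> x c0 d0 * (osc w x - 1)) \<le> B' * x powr (\<alpha> + 1) * (1 + \<bar>ln x\<bar>)" if "x \<in> {0<..a}" for x
        using B' that by blast
    qed (use al in auto)
  qed
  have E0: "E 0 = 0" by (simp add: E_def)
  have dE: "(E has_vector_derivative
      amp \<alpha> x (levin_op a \<alpha> g w c0 q x) (levin_op a \<alpha> g w d0 l x + dg x * q x) * osc w x) (at x)"
    if x: "x \<in> {0<..<a}" for x
  proof -
    have x': "x \<in> {0<..a}" "x \<in> {0..a}" using x by auto
    have dI: "((\<lambda>y. integral {0..y} \<kappa>) has_vector_derivative \<kappa> x) (at x)"
    proof -
      have "continuous_on {0<..<a} \<kappa>" by (rule continuous_on_subset[OF kc]) auto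
      then have "continuous (at x) \<kappa>" using x by (simp add: continuous_on_eq_continuous_at)
      then have "((\<lambda>y. integral {0..y} \<kappa>) has_vector_derivative \<kappa> x) (at x within {0..a} - {})"
        by (intro integral_has_vector_derivative_continuous_at ki) (use x in \<open>auto intro: continuous_at_imp_continuous_within\<close>)
      then show ?thesis using x by (simp add: at_within_Icc_at)
    qed
    have do1: "((\<lambda>y. osc w y - 1) has_vector_derivative \<i> * w * dg x * osc w x) (at x)"
      using has_vector_derivative_diff[OF osc_deriv[OF x] has_vector_derivative_const[of 1]] by simp
    have d2: "((\<lambda>y. amp \<alpha> y c0 d0) has_vector_derivative
      amp \<alpha> x 0 0 + amp (\<alpha> - 1) x (\<alpha> * (dg x * c0)) (\<alpha> * (dg x * d0) + dg x * c0)) (at x)"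
    proof -
      have z: "deriv_on a (\<lambda>_. c0) x = 0" "deriv_on a (\<lambda>_. d0) x = 0"
        by (rule deriv_on_const[OF a_pos x'(2)])+
      show ?thesis using amp_deriv[OF smc x, of \<alpha>] unfolding z .
    qed
    have "amp (1 + \<alpha>) x (deriv_on a q x) (deriv_on a l x)
       + amp (1 + \<alpha> - 1) x (complex_of_real (1 + \<alpha>) * (dg x * q x)) (complex_of_real (1 + \<alpha>) * (dg x * l x) + dg x * q x)
      = amp (1 + \<alpha>) x (deriv_on a q x) (deriv_on a l x)
       + amp \<alpha> x ((1 + \<alpha>) * (dg x * q x)) ((1 + \<alpha>) * (dg x * l x) + dg x * q x)" by simp
    note d1 = amp_deriv[OF q l x, of "1 + \<alpha>", unfolded this]
    show ?thesis
      unfolding E_def \<kappa>_def[symmetric] amp_osc_integrand[OF x'(1), symmetric]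
      by (rule back_subst[of "\<lambda>d. (_ has_vector_derivative d) (at x)",
            OF has_vector_derivative_add[OF has_vector_derivative_add[OF
              has_vector_derivative_mult[OF d1 osc_deriv[OF x]] has_vector_derivative_mult[OF d2 do1]] dI]])
         (simp add: \<kappa>_def amp_def[of _ _ 0 0] algebra_simps)
  qed
  have "((\<lambda>x. amp \<alpha> x (levin_op a \<alpha> g w c0 q x) (levin_op a \<alpha> g w d0 l x + dg x * q x) * osc w x)
      has_integral E a - E 0) {0..a}"
    by (rule fundamental_theorem_of_calculus_interior[OF _ cE dE]) (use a_pos in auto)
  then have "integral {0..a} (\<lambda>x. amp \<alpha> x (levin_op a \<alpha> g w c0 q x) (levin_op a \<alpha> g w d0 l x + dg x * q x) * osc w x) = E a"
    using E0 by (simp add: integral_unique)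
  moreover have "(E \<longlongrightarrow> 0) (at_right 0)"
    using continuous_on_Icc_at_rightD[OF cE a_pos] E0 by simp
  then have "Lim (at_right 0) E = 0" by (intro tendsto_Lim) auto
  ultimately show ?thesis by (simp add: bracket_def)
qed

text \<open>The quotient \<open>x / g x\<close> is the reciprocal of the Hadamard quotient of \<open>g\<close>, which is positive on the whole interval.\<close>

lemma smooth_alg_part:
  assumes F: "smooth_on {0..a} F"
  shows "smooth_on {0..a} (alg_part a \<alpha> g F)"
proof -
  obtain G where G: "smooth_on {0..a} G" "\<And>x. x \<in> {0..a} \<Longrightarrow> g x = x * G x" "\<And>x. x \<in> {0..a} \<Longrightarrow> G x > 0" "G 0 = dg 0"
    using g_quotient by metis
  show ?thesis
  proof (rule smooth_on_cong[OF a_pos])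
    show "smooth_on {0..a} (\<lambda>x. F x * complex_of_real (G x powr (-\<alpha>)))"
      by (intro smooth_on_mult F smooth_on_of_real smooth_on_powr G a_pos) auto
    fix x assume x: "x \<in> {0..a}"
    show "F x * complex_of_real (G x powr (-\<alpha>)) = alg_part a \<alpha> g F x"
    proof (cases "x = 0")
      case True then show ?thesis using G(4) by (simp add: alg_part_def powr_minus_divide)
    next
      case False
      then have "x / g x = 1 / G x" using G(2)[OF x] by simp
      then show ?thesis using False G(3)[OF x] by (simp add: alg_part_def powr_minus_divide powr_divide)
    qed
  qed
qed

lemma smooth_log_part:
  assumes F: "smooth_on {0..a} F"
  shows "smooth_on {0..a} (log_part a g F)"
proof -
  obtain G where G: "smooth_on {0..a} G" "\<And>x. x \<in> {0..a} \<Longrightarrow> g x = x * G x" "\<And>x. x \<in> {0..a} \<Longrightarrow> G x > 0" "G 0 = dg 0"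
    using g_quotient by metis
  show ?thesis
  proof (rule smooth_on_cong[OF a_pos])
    show "smooth_on {0..a} (\<lambda>x. F x * (complex_of_real (ln (G x)) * (-1)))"
      by (intro smooth_on_mult F smooth_on_of_real smooth_on_ln G a_pos smooth_on_const) auto
    fix x assume x: "x \<in> {0..a}"
    have ln: "complex_of_real (ln (1 / G x)) = complex_of_real (ln (G x)) * (-1)"
      using G(3)[OF x] by (simp add: ln_div)
    show "F x * (complex_of_real (ln (G x)) * (-1)) = log_part a g F x"
    proof (cases "x = 0")
      case True
      show ?thesis using ln unfolding True G(4) by (simp only: log_part_def if_True simp_thms)
    next
      case False
      then have "x / g x = 1 / G x" using G(2)[OF x] by simp
      then show ?thesis using False ln by (simp only: log_part_def if_False)
    qed
  qed
qed

lemma singular_integrand_eq_amp: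
  assumes x: "x \<in> {0..a}"
  shows "f x * complex_of_real (x powr \<alpha>) * complex_of_real (ln x)
    = amp \<alpha> x (alg_part a \<alpha> g f x) (alg_part a \<alpha> g (log_part a g f) x)"
proof (cases "x = 0")
  case False
  then have x0: "x > 0" and gx: "g x > 0" using x g_pos by auto
  have 1: "complex_of_real (x powr \<alpha>) = complex_of_real (g x powr \<alpha>) * complex_of_real ((x / g x) powr \<alpha>)"
    using x0 gx by (simp add: powr_divide)
  have 2: "complex_of_real (ln x) = complex_of_real (ln (g x)) + complex_of_real (ln (x / g x))"
    using x0 gx by (simp add: ln_div)
  show ?thesis using False unfolding 1 2 amp_def alg_part_def log_part_def by (simp add: algebra_simps)
qed simp

text \<open>Multiplying out the oscillator turns \<open>(1 - e\<^sup>-\<^sup>i\<^sup>w\<^sup>g) e\<^sup>i\<^sup>w\<^sup>g\<close> into \<open>osc - 1\<close> and removes the exponential in front of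
  the integral.\<close>

lemma levin_bracket_eq_integral:
  fixes q l :: "real \<Rightarrow> complex" and c0 d0 :: complex
  assumes al: "-1 < \<alpha>" and w: "w \<ge> 0" and q: "smooth_on {0..a} q" and l: "smooth_on {0..a} l"
  shows "bracket a (\<lambda>y.
          ((q y * complex_of_real (ln (g y)) + l y) * complex_of_real (g y powr (1 + \<alpha>))
           + (c0 * complex_of_real (ln (g y)) + d0) *
               (1 - exp (- \<i> * complex_of_real w * complex_of_real (g y))) *
               complex_of_real (g y powr \<alpha>)
           + exp (- \<i> * complex_of_real w * complex_of_real (g y)) *
               integral {0..y} (\<lambda>t.
                 (complex_of_real \<alpha> * c0 * complex_of_real (ln (g t)) + complex_of_real \<alpha> * d0 + c0) *
                 complex_of_real (dg t) *
                 ((1 - osc w t) / complex_of_real (g t powr (1 - \<alpha>))))) * osc w y)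
    = integral {0..a} (\<lambda>x. amp \<alpha> x (levin_op a \<alpha> g w c0 q x) (levin_op a \<alpha> g w d0 l x + dg x * q x) * osc w x)"
    (is "bracket a ?E = _")
proof -
  have e: "?E = (\<lambda>y. amp (1 + \<alpha>) y (q y) (l y) * osc w y + amp \<alpha> y c0 d0 * (osc w y - 1)
      + integral {0..y} (\<lambda>t. - (amp (\<alpha> - 1) t (\<alpha> * (dg t * c0)) (\<alpha> * (dg t * d0) + dg t * c0) * (osc w t - 1))))"
  proof
    fix y
    have i: "(\<lambda>t. (complex_of_real \<alpha> * c0 * complex_of_real (ln (g t)) + complex_of_real \<alpha> * d0 + c0) *
                 complex_of_real (dg t) * ((1 - osc w t) / complex_of_real (g t powr (1 - \<alpha>))))
        = (\<lambda>t. - (amp (\<alpha> - 1) t (\<alpha> * (dg t * c0)) (\<alpha> * (dg t * d0) + dg t * c0) * (osc w t - 1)))"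
    proof
      fix t
      have "g t powr (\<alpha> - 1) = 1 / g t powr (1 - \<alpha>)" using powr_minus_divide[of "g t" "1 - \<alpha>"] by simp
      then have "complex_of_real (g t powr (\<alpha> - 1)) = 1 / complex_of_real (g t powr (1 - \<alpha>))" by simp
      then show "(complex_of_real \<alpha> * c0 * complex_of_real (ln (g t)) + complex_of_real \<alpha> * d0 + c0) *
                 complex_of_real (dg t) * ((1 - osc w t) / complex_of_real (g t powr (1 - \<alpha>)))
         = - (amp (\<alpha> - 1) t (\<alpha> * (dg t * c0)) (\<alpha> * (dg t * d0) + dg t * c0) * (osc w t - 1))"
        unfolding amp_def by (simp add: divide_inverse algebra_simps)
    qed
    define A where "A = exp (- \<i> * complex_of_real w * complex_of_real (g y))"
    have AO: "A * osc w y = 1" unfolding A_def by (simp add: exp_minus)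
    have comb: "(u * p + v * (1 - A) * r + A * I) * osc w y = p * u * osc w y + r * v * (osc w y - 1) + I" for u p v r I
    proof -
      have "(u * p + v * (1 - A) * r + A * I) * osc w y
        = p * u * osc w y + r * v * (osc w y - A * osc w y) + (A * osc w y) * I"
        by (simp add: algebra_simps)
      then show ?thesis unfolding AO by simp
    qed
    show "?E y = amp (1 + \<alpha>) y (q y) (l y) * osc w y + amp \<alpha> y c0 d0 * (osc w y - 1)
      + integral {0..y} (\<lambda>t. - (amp (\<alpha> - 1) t (\<alpha> * (dg t * c0)) (\<alpha> * (dg t * d0) + dg t * c0) * (osc w t - 1)))"
      unfolding i A_def[symmetric] comb by (simp add: amp_def mult.commute)
  qed
  show ?thesis unfolding e by (rule levin_antiderivative[OF al w q l])
qed

lemma levin_op_zero: "x \<in> {0..a} \<Longrightarrow> levin_op a \<alpha> g w 0 (\<lambda>_. 0) x = 0"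
  by (simp add: levin_op_def deriv_on_const[OF a_pos])

end

section \<open>Square linear systems with a large parameter\<close>

lemma injective_square_system_inverse:
  fixes P :: "'k \<Rightarrow> nat \<Rightarrow> complex"
  assumes fin: "finite K" and card: "card K = N"
    and inj: "\<forall>v. (\<forall>k\<in>K. (\<Sum>i<N. P k i * v i) = 0) \<longrightarrow> (\<forall>i<N. v i = 0)"
  shows "\<exists>Q. (\<forall>i<N. \<forall>j<N. (\<Sum>k\<in>K. Q i k * P k j) = of_bool (i = j)) \<and>
    (\<forall>k\<in>K. \<forall>l\<in>K. (\<Sum>i<N. P k i * Q i l) = of_bool (k = l))"
proof -
  obtain h where h: "bij_betw h {..<N} K"
    using ex_bij_betw_nat_finite[OF fin] card by (auto simp: atLeast0LessThan)
  have hK: "h r \<in> K" if "r < N" for r using h that by (auto simp: bij_betw_def)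
  define A where "A = mat N N (\<lambda>(r, c). P (h r) c)"
  have A: "A \<in> carrier_mat N N" by (simp add: A_def)
  have "Determinant.det A \<noteq> 0"
  proof
    assume "Determinant.det A = 0"
    then obtain v where v: "v \<in> carrier_vec N" "v \<noteq> 0\<^sub>v N" "A *\<^sub>v v = 0\<^sub>v N"
      using det_0_iff_vec_prod_zero[OF A] by blast
    have "(\<Sum>i<N. P k i * vec_index v i) = 0" if "k \<in> K" for k
    proof -
      have "k \<in> h ` {..<N}" using bij_betw_imp_surj_on[OF h] that by simp
      then obtain r where r: "r < N" "h r = k" by auto
      have "vec_index (A *\<^sub>v v) r = 0" using v(3) r(1) by simp
      then show ?thesis using r v(1) A
        by (simp add: A_def scalar_prod_def atLeast0LessThan)
    qed
    then have "\<forall>i<N. vec_index v i = 0" using inj by blast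
    then have "v = 0\<^sub>v N" using v(1) by (intro eq_vecI) auto
    then show False using v(2) by simp
  qed
  from det_non_zero_imp_unit[OF A this, of undefined]
  obtain B where B: "B \<in> carrier_mat N N" "B * A = 1\<^sub>m N" "A * B = 1\<^sub>m N"
    by (auto simp: Units_def ring_mat_simps)
  define Q where "Q i k = B $$ (i, inv_into {..<N} h k)" for i k
  have hi: "inv_into {..<N} h k < N" "h (inv_into {..<N} h k) = k" if "k \<in> K" for k
    using h that bij_betw_imp_surj_on[OF h] inv_into_into[of k h "{..<N}"] f_inv_into_f[of k h "{..<N}"] by auto
  have ih: "inv_into {..<N} h (h r) = r" if "r < N" for r
    using h that by (auto simp: bij_betw_def intro: inv_into_f_f)
  show ?thesis
  proof (intro exI[of _ Q] conjI allI impI ballI)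
    fix i j :: nat assume ij: "i < N" "j < N"
    have "(\<Sum>k\<in>K. Q i k * P k j) = (\<Sum>r<N. B $$ (i, r) * P (h r) j)"
      unfolding Q_def using ih by (subst sum.reindex_bij_betw[OF h, symmetric]) simp
    also have "\<dots> = (B * A) $$ (i, j)"
      using ij B(1) A by (simp add: A_def scalar_prod_def atLeast0LessThan)
    finally show "(\<Sum>k\<in>K. Q i k * P k j) = of_bool (i = j)" using B(2) ij by simp
  next
    fix k l assume kl: "k \<in> K" "l \<in> K"
    define r c where "r = inv_into {..<N} h k" and "c = inv_into {..<N} h l"
    have rc: "r < N" "c < N" "h r = k" "h c = l" using hi kl by (auto simp: r_def c_def)
    have "(\<Sum>i<N. P k i * Q i l) = (A * B) $$ (r, c)"
      using rc B(1) A by (simp add: A_def Q_def scalar_prod_def atLeast0LessThan c_def[symmetric])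
    also have "\<dots> = of_bool (r = c)" using B(3) rc by simp
    also have "(r = c) = (k = l)" using rc ih by metis
    finally show "(\<Sum>i<N. P k i * Q i l) = of_bool (k = l)" .
  qed
qed

text \<open>Applying an inverse \<open>Q\<close> of \<open>A\<close> to the system gives \<open>w v = Q (\<rho> - B v)\<close>, and for large \<open>w\<close> the term with \<open>B\<close> is absorbed
  into the left-hand side.\<close>

lemma large_parameter_system_bound:
  fixes A B :: "'k \<Rightarrow> nat \<Rightarrow> complex"
  assumes fin: "finite K" and card: "card K = N"
    and inj: "\<forall>v. (\<forall>k\<in>K. (\<Sum>i<N. A k i * v i) = 0) \<longrightarrow> (\<forall>i<N. v i = 0)"
  shows "\<exists>C w0 :: real. C \<ge> 0 \<and> w0 > 0 \<and> (\<forall>w v \<rho> i. w \<ge> w0 \<longrightarrow> \<rho> \<ge> 0 \<longrightarrow>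
      (\<forall>k\<in>K. norm (\<Sum>i<N. (w * A k i + B k i) * v i) \<le> \<rho>) \<longrightarrow> i < N \<longrightarrow> norm (v i) \<le> C * \<rho> / w)"
proof -
  obtain Q where "\<forall>i<N. \<forall>j<N. (\<Sum>k\<in>K. Q i k * A k j) = of_bool (i = j)"
    using injective_square_system_inverse[of K N A, OF fin card inj] by (elim exE conjE) (rule that)
  then have Q: "(\<Sum>k\<in>K. Q i k * A k j) = of_bool (i = j)" if "i < N" "j < N" for i j using that by blast
  define q where "q = (\<Sum>i<N. \<Sum>k\<in>K. norm (Q i k))"
  define b where "b = (\<Sum>i<N. \<Sum>k\<in>K. norm (B k i))"
  have qb: "q \<ge> 0" "b \<ge> 0" unfolding q_def b_def by (auto intro!: sum_nonneg)
  have bB: "norm (B k i) \<le> b" if "k \<in> K" "i < N" for k i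
  proof -
    have "norm (B k i) \<le> (\<Sum>k\<in>K. norm (B k i))" by (rule member_le_sum) (use that fin in auto)
    also have "\<dots> \<le> b" unfolding b_def by (rule member_le_sum) (use that in \<open>auto intro: sum_nonneg\<close>)
    finally show ?thesis .
  qed
  \<comment> \<open>From here on \<open>q b V\<close> is at most half of \<open>w V\<close>, and \<open>w\<close> is positive.\<close>
  define w0 where "w0 = 2 * q * b + 1"
  show ?thesis
  proof (rule exI[of _ "2 * q"], rule exI[of _ w0], intro conjI allI impI)
    show "2 * q \<ge> 0" "w0 > 0" using qb by (auto simp: w0_def add_nonneg_pos)
    fix w \<rho> :: real and v and i :: nat
    assume w: "w \<ge> w0" and rho: "\<rho> \<ge> 0"
      and le: "\<forall>k\<in>K. norm (\<Sum>i<N. (w * A k i + B k i) * v i) \<le> \<rho>" and i: "i < N"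
    define V where "V = (\<Sum>i<N. norm (v i))"
    have "0 \<le> 2 * q * b" using qb by simp
    then have wp: "w > 0" using w unfolding w0_def by linarith
    have step: "w * norm (v i) \<le> (\<Sum>k\<in>K. norm (Q i k)) * (\<rho> + b * V)" if i: "i < N" for i
    proof -
      have "(\<Sum>k\<in>K. Q i k * (\<Sum>j<N. A k j * v j)) = (\<Sum>k\<in>K. \<Sum>j<N. (Q i k * A k j) * v j)"
        by (simp add: sum_distrib_left mult.assoc)
      also have "\<dots> = (\<Sum>j<N. (\<Sum>k\<in>K. Q i k * A k j) * v j)"
        by (subst sum.swap) (simp add: sum_distrib_right)
      also have "\<dots> = (\<Sum>j<N. of_bool (i = j) * v j)" using Q[OF i] by simp
      also have "\<dots> = v i" using i by simp
      finally have vi: "v i = (\<Sum>k\<in>K. Q i k * (\<Sum>j<N. A k j * v j))" by simp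
      have "w * v i = (\<Sum>k\<in>K. Q i k * ((\<Sum>j<N. (w * A k j + B k j) * v j) - (\<Sum>j<N. B k j * v j)))"
        by (subst vi) (simp add: sum_distrib_left sum_subtractf[symmetric] algebra_simps)
      also have "norm \<dots> \<le> (\<Sum>k\<in>K. norm (Q i k) * (\<rho> + b * V))"
      proof (rule sum_norm_le)
        fix k assume k: "k \<in> K"
        have "norm (\<Sum>j<N. B k j * v j) \<le> (\<Sum>j<N. b * norm (v j))"
          by (rule sum_norm_le) (use bB[OF k] in \<open>auto simp: norm_mult intro!: mult_right_mono\<close>)
        then have "norm (\<Sum>j<N. B k j * v j) \<le> b * V" by (simp add: V_def sum_distrib_left)
        then have "norm ((\<Sum>j<N. (w * A k j + B k j) * v j) - (\<Sum>j<N. B k j * v j)) \<le> \<rho> + b * V"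
          using le[rule_format, OF k] norm_triangle_ineq4 by (meson add_mono order_trans)
        then show "norm (Q i k * ((\<Sum>j<N. (w * A k j + B k j) * v j) - (\<Sum>j<N. B k j * v j))) \<le> norm (Q i k) * (\<rho> + b * V)"
          by (simp add: norm_mult mult_left_mono)
      qed
      finally show ?thesis using wp by (simp add: norm_mult sum_distrib_right)
    qed
    have "w * V = (\<Sum>i<N. w * norm (v i))" by (simp add: V_def sum_distrib_left)
    also have "\<dots> \<le> (\<Sum>i<N. (\<Sum>k\<in>K. norm (Q i k)) * (\<rho> + b * V))" by (rule sum_mono) (use step in auto)
    also have "\<dots> = q * (\<rho> + b * V)" by (simp add: q_def sum_distrib_right)
    finally have 1: "w * V \<le> q * \<rho> + q * b * V" by (simp add: algebra_simps)
    have V0: "V \<ge> 0" unfolding V_def by (auto intro: sum_nonneg)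
    have "2 * q * b * V \<le> w * V" using w V0 by (intro mult_right_mono) (auto simp: w0_def)
    then have "w * V \<le> 2 * q * \<rho>" using 1 by linarith
    then have "V \<le> 2 * q * \<rho> / w" using wp by (simp add: pos_le_divide_eq mult.commute)
    moreover have "norm (v i) \<le> V" unfolding V_def by (rule member_le_sum) (use i in auto)
    ultimately show "norm (v i) \<le> 2 * q * \<rho> / w" by linarith
  qed
qed

section \<open>The collocation systems\<close>

lemma vanishes_imp_zero_multiplicity_ge:
  assumes "vanishes a y p u"
  shows "enat p \<le> zero_multiplicity {0..a} u y"
proof (cases "\<exists>k. nth_deriv_on {0..a} k u y \<noteq> 0")
  case True
  then have "nth_deriv_on {0..a} (LEAST k. nth_deriv_on {0..a} k u y \<noteq> 0) u y \<noteq> 0" by (rule LeastI_ex)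
  then have "p \<le> (LEAST k. nth_deriv_on {0..a} k u y \<noteq> 0)"
    using assms unfolding vanishes_def by (meson not_le)
  then show ?thesis using True by (simp add: zero_multiplicity_def)
qed (simp add: zero_multiplicity_def)

text \<open>A nontrivial combination would have at least \<open>M\<close> zeros with multiplicity among the nodes alone. Nodes with \<open>p l = 0\<close> are
  left out of the count, since they need not be zeros.\<close>

lemma chebyshev_vanishing_imp_zero:
  fixes x :: "nat \<Rightarrow> real" and p :: "nat \<Rightarrow> nat"
  assumes cheb: "chebyshev_set {0..a} M \<phi>" and M: "M \<ge> 1" and inj: "inj_on x {0..n}"
    and x: "\<And>l. l \<le> n \<Longrightarrow> x l \<in> {0..a}" and sum: "(\<Sum>l=0..n. p l) = M"
    and van: "\<And>l. l \<le> n \<Longrightarrow> vanishes a (x l) (p l) (lin_comb M \<phi> c)"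
    and j: "j \<in> {1..M}"
  shows "c j = 0"
proof (rule ccontr)
  assume "c j \<noteq> 0"
  let ?q = "lin_comb M \<phi> c" and ?Z = "{y \<in> {0..a}. lin_comb M \<phi> c y = 0}"
  have fin: "finite ?Z" and le: "(\<Sum>y\<in>?Z. zero_multiplicity {0..a} ?q y) \<le> enat (M - 1)"
    using cheb \<open>c j \<noteq> 0\<close> j unfolding chebyshev_set_def by blast+
  let ?L = "{l \<in> {0..n}. p l > 0}"
  have "enat M = enat (\<Sum>l\<in>?L. p l)"
    unfolding sum[symmetric] by (subst sum.mono_neutral_left[of "{0..n}" ?L p]) auto
  also have "\<dots> = (\<Sum>l\<in>?L. enat (p l))"
    by (simp add: of_nat_eq_enat[symmetric])
  also have "\<dots> \<le> (\<Sum>l\<in>?L. zero_multiplicity {0..a} ?q (x l))"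
    by (rule sum_mono) (auto intro: vanishes_imp_zero_multiplicity_ge van)
  also have "\<dots> = (\<Sum>y\<in>x ` ?L. zero_multiplicity {0..a} ?q y)"
    by (subst sum.reindex) (auto intro: inj_on_subset[OF inj])
  also have "\<dots> \<le> (\<Sum>y\<in>?Z. zero_multiplicity {0..a} ?q y)"
  proof (rule sum_mono2[OF fin])
    show "x ` ?L \<subseteq> ?Z"
    proof
      fix y assume "y \<in> x ` ?L"
      then obtain l where l: "l \<le> n" "p l > 0" "y = x l" by auto
      then have "vanishes a y (Suc (p l - 1)) ?q" using van[OF l(1)] by simp
      then show "y \<in> ?Z" using x[OF l(1)] l(3) by (auto simp: vanishes_Suc)
    qed
  qed simp
  finally have "enat M \<le> enat (M - 1)" using le by (rule order_trans)
  then show False using M by simp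
qed

locale levin_collocation = levin_phase +
  fixes \<alpha> :: real and n s M :: nat and node :: "nat \<Rightarrow> real" and m :: "nat \<Rightarrow> nat"
    and \<phi> :: "nat \<Rightarrow> real \<Rightarrow> complex"
  assumes node_0: "node 0 = 0" and node_n: "node n = a"
    and node_less: "\<And>l. l < n \<Longrightarrow> node l < node (Suc l)"
    and m_pos: "\<And>l. l \<le> n \<Longrightarrow> m l \<ge> 1" and m_0: "m 0 = s + 1" and m_n: "m n = s + 1"
    and M_eq: "M = (\<Sum>j=0..n. m j) - 1"
    and smooth_basis: "\<And>j. j \<in> {1..M} \<Longrightarrow> smooth_on {0..a} (\<phi> j)"
    and cheb: "chebyshev_set {0..a} M \<phi>"
begin

lemma node_mono: "l < l' \<Longrightarrow> l' \<le> n \<Longrightarrow> node l < node l'"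
proof (induction l')
  case (Suc l')
  then have "node l' < node (Suc l')" by (intro node_less) simp
  moreover have "node l \<le> node l'" using Suc by (cases "l = l'") auto
  ultimately show ?case by linarith
qed simp

lemma n_pos: "n > 0"
  using node_0 node_n a_pos by (cases n) auto

lemma node_mem: "l \<le> n \<Longrightarrow> node l \<in> {0..a}"
  using node_mono[of 0 l] node_mono[of l n] node_0 node_n a_pos
  by (cases "l = 0"; cases "l = n") auto

lemma inj_on_node: "inj_on node {0..n}"
  by (rule inj_onI) (metis atLeastAtMost_iff less_irrefl linorder_neqE_nat node_mono)

text \<open>These are the zeros left to the function unknown: the scalar unknown takes one of the \<open>s + 1\<close> conditions at 0.\<close>

lemma sum_reduced_multiplicities: "(\<Sum>l=0..n. if l = 0 then s else m l) = M" and M_pos: "M \<ge> 1"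
proof -
  have e: "{0..n} = insert 0 {1..n}" by auto
  have "(\<Sum>l=1..n. m l) \<ge> m n" using n_pos by (intro member_le_sum) auto
  then show "M \<ge> 1" unfolding M_eq e using m_0 m_n by simp
  show "(\<Sum>l=0..n. if l = 0 then s else m l) = M" unfolding M_eq e using m_0 by simp
qed

text \<open>The operator is linear in the unknowns and affine in \<open>w\<close>: \<open>w * lead_col i + rest_col i\<close> is its value on the \<open>i\<close>-th unit
  vector, with index 0 for the scalar unknown.\<close>

definition lead_col :: "nat \<Rightarrow> real \<Rightarrow> complex" where
  "lead_col i x = (if i = 0 then \<i> * dg x else \<i> * dg x * g x * \<phi> i x)"

definition rest_col :: "nat \<Rightarrow> real \<Rightarrow> complex" where
  "rest_col i x = (if i = 0 then 0 else g x * deriv_on a (\<phi> i) x + (1 + \<alpha>) * dg x * \<phi> i x)"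

lemma smooth_complex_g: "smooth_on {0..a} (\<lambda>x. complex_of_real (g x))"
  by (intro smooth_on_of_real smooth_g a_pos)

lemma smooth_lead_col: "i < Suc M \<Longrightarrow> smooth_on {0..a} (lead_col i)"
  unfolding lead_col_def
  by (cases "i = 0") (auto intro!: smooth_on_mult smooth_on_const smooth_dg smooth_complex_g smooth_basis a_pos)

lemma smooth_rest_col: "i < Suc M \<Longrightarrow> smooth_on {0..a} (rest_col i)"
  unfolding rest_col_def
  by (cases "i = 0") (auto intro!: smooth_on_add smooth_on_mult smooth_on_const smooth_dg smooth_complex_g smooth_basis
      smooth_on_deriv a_pos)

lemma sum_lessThan_Suc_M: "(\<Sum>i<Suc M. f i) = f 0 + (\<Sum>j=1..M. f j)" for f :: "nat \<Rightarrow> complex"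
  unfolding sum.lessThan_Suc_shift by (simp add: sum.atLeast1_atMost_eq)

lemma lin_comb_smooth: "smooth_on {0..a} (lin_comb M \<phi> c)"
  unfolding lin_comb_def[abs_def] by (intro smooth_on_sum smooth_on_mult smooth_on_const smooth_basis a_pos)

lemma levin_op_expand:
  assumes x: "x \<in> {0..a}"
  shows "levin_op a \<alpha> g w (c 0) (lin_comb M \<phi> c) x = (\<Sum>i<Suc M. c i * (w * lead_col i x + rest_col i x))"
proof -
  have "deriv_on a (lin_comb M \<phi> c) x = (\<Sum>j=1..M. c j * deriv_on a (\<phi> j) x)"
    using nth_deriv_on_lin_comb[OF a_pos x, of "{1..M}" \<phi> "Suc 0" c] smooth_basis
    by (simp add: lin_comb_def[abs_def])
  then show ?thesis
    unfolding sum_lessThan_Suc_M levin_op_def lin_comb_def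
    by (simp add: lead_col_def rest_col_def sum_distrib_left sum.distrib[symmetric] algebra_simps)
qed

lemma nth_deriv_levin_op:
  assumes x: "x \<in> {0..a}"
  shows "nth_deriv_on {0..a} k (levin_op a \<alpha> g w (c 0) (lin_comb M \<phi> c)) x
    = (\<Sum>i<Suc M. (w * nth_deriv_on {0..a} k (lead_col i) x + nth_deriv_on {0..a} k (rest_col i) x) * c i)"
proof -
  have sm: "smooth_on {0..a} (\<lambda>x. w * lead_col i x)" if "i < Suc M" for i
    by (intro smooth_on_mult smooth_on_const smooth_lead_col that a_pos)
  have "nth_deriv_on {0..a} k (levin_op a \<alpha> g w (c 0) (lin_comb M \<phi> c)) x
     = nth_deriv_on {0..a} k (\<lambda>x. \<Sum>i<Suc M. c i * (w * lead_col i x + rest_col i x)) x"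
    by (rule nth_deriv_on_cong[OF levin_op_expand x])
  also have "\<dots> = (\<Sum>i<Suc M. c i * nth_deriv_on {0..a} k (\<lambda>x. w * lead_col i x + rest_col i x) x)"
    by (rule nth_deriv_on_lin_comb[OF a_pos x]) (auto intro: smooth_on_add sm smooth_rest_col a_pos)
  also have "\<dots> = (\<Sum>i<Suc M. (w * nth_deriv_on {0..a} k (lead_col i) x + nth_deriv_on {0..a} k (rest_col i) x) * c i)"
    by (rule sum.cong)
       (simp_all add: nth_deriv_on_add[OF a_pos sm smooth_rest_col x] nth_deriv_on_cmult[OF a_pos x smooth_lead_col] mult.commute)
  finally show ?thesis .
qed

abbreviation conditions :: "(nat \<times> nat) set" where
  "conditions \<equiv> (SIGMA l:{0..n}. {..<m l})"

lemma card_conditions: "card conditions = Suc M"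
proof -
  have "(\<Sum>j=0..n. m j) \<ge> m 0" by (rule member_le_sum) auto
  then show ?thesis using m_0 by (simp add: M_eq)
qed

text \<open>The leading part of the operator is \<open>\<i> g' (v 0 + g q)\<close>. Vanishing at the left endpoint gives \<open>v 0 = 0\<close>. There \<open>g\<close> has a
  simple zero, so \<open>q\<close> inherits one zero less than prescribed; at the other nodes \<open>g\<close> is nonzero and \<open>q\<close> inherits all of them.
  Altogether these are \<open>M\<close> zeros.\<close>

lemma leading_system_injective:
  assumes z: "\<forall>(l, j)\<in>conditions. (\<Sum>i<Suc M. nth_deriv_on {0..a} j (lead_col i) (node l) * v i) = 0"
  shows "\<forall>i<Suc M. v i = 0"
proof -
  define q where "q = lin_comb M \<phi> v"
  define u where "u x = v 0 + complex_of_real (g x) * q x" for x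
  have smq: "smooth_on {0..a} q" unfolding q_def by (rule lin_comb_smooth)
  have smu: "smooth_on {0..a} u" unfolding u_def[abs_def]
    by (intro smooth_on_add smooth_on_mult smooth_on_const smooth_complex_g smq a_pos)
  have ex: "(\<Sum>i<Suc M. v i * lead_col i x) = (\<i> * complex_of_real (dg x)) * u x" for x
    unfolding sum_lessThan_Suc_M u_def q_def lin_comb_def
    by (simp add: lead_col_def sum_distrib_left algebra_simps)
  have vu: "vanishes a (node l) (m l) u" if l: "l \<le> n" for l
  proof (rule vanishes_cancel_nonzero[OF a_pos node_mem[OF l] _ _ smu])
    show "smooth_on {0..a} (\<lambda>x. \<i> * complex_of_real (dg x))"
      by (intro smooth_on_mult smooth_on_const smooth_dg a_pos)
    show "\<i> * complex_of_real (dg (node l)) \<noteq> 0" using dg_pos[OF node_mem[OF l]] by simp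
    show "vanishes a (node l) (m l) (\<lambda>x. (\<i> * complex_of_real (dg x)) * u x)"
      unfolding vanishes_def ex[symmetric]
    proof (intro allI impI)
      fix j assume j: "j < m l"
      have "nth_deriv_on {0..a} j (\<lambda>x. \<Sum>i<Suc M. v i * lead_col i x) (node l)
          = (\<Sum>i<Suc M. v i * nth_deriv_on {0..a} j (lead_col i) (node l))"
        by (rule nth_deriv_on_lin_comb[OF a_pos node_mem[OF l]]) (auto intro: smooth_lead_col)
      also have "\<dots> = 0" using z l j by (force simp: mult.commute)
      finally show "nth_deriv_on {0..a} j (\<lambda>x. \<Sum>i<Suc M. v i * lead_col i x) (node l) = 0" .
    qed
  qed
  have "vanishes a 0 (Suc s) u" using vu[of 0] node_0 m_0 by simp
  then have v0: "v 0 = 0" by (simp add: vanishes_Suc u_def g_0)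
  have u_eq: "u = (\<lambda>x. complex_of_real (g x) * q x)" unfolding u_def v0 by simp
  have "vanishes a (node l) (if l = 0 then s else m l) q" if l: "l \<le> n" for l
  proof (cases "l = 0")
    case True
    have "vanishes a 0 s q"
    proof (rule vanishes_cancel_simple_zero[OF a_pos _ smooth_complex_g _ _ smq])
      show "vanishes a 0 (Suc s) (\<lambda>x. complex_of_real (g x) * q x)"
        using \<open>vanishes a 0 (Suc s) u\<close> unfolding u_eq .
      show "deriv_on a (\<lambda>x. complex_of_real (g x)) 0 \<noteq> 0"
        using deriv_on_of_real[OF a_pos smooth_g, of 0] dg_pos[of 0] a_pos by simp
    qed (use a_pos g_0 in auto)
    then show ?thesis using True node_0 by simp
  next
    case False
    have "node l > 0" using node_mono[of 0 l] False l node_0 by simp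
    then have "g (node l) > 0" using node_mem[OF l] by (intro g_pos) auto
    then have "vanishes a (node l) (m l) q"
      using vanishes_cancel_nonzero[OF a_pos node_mem[OF l] smooth_complex_g _ smq] vu[OF l] unfolding u_eq by simp
    then show ?thesis using False by simp
  qed
  then have "v j = 0" if "j \<in> {1..M}" for j
    using chebyshev_vanishing_imp_zero[OF cheb M_pos inj_on_node node_mem sum_reduced_multiplicities _ that]
    unfolding q_def by blast
  then show ?thesis using v0 by (metis Suc_leI atLeastAtMost_iff less_Suc_eq_le not_gr0 One_nat_def)
qed

lemma levin_system_iff:
  "levin_system a \<alpha> g n node m M \<phi> w R c \<longleftrightarrow> c \<in> {0..M} \<rightarrow>\<^sub>E UNIV \<and>
    (\<forall>k\<in>conditions. (\<Sum>i<Suc M. (w * nth_deriv_on {0..a} (snd k) (lead_col i) (node (fst k))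
        + nth_deriv_on {0..a} (snd k) (rest_col i) (node (fst k))) * c i)
      = nth_deriv_on {0..a} (snd k) R (node (fst k)))"
  unfolding levin_system_def using nth_deriv_levin_op node_mem by force

text \<open>With zero data the bound for large parameters says that the matrix at \<open>w\<close> itself is injective; as the system is square, it
  is then solvable for every right-hand side.\<close>

lemma levin_system_large_parameter:
  "\<exists>C w0. C \<ge> 0 \<and> w0 > 0 \<and>
    (\<forall>w\<ge>w0. \<forall>R. \<exists>!c. levin_system a \<alpha> g n node m M \<phi> w R c) \<and>
    (\<forall>w\<ge>w0. \<forall>R c \<rho> i. levin_system a \<alpha> g n node m M \<phi> w R c \<longrightarrow> \<rho> \<ge> 0 \<longrightarrow>
      (\<forall>l\<le>n. \<forall>j<m l. norm (nth_deriv_on {0..a} j R (node l)) \<le> \<rho>) \<longrightarrow> i \<le> M \<longrightarrow> norm (c i) \<le> C * \<rho> / w)"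
proof -
  define A where "A k i = nth_deriv_on {0..a} (snd k) (lead_col i) (node (fst k))" for k :: "nat \<times> nat" and i
  define B where "B k i = nth_deriv_on {0..a} (snd k) (rest_col i) (node (fst k))" for k :: "nat \<times> nat" and i
  have fin: "finite conditions" by simp
  have inj: "\<forall>v. (\<forall>k\<in>conditions. (\<Sum>i<Suc M. A k i * v i) = 0) \<longrightarrow> (\<forall>i<Suc M. v i = 0)"
    using leading_system_injective unfolding A_def by fastforce
  obtain C w0 where C: "C \<ge> 0" "w0 > 0" and bound':
    "\<forall>w v \<rho> i. w \<ge> w0 \<longrightarrow> \<rho> \<ge> 0 \<longrightarrow>
      (\<forall>k\<in>conditions. norm (\<Sum>i<Suc M. (w * A k i + B k i) * v i) \<le> \<rho>) \<longrightarrow> i < Suc M \<longrightarrow> norm (v i) \<le> C * \<rho> / w"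
    using large_parameter_system_bound[of conditions "Suc M" A B, OF fin card_conditions inj]
    by (elim exE conjE) (rule that)
  have bound: "norm (v i) \<le> C * \<rho> / w" if "w \<ge> w0" "\<rho> \<ge> 0"
      "\<forall>k\<in>conditions. norm (\<Sum>i<Suc M. (w * A k i + B k i) * v i) \<le> \<rho>" "i < Suc M" for w v \<rho> i
    using bound' that by blast
  have sys: "levin_system a \<alpha> g n node m M \<phi> w R c \<longleftrightarrow> c \<in> {0..M} \<rightarrow>\<^sub>E UNIV \<and>
    (\<forall>k\<in>conditions. (\<Sum>i<Suc M. (w * A k i + B k i) * c i) = nth_deriv_on {0..a} (snd k) R (node (fst k)))" for w R c
    unfolding levin_system_iff A_def B_def ..
  show ?thesis
  proof (rule exI[of _ C], rule exI[of _ w0], intro conjI C allI impI)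
    fix w R c \<rho> i
    assume w: "w \<ge> w0" and c: "levin_system a \<alpha> g n node m M \<phi> w R c" and rho: "\<rho> \<ge> 0"
      and R: "\<forall>l\<le>n. \<forall>j<m l. norm (nth_deriv_on {0..a} j R (node l)) \<le> \<rho>" and i: "i \<le> M"
    have "\<forall>k\<in>conditions. norm (\<Sum>i<Suc M. (w * A k i + B k i) * c i) \<le> \<rho>"
      using c[unfolded sys] R by auto
    then show "norm (c i) \<le> C * \<rho> / w" using bound[OF w rho] i by simp
  next
    fix w and R :: "real \<Rightarrow> complex" assume w: "w \<ge> w0"
    have inj_w: "\<forall>v. (\<forall>k\<in>conditions. (\<Sum>i<Suc M. (w * A k i + B k i) * v i) = 0) \<longrightarrow> (\<forall>i<Suc M. v i = 0)"
    proof (intro allI impI)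
      fix v i assume "\<forall>k\<in>conditions. (\<Sum>i<Suc M. (w * A k i + B k i) * v i) = 0" "i < Suc M"
      with bound[OF w, of 0 v i] show "v i = 0" by simp
    qed
    obtain Q where "\<forall>k\<in>conditions. \<forall>l\<in>conditions.
        (\<Sum>i<Suc M. (w * A k i + B k i) * Q i l) = of_bool (k = l)"
      using injective_square_system_inverse[of conditions "Suc M" "\<lambda>k i. w * A k i + B k i", OF fin card_conditions inj_w]
      by (elim exE conjE) (rule that)
    then have Q: "(\<Sum>i<Suc M. (w * A k i + B k i) * Q i l) = of_bool (k = l)"
      if "k \<in> conditions" "l \<in> conditions" for k l using that by blast
    define b where "b k = nth_deriv_on {0..a} (snd k) R (node (fst k))" for k
    define c where "c = restrict (\<lambda>i. \<Sum>l\<in>conditions. Q i l * b l) {0..M}"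
    have "(\<Sum>i<Suc M. (w * A k i + B k i) * c i) = b k" if k: "k \<in> conditions" for k
    proof -
      have "(\<Sum>i<Suc M. (w * A k i + B k i) * c i) = (\<Sum>i<Suc M. (w * A k i + B k i) * (\<Sum>l\<in>conditions. Q i l * b l))"
        by (rule sum.cong) (auto simp: c_def)
      also have "\<dots> = (\<Sum>i<Suc M. \<Sum>l\<in>conditions. ((w * A k i + B k i) * Q i l) * b l)"
        by (simp add: sum_distrib_left mult.assoc)
      also have "\<dots> = (\<Sum>l\<in>conditions. (\<Sum>i<Suc M. (w * A k i + B k i) * Q i l) * b l)"
        by (subst sum.swap) (simp only: sum_distrib_right)
      also have "\<dots> = (\<Sum>l\<in>conditions. of_bool (k = l) * b l)"
        by (rule sum.cong) (simp_all only: Q[OF k])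
      also have "\<dots> = (\<Sum>l\<in>conditions. if k = l then b l else 0)" by (rule sum.cong) auto
      also have "\<dots> = b k" using k fin by (subst sum.delta') auto
      finally show ?thesis .
    qed
    then have ex: "levin_system a \<alpha> g n node m M \<phi> w R c"
      unfolding sys b_def by (auto simp: c_def)
    show "\<exists>!c. levin_system a \<alpha> g n node m M \<phi> w R c"
    proof (rule ex1I[of "levin_system a \<alpha> g n node m M \<phi> w R" c, OF ex])
      fix c' assume c': "levin_system a \<alpha> g n node m M \<phi> w R c'"
      have "\<forall>k\<in>conditions. (\<Sum>i<Suc M. (w * A k i + B k i) * (c' i - c i)) = 0"
        using c' ex unfolding sys by (simp only: right_diff_distrib sum_subtractf) simp
      from inj_w[THEN spec, THEN mp, OF this] have "c' i = c i" if "i \<le> M" for i using that by (metis eq_iff_diff_eq_0 less_Suc_eq_le)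
      then show "c' = c" using c' ex unfolding sys by (intro PiE_ext[of c' _ _ c]) auto
    qed
  qed
qed

section \<open>The quadrature error\<close>

lemma collocation_data_bound:
  assumes R: "bounded_comb a W R"
  shows "\<exists>\<rho>\<ge>0. \<forall>w\<in>W. \<forall>l\<le>n. \<forall>j<m l. norm (nth_deriv_on {0..a} j (R w) (node l)) \<le> \<rho>"
proof -
  have "\<forall>j. \<exists>C\<ge>0. \<forall>w\<in>W. \<forall>x\<in>{0..a}. norm (nth_deriv_on {0..a} j (R w) x) \<le> C"
    using bounded_comb_bound[OF bounded_comb_nth_deriv[OF a_pos R]] by metis
  then obtain C where C: "\<And>j. C j \<ge> 0" "\<And>j w x. w \<in> W \<Longrightarrow> x \<in> {0..a} \<Longrightarrow> norm (nth_deriv_on {0..a} j (R w) x) \<le> C j"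
    by metis
  define J where "J = (\<Sum>l=0..n. m l)"
  have "norm (nth_deriv_on {0..a} j (R w) (node l)) \<le> (\<Sum>j<J. C j)" if "w \<in> W" "l \<le> n" "j < m l" for w l j
  proof -
    have "m l \<le> J" unfolding J_def by (rule member_le_sum) (use that in auto)
    then have "C j \<le> (\<Sum>j<J. C j)" by (intro member_le_sum) (use that C(1) in auto)
    then show ?thesis using C(2)[OF that(1) node_mem[OF that(2)], of j] by linarith
  qed
  moreover have "(\<Sum>j<J. C j) \<ge> 0" using C(1) by (simp add: sum_nonneg)
  ultimately show ?thesis by blast
qed

text \<open>The operator multiplies the unknowns by at most \<open>w\<close>, which is compensated by their decay; so the residual is
  a combination of the data and of the fixed columns with bounded coefficients.\<close>

lemma levin_residual_family:
  assumes C: "C \<ge> 0" and w1: "\<forall>w\<in>W. w \<ge> 1"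
    and bound: "\<forall>w\<in>W. \<forall>R c \<rho> i. levin_system a \<alpha> g n node m M \<phi> w R c \<longrightarrow> \<rho> \<ge> 0 \<longrightarrow>
      (\<forall>l\<le>n. \<forall>j<m l. norm (nth_deriv_on {0..a} j R (node l)) \<le> \<rho>) \<longrightarrow> i \<le> M \<longrightarrow> norm (c i) \<le> C * \<rho> / w"
    and R: "bounded_comb a W R"
    and sol: "\<forall>w\<in>W. levin_system a \<alpha> g n node m M \<phi> w (R w) (c w)"
  shows "bounded_comb a W (\<lambda>w. lin_comb M \<phi> (c w))"
    and "bounded_comb a W (\<lambda>w x. R w x - levin_op a \<alpha> g w (c w 0) (lin_comb M \<phi> (c w)) x)"
    and "\<And>w l. w \<in> W \<Longrightarrow> l \<le> n \<Longrightarrow>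
      vanishes a (node l) (m l) (\<lambda>x. R w x - levin_op a \<alpha> g w (c w 0) (lin_comb M \<phi> (c w)) x)"
proof -
  obtain \<rho> where rho: "\<rho> \<ge> 0" "\<forall>w\<in>W. \<forall>l\<le>n. \<forall>j<m l. norm (nth_deriv_on {0..a} j (R w) (node l)) \<le> \<rho>"
    using collocation_data_bound[OF R] by blast
  have c: "norm (c w i) \<le> C * \<rho> / w" if "w \<in> W" "i \<le> M" for w i
    using bound[rule_format, OF that(1) sol[rule_format, OF that(1)] rho(1) _ that(2)] rho(2) that(1) by blast
  have wc: "norm (w * c w i) \<le> C * \<rho>" if "w \<in> W" "i \<le> M" for w i
    using c[OF that] w1[rule_format, OF that(1)] by (simp add: norm_mult field_simps)
  have c': "norm (c w i) \<le> C * \<rho>" if "w \<in> W" "i \<le> M" for w i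
  proof -
    have "norm (c w i) \<le> w * norm (c w i)" using w1[rule_format, OF that(1)] mult_right_mono[of 1 w "norm (c w i)"] by simp
    then show ?thesis using wc[OF that] w1[rule_format, OF that(1)] by (simp add: norm_mult)
  qed
  have bc: "bounded ((\<lambda>w. c w i) ` W)" if "i \<le> M" for i
    unfolding bounded_iff using c' that by blast
  have bwc: "bounded ((\<lambda>w. w * c w i) ` W)" if "i \<le> M" for i
    unfolding bounded_iff using wc that by blast
  show q: "bounded_comb a W (\<lambda>w. lin_comb M \<phi> (c w))"
    unfolding lin_comb_def[abs_def]
    by (intro bounded_comb_sum a_pos bounded_comb.single smooth_basis bc) auto
  have "bounded_comb a W (\<lambda>w x. \<Sum>i<Suc M. (w * c w i) * lead_col i x + c w i * rest_col i x)"
    by (intro bounded_comb_sum a_pos bounded_comb.add bounded_comb.single smooth_lead_col smooth_rest_col bc bwc) auto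
  then have L: "bounded_comb a W (\<lambda>w x. levin_op a \<alpha> g w (c w 0) (lin_comb M \<phi> (c w)) x)"
  proof (rule bounded_comb.cong)
    fix w x assume x: "x \<in> {0..a}"
    show "(\<Sum>i<Suc M. (w * c w i) * lead_col i x + c w i * rest_col i x)
      = levin_op a \<alpha> g w (c w 0) (lin_comb M \<phi> (c w)) x"
      unfolding levin_op_expand[OF x] by (intro sum.cong) (auto simp: algebra_simps)
  qed
  show "bounded_comb a W (\<lambda>w x. R w x - levin_op a \<alpha> g w (c w 0) (lin_comb M \<phi> (c w)) x)"
    by (intro bounded_comb_diff a_pos R L)
  fix w l assume w: "w \<in> W" and l: "l \<le> n"
  show "vanishes a (node l) (m l) (\<lambda>x. R w x - levin_op a \<alpha> g w (c w 0) (lin_comb M \<phi> (c w)) x)"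
  proof (rule vanishes_diffI[OF a_pos node_mem[OF l]])
    show "smooth_on {0..a} (R w)" by (rule bounded_comb_smooth[OF a_pos R w])
    show "smooth_on {0..a} (levin_op a \<alpha> g w (c w 0) (lin_comb M \<phi> (c w)))"
      by (intro levin_op_smooth lin_comb_smooth)
  qed (use sol[rule_format, OF w] l in \<open>auto simp: levin_system_def\<close>)
qed

text \<open>The algebraic rule is the special case of the bracket in which the logarithmic unknowns are zero.\<close>

lemma levin_alg_eq_integral:
  fixes F :: "real \<Rightarrow> complex"
  assumes al: "-1 < \<alpha>" and w: "w \<ge> 0"
  defines "c \<equiv> levin_solution a \<alpha> g n node m M \<phi> w (alg_part a \<alpha> g F)"
  shows "levin_alg a \<alpha> g n node m M \<phi> w F =
    integral {0..a} (\<lambda>x. amp \<alpha> x 0 (levin_op a \<alpha> g w (c 0) (lin_comb M \<phi> c) x) * osc w x)"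
proof -
  have "levin_alg a \<alpha> g n node m M \<phi> w F = bracket a (\<lambda>y.
          ((0 * complex_of_real (ln (g y)) + lin_comb M \<phi> c y) * complex_of_real (g y powr (1 + \<alpha>))
           + (0 * complex_of_real (ln (g y)) + c 0) *
               (1 - exp (- \<i> * complex_of_real w * complex_of_real (g y))) *
               complex_of_real (g y powr \<alpha>)
           + exp (- \<i> * complex_of_real w * complex_of_real (g y)) *
               integral {0..y} (\<lambda>t.
                 (complex_of_real \<alpha> * 0 * complex_of_real (ln (g t)) + complex_of_real \<alpha> * c 0 + 0) *
                 complex_of_real (dg t) *
                 ((1 - osc w t) / complex_of_real (g t powr (1 - \<alpha>))))) * osc w y)"
    unfolding levin_alg_def Let_def c_def[symmetric]
  proof (rule arg_cong[where f = "bracket a"], rule ext)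
    fix y
    have "integral {0..y} (\<lambda>t. (complex_of_real \<alpha> * 0 * complex_of_real (ln (g t)) + complex_of_real \<alpha> * c 0 + 0) *
                 complex_of_real (dg t) * ((1 - osc w t) / complex_of_real (g t powr (1 - \<alpha>))))
      = integral {0..y} (\<lambda>t. (complex_of_real \<alpha> * c 0) * (complex_of_real (dg t) * (1 - osc w t) / complex_of_real (g t powr (1 - \<alpha>))))"
      by (rule integral_cong) simp
    also have "\<dots> = (complex_of_real \<alpha> * c 0) * integral {0..y} (\<lambda>t. complex_of_real (dg t) * (1 - osc w t) / complex_of_real (g t powr (1 - \<alpha>)))"
      by (rule integral_mult_right)
    finally have i: "integral {0..y} (\<lambda>t. (complex_of_real \<alpha> * 0 * complex_of_real (ln (g t)) + complex_of_real \<alpha> * c 0 + 0) *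
                 complex_of_real (dg t) * ((1 - osc w t) / complex_of_real (g t powr (1 - \<alpha>))))
      = (complex_of_real \<alpha> * c 0) * integral {0..y} (\<lambda>t. complex_of_real (dg t) * (1 - osc w t) / complex_of_real (g t powr (1 - \<alpha>)))" .
    show "(complex_of_real (g y powr (\<alpha> + 1)) * lin_comb M \<phi> c y +
           c 0 * (1 - exp (- \<i> * complex_of_real w * complex_of_real (g y))) * complex_of_real (g y powr \<alpha>) +
           complex_of_real \<alpha> * c 0 * exp (- \<i> * complex_of_real w * complex_of_real (g y)) *
           integral {0..y} (\<lambda>t. complex_of_real (dg t) * (1 - osc w t) / complex_of_real (g t powr (1 - \<alpha>)))) * osc w y =
      ((0 * complex_of_real (ln (g y)) + lin_comb M \<phi> c y) * complex_of_real (g y powr (1 + \<alpha>))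
           + (0 * complex_of_real (ln (g y)) + c 0) *
               (1 - exp (- \<i> * complex_of_real w * complex_of_real (g y))) *
               complex_of_real (g y powr \<alpha>)
           + exp (- \<i> * complex_of_real w * complex_of_real (g y)) *
               integral {0..y} (\<lambda>t.
                 (complex_of_real \<alpha> * 0 * complex_of_real (ln (g t)) + complex_of_real \<alpha> * c 0 + 0) *
                 complex_of_real (dg t) *
                 ((1 - osc w t) / complex_of_real (g t powr (1 - \<alpha>))))) * osc w y"
      unfolding i by (simp only: mult_zero_left add_0_left add.commute[of \<alpha> 1] mult_ac)
  qed
  also have "\<dots> = integral {0..a} (\<lambda>x. amp \<alpha> x (levin_op a \<alpha> g w 0 (\<lambda>_. 0) x)
      (levin_op a \<alpha> g w (c 0) (lin_comb M \<phi> c) x + complex_of_real (dg x) * 0) * osc w x)"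
    by (rule levin_bracket_eq_integral[OF al w smooth_on_const[OF a_pos] lin_comb_smooth])
  also have "\<dots> = integral {0..a} (\<lambda>x. amp \<alpha> x 0 (levin_op a \<alpha> g w (c 0) (lin_comb M \<phi> c) x) * osc w x)"
    by (rule integral_cong) (simp add: levin_op_zero)
  finally show ?thesis .
qed

lemma levin_log_eq_integral:
  fixes f :: "real \<Rightarrow> complex"
  assumes al: "-1 < \<alpha>" and w: "w \<ge> 0"
  defines "c \<equiv> levin_solution a \<alpha> g n node m M \<phi> w (alg_part a \<alpha> g f)"
  defines "d \<equiv> levin_solution a \<alpha> g n node m M \<phi> w (\<lambda>y. - lin_comb M \<phi> c y * complex_of_real (dg y))"
  shows "levin_log a \<alpha> g n node m M \<phi> w f = levin_alg a \<alpha> g n node m M \<phi> w (log_part a g f) +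
    integral {0..a} (\<lambda>x. amp \<alpha> x (levin_op a \<alpha> g w (c 0) (lin_comb M \<phi> c) x)
      (levin_op a \<alpha> g w (d 0) (lin_comb M \<phi> d) x + dg x * lin_comb M \<phi> c x) * osc w x)"
  unfolding levin_log_def Let_def c_def[symmetric] d_def[symmetric]
  by (simp only: levin_bracket_eq_integral[OF al w lin_comb_smooth lin_comb_smooth])

text \<open>The right-hand side \<open>R\<close> of the second system is chosen to compensate the extra term \<open>g' q\<close> that stems from
  differentiating \<open>ln g\<close>; hence only residuals of the three systems remain.\<close>

lemma levin_error_eq:
  fixes f :: "real \<Rightarrow> complex"
  assumes al: "-1 < \<alpha>" and w: "w \<ge> 0" and f: "smooth_on {0..a} f"
  defines "f1 \<equiv> alg_part a \<alpha> g f" and "f2 \<equiv> alg_part a \<alpha> g (log_part a g f)"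
  defines "c \<equiv> levin_solution a \<alpha> g n node m M \<phi> w f1"
  defines "R \<equiv> \<lambda>y. - lin_comb M \<phi> c y * complex_of_real (dg y)"
  defines "d \<equiv> levin_solution a \<alpha> g n node m M \<phi> w R"
  defines "\<gamma> \<equiv> levin_solution a \<alpha> g n node m M \<phi> w f2"
  shows "integral {0..a} (\<lambda>y. f y * complex_of_real (y powr \<alpha>) * complex_of_real (ln y) * osc w y)
      - levin_log a \<alpha> g n node m M \<phi> w f
    = integral {0..a} (\<lambda>x. amp \<alpha> x (f1 x - levin_op a \<alpha> g w (c 0) (lin_comb M \<phi> c) x)
        ((f2 x - levin_op a \<alpha> g w (\<gamma> 0) (lin_comb M \<phi> \<gamma>) x)
         + (R x - levin_op a \<alpha> g w (d 0) (lin_comb M \<phi> d) x)) * osc w x)"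
proof -
  let ?I = "\<lambda>u v. (\<lambda>x. amp \<alpha> x (u x) (v x) * osc w x)"
  let ?L = "\<lambda>c. levin_op a \<alpha> g w (c 0) (lin_comb M \<phi> c)"
  have sm: "smooth_on {0..a} f1" "smooth_on {0..a} f2" "smooth_on {0..a} (?L c)" "smooth_on {0..a} (?L \<gamma>)"
    "smooth_on {0..a} (\<lambda>x. ?L d x + dg x * lin_comb M \<phi> c x)" "smooth_on {0..a} (\<lambda>_. 0 :: complex)"
    unfolding f1_def f2_def
    by (intro smooth_alg_part smooth_log_part f levin_op_smooth lin_comb_smooth smooth_on_add smooth_on_mult smooth_dg
        smooth_on_const a_pos)+
  note int = amp_osc_integrable[OF al]
  have "integral {0..a} (\<lambda>y. f y * complex_of_real (y powr \<alpha>) * complex_of_real (ln y) * osc w y) = integral {0..a} (?I f1 f2)"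
    by (rule integral_cong) (simp only: singular_integrand_eq_amp f1_def f2_def)
  moreover have "levin_log a \<alpha> g n node m M \<phi> w f = integral {0..a} (?I (\<lambda>_. 0) (?L \<gamma>))
      + integral {0..a} (?I (?L c) (\<lambda>x. ?L d x + dg x * lin_comb M \<phi> c x))"
    using levin_log_eq_integral[OF al w, of f] levin_alg_eq_integral[OF al w, of "log_part a g f"]
    unfolding f1_def f2_def c_def d_def R_def \<gamma>_def by simp
  moreover have "((\<lambda>x. ?I f1 f2 x - (?I (\<lambda>_. 0) (?L \<gamma>) x + ?I (?L c) (\<lambda>x. ?L d x + dg x * lin_comb M \<phi> c x) x)) has_integral
     integral {0..a} (?I f1 f2) - (integral {0..a} (?I (\<lambda>_. 0) (?L \<gamma>))
      + integral {0..a} (?I (?L c) (\<lambda>x. ?L d x + dg x * lin_comb M \<phi> c x)))) {0..a}"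
    by (intro has_integral_diff has_integral_add integrable_integral int sm)
  moreover have "(\<lambda>x. ?I f1 f2 x - (?I (\<lambda>_. 0) (?L \<gamma>) x + ?I (?L c) (\<lambda>x. ?L d x + dg x * lin_comb M \<phi> c x) x))
    = (\<lambda>x. amp \<alpha> x (f1 x - ?L c x) ((f2 x - ?L \<gamma> x) + (R x - ?L d x)) * osc w x)"
    unfolding amp_def R_def by (rule ext) (simp add: algebra_simps)
  ultimately show ?thesis by (simp add: integral_unique)
qed

lemma levin_error_bound:
  assumes al: "-1 < \<alpha>" "\<alpha> \<noteq> 0" "\<alpha> < 1" and f: "smooth_on {0..a} f"
  shows "\<exists>K w1. \<forall>w\<ge>w1. norm (integral {0..a} (\<lambda>y. f y * complex_of_real (y powr \<alpha>) * complex_of_real (ln y) * osc w y)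
      - levin_log a \<alpha> g n node m M \<phi> w f) \<le> K * delta \<alpha> w * w powr (- real s - 1 - min (1 + \<alpha>) 1)"
proof -
  obtain C w0 where C: "C \<ge> 0"
    and ex1: "\<forall>w\<ge>w0. \<forall>R. \<exists>!c. levin_system a \<alpha> g n node m M \<phi> w R c"
    and bound: "\<forall>w\<ge>w0. \<forall>R c \<rho> i. levin_system a \<alpha> g n node m M \<phi> w R c \<longrightarrow> \<rho> \<ge> 0 \<longrightarrow>
      (\<forall>l\<le>n. \<forall>j<m l. norm (nth_deriv_on {0..a} j R (node l)) \<le> \<rho>) \<longrightarrow> i \<le> M \<longrightarrow> norm (c i) \<le> C * \<rho> / w"
    using levin_system_large_parameter by (elim exE conjE) (rule that)
  define w1 where "w1 = max w0 (max 1 (1 / a))"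
  define W where "W = {w1..}"
  have W: "w \<ge> 1 \<and> w \<ge> 1 / a" "w \<ge> w0" "w \<ge> 1" "w \<ge> 0" if "w \<in> W" for w
    using that by (auto simp: W_def w1_def)
  define f1 f2 where "f1 = alg_part a \<alpha> g f" and "f2 = alg_part a \<alpha> g (log_part a g f)"
  define c where "c w = levin_solution a \<alpha> g n node m M \<phi> w f1" for w
  define R where "R w y = - lin_comb M \<phi> (c w) y * complex_of_real (dg y)" for w y
  define d where "d w = levin_solution a \<alpha> g n node m M \<phi> w (R w)" for w
  define \<gamma> where "\<gamma> w = levin_solution a \<alpha> g n node m M \<phi> w f2" for w
  have sol: "levin_system a \<alpha> g n node m M \<phi> w Q (levin_solution a \<alpha> g n node m M \<phi> w Q)" if "w \<in> W" for w Q
    unfolding levin_solution_def by (rule theI'[of "levin_system a \<alpha> g n node m M \<phi> w Q"]) (rule ex1[rule_format, OF W(2)[OF that]])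
  have fam_bound: "\<forall>w\<in>W. \<forall>R c \<rho> i. levin_system a \<alpha> g n node m M \<phi> w R c \<longrightarrow> \<rho> \<ge> 0 \<longrightarrow>
      (\<forall>l\<le>n. \<forall>j<m l. norm (nth_deriv_on {0..a} j R (node l)) \<le> \<rho>) \<longrightarrow> i \<le> M \<longrightarrow> norm (c i) \<le> C * \<rho> / w"
    using bound W(2) by blast
  have W1: "\<forall>w\<in>W. w \<ge> 1" using W(3) by blast
  note family = levin_residual_family[OF C W1 fam_bound]
  have b1: "bounded_comb a W (\<lambda>_. f1)" and b2: "bounded_comb a W (\<lambda>_. f2)"
    unfolding f1_def f2_def by (intro bounded_comb_fixed smooth_alg_part smooth_log_part f)+
  have sc: "\<forall>w\<in>W. levin_system a \<alpha> g n node m M \<phi> w f1 (c w)"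
    and sg: "\<forall>w\<in>W. levin_system a \<alpha> g n node m M \<phi> w f2 (\<gamma> w)"
    and sd: "\<forall>w\<in>W. levin_system a \<alpha> g n node m M \<phi> w (R w) (d w)"
    unfolding c_def \<gamma>_def d_def using sol by blast+
  note c = family[OF b1 sc] and g = family[OF b2 sg]
  have bR: "bounded_comb a W R"
  proof (rule bounded_comb.cong)
    show "bounded_comb a W (\<lambda>w x. (-1) * (lin_comb M \<phi> (c w) x * complex_of_real (dg x)))"
      by (intro bounded_comb_cmult bounded_comb_mult smooth_dg c(1) a_pos)
  qed (simp add: R_def)
  note d = family[OF bR sd]
  define E where "E w x = f1 x - levin_op a \<alpha> g w (c w 0) (lin_comb M \<phi> (c w)) x" for w x
  define F where "F w x = (f2 x - levin_op a \<alpha> g w (\<gamma> w 0) (lin_comb M \<phi> (\<gamma> w)) x)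
    + (R w x - levin_op a \<alpha> g w (d w 0) (lin_comb M \<phi> (d w)) x)" for w x
  have bE: "bounded_comb a W E" unfolding E_def by (rule c(2))
  have bF: "bounded_comb a W F" unfolding F_def by (rule bounded_comb.add[OF g(2) d(2)])
  have van: "vanishes a (node l) (m l) (E w) \<and> vanishes a (node l) (m l) (F w)" if w: "w \<in> W" and l: "l \<le> n" for w l
    unfolding E_def F_def
    by (intro conjI c(3) vanishes_add a_pos bounded_comb_smooth[OF a_pos g(2) w] bounded_comb_smooth[OF a_pos d(2) w]
        node_mem g(3) d(3) w l)
  have "\<exists>K\<ge>0. \<forall>w\<in>W. norm (integral {0..a} (\<lambda>x. amp (\<alpha> - real 0) x (E w x) (F w x) * osc w x))
      \<le> K * delta \<alpha> w * w powr (- real (Suc s) - min (1 + \<alpha>) 1)"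
    by (rule osc_integral_decay[OF al W(1) bE bF]) (use van[of _ 0] van[of _ n] node_0 node_n m_0 m_n in auto)
  moreover have "\<alpha> - real 0 = \<alpha>" "- real (Suc s) - min (1 + \<alpha>) 1 = - real s - 1 - min (1 + \<alpha>) 1"
    by simp_all
  ultimately obtain K where K: "\<forall>w\<in>W. norm (integral {0..a} (\<lambda>x. amp \<alpha> x (E w x) (F w x) * osc w x))
      \<le> K * delta \<alpha> w * w powr (- real s - 1 - min (1 + \<alpha>) 1)"
    by (elim exE conjE) (simp only:)
  have "norm (integral {0..a} (\<lambda>y. f y * complex_of_real (y powr \<alpha>) * complex_of_real (ln y) * osc w y)
      - levin_log a \<alpha> g n node m M \<phi> w f) \<le> K * delta \<alpha> w * w powr (- real s - 1 - min (1 + \<alpha>) 1)" if w: "w \<in> W" for w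
    using K[rule_format, OF w] levin_error_eq[OF al(1) W(4)[OF w] f]
    unfolding E_def F_def f1_def f2_def R_def[abs_def] c_def d_def \<gamma>_def by simp
  then show ?thesis unfolding W_def by (intro exI[of _ K] exI[of _ w1]) auto
qed

end

theorem theorem3p1:
  fixes a \<alpha> :: real
    and f :: "real \<Rightarrow> complex" and g :: "real \<Rightarrow> real"
    and n s M :: nat and x :: "nat \<Rightarrow> real" and m :: "nat \<Rightarrow> nat"
    and \<phi> :: "nat \<Rightarrow> real \<Rightarrow> complex"
  assumes "a > 0"
    and "0 < \<bar>\<alpha>\<bar>" and "\<bar>\<alpha>\<bar> < 1"
    and "smooth_on {0..a} f" and "smooth_on {0..a} g"
    and "g 0 = 0" and "\<forall>y\<in>{0..a}. deriv_on a g y > 0"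
    and "x 0 = 0" and "x n = a" and "\<forall>l<n. x l < x (Suc l)"
    and "\<forall>l\<in>{0..n}. m l \<ge> 1" and "m 0 = s + 1" and "m n = s + 1"
    and "M = (\<Sum>j=0..n. m j) - 1"
    and "\<forall>j\<in>{1..M}. smooth_on {0..a} (\<phi> j)"
    and "chebyshev_set {0..a} M \<phi>"
  shows "(\<forall>\<^sub>F w in at_top.
            (\<exists>!c. levin_system a \<alpha> g n x m M \<phi> w (alg_part a \<alpha> g f) c) \<and>
            (\<forall>c. levin_system a \<alpha> g n x m M \<phi> w (alg_part a \<alpha> g f) c \<longrightarrow>
               (\<exists>!d. levin_system a \<alpha> g n x m M \<phi> w
                       (\<lambda>y. - lin_comb M \<phi> c y * complex_of_real (deriv_on a g y)) d))) \<and>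
         (\<lambda>w. norm (integral {0..a} (\<lambda>y. f y * complex_of_real (y powr \<alpha>) * complex_of_real (ln y) *
                        exp (\<i> * complex_of_real w * complex_of_real (g y)))
                     - levin_log a \<alpha> g n x m M \<phi> w f))
           \<in> O[at_top](\<lambda>w. delta \<alpha> w * w powr (- real s - 1 - min (1 + \<alpha>) 1))"
proof -
  have al: "-1 < \<alpha>" "\<alpha> \<noteq> 0" "\<alpha> < 1" using assms(2,3) by auto
  interpret levin_collocation a g \<alpha> n s M x m \<phi>
  proof
    show "deriv_on a g y > 0" if "y \<in> {0..a}" for y using assms(7) that by blast
    show "x l < x (Suc l)" if "l < n" for l using assms(10) that by blast
    show "m l \<ge> 1" if "l \<le> n" for l using assms(11) that by simp
    show "smooth_on {0..a} (\<phi> j)" if "j \<in> {1..M}" for j using assms(15) that by blast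
  qed (rule assms)+
  obtain w0 where w0: "\<forall>w\<ge>w0. \<forall>R. \<exists>!c. levin_system a \<alpha> g n x m M \<phi> w R c"
    using levin_system_large_parameter by (elim exE conjE) (rule that)
  have "\<forall>\<^sub>F w in at_top.
            (\<exists>!c. levin_system a \<alpha> g n x m M \<phi> w (alg_part a \<alpha> g f) c) \<and>
            (\<forall>c. levin_system a \<alpha> g n x m M \<phi> w (alg_part a \<alpha> g f) c \<longrightarrow>
               (\<exists>!d. levin_system a \<alpha> g n x m M \<phi> w
                       (\<lambda>y. - lin_comb M \<phi> c y * complex_of_real (deriv_on a g y)) d))"
    by (rule eventually_at_top_linorderI[of w0]) (intro conjI allI impI w0[rule_format])
  moreover obtain K w1 where K: "\<forall>w\<ge>w1. norm (integral {0..a} (\<lambda>y. f y * complex_of_real (y powr \<alpha>) * complex_of_real (ln y) * osc w y)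
      - levin_log a \<alpha> g n x m M \<phi> w f) \<le> K * delta \<alpha> w * w powr (- real s - 1 - min (1 + \<alpha>) 1)"
    using levin_error_bound[OF al assms(4)] by blast
  have "(\<lambda>w. norm (integral {0..a} (\<lambda>y. f y * complex_of_real (y powr \<alpha>) * complex_of_real (ln y) * osc w y)
      - levin_log a \<alpha> g n x m M \<phi> w f)) \<in> O[at_top](\<lambda>w. delta \<alpha> w * w powr (- real s - 1 - min (1 + \<alpha>) 1))"
  proof (rule bigoI[of _ K], rule eventually_at_top_linorderI[of w1])
    fix w assume "w \<ge> w1"
    moreover have "0 \<le> delta \<alpha> w * w powr (- real s - 1 - min (1 + \<alpha>) 1)"
      using delta_ge_1[of \<alpha> w] by simp
    ultimately show "norm (norm (integral {0..a} (\<lambda>y. f y * complex_of_real (y powr \<alpha>) * complex_of_real (ln y) * osc w y)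
      - levin_log a \<alpha> g n x m M \<phi> w f)) \<le> K * norm (delta \<alpha> w * w powr (- real s - 1 - min (1 + \<alpha>) 1))"
      using K by (simp add: mult.assoc)
  qed
  ultimately show ?thesis by blast
qed

end
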